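(* Let $\omega,c,\lambda_{1},\lambda_{2},p_{1},p_{2}$ be non-zero (complex) constants, and let $q,Q$ be polynomials in $z$ such that $Q$ is not a constant and $q\not\equiv0$. If $f$ is a transcendental entire solution with finite order of $$f^{3}(z)+\omega f^{2}(z)f'(z)+q(z)e^{Q(z)}f(z+c)=p_{1}e^{\lambda_{1}z}+p_{2}e^{\lambda_{2}z}$$ satisfying $$N_{1)}\!\left(r,\frac1f\right)<(\kappa+o(1))\,T(r,f),$$ where $0\leq\kappa<1$, then $\sigma(f)=\deg Q=1$.
   Context: For an entire function $f$, $T(r,f)$ is the Nevanlinna characteristic, $\sigma(f)=\limsup_{r\to\infty}\frac{\log^{+} T(r,f)}{\log r}$ is the order of growth of $f$, and $N_{1)}(r,1/f)$ denotes the (integrated) Nevanlinna counting function corresponding to the simple zeros of $f$, i.e. zeros of multiplicity exactly $1$. The term $o(1)$ is as $r\to\infty$.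
   Formalization: The formal theorem also assumes that the right-hand side is not identically zero (λ₁ ≠ λ₂ or p₁ + p₂ ≠ 0); without this, f = e^{z²} with λ₁ = λ₂, p₂ = −p₁, ω = c = 1, q = −(1+2z), Q = 2z²−2z−1 is a counterexample of order 2. *)

theory Defs
  imports "HOL-Complex_Analysis.Complex_Analysis" "HOL-Library.Landau_Symbols"
begin

definition log_plus :: "real \<Rightarrow> real" where
  "log_plus x = ln (max 1 x)"

definition entire :: "(complex \<Rightarrow> complex) \<Rightarrow> bool" where
  "entire f \<longleftrightarrow> f holomorphic_on UNIV"

definition transcendental_entire :: "(complex \<Rightarrow> complex) \<Rightarrow> bool" where
  "transcendental_entire f \<longleftrightarrow> entire f \<and> \<not> (\<exists>p. f = poly p)"

definition proximity_fun :: "real \<Rightarrow> (complex \<Rightarrow> complex) \<Rightarrow> real" where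
  "proximity_fun r f =
     1 / (2 * pi) * integral {0..2 * pi} (\<lambda>\<theta>. log_plus (norm (f (of_real r * cis \<theta>))))"

text \<open>The integrated counting function belonging to an unintegrated one \<open>n\<close>, where
  \<open>n t\<close> counts points in the closed disc of radius \<open>t\<close>.\<close>

definition integrated_count :: "(real \<Rightarrow> nat) \<Rightarrow> real \<Rightarrow> real" where
  "integrated_count n r =
     integral {0..r} (\<lambda>t. (real (n t) - real (n 0)) / t) + real (n 0) * ln r"

text \<open>Poles are counted with multiplicity; \<open>zorder\<close> is minus the multiplicity at a pole.\<close>

definition pole_count :: "(complex \<Rightarrow> complex) \<Rightarrow> real \<Rightarrow> nat" where
  "pole_count f t = (\<Sum>z | norm z \<le> t \<and> is_pole f z. nat (- zorder f z))"

definition nevanlinna_char :: "real \<Rightarrow> (complex \<Rightarrow> complex) \<Rightarrow> real" where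
  "nevanlinna_char r f = proximity_fun r f + integrated_count (pole_count f) r"

definition growth_order :: "(complex \<Rightarrow> complex) \<Rightarrow> ereal" where
  "growth_order f = Limsup at_top (\<lambda>r. ereal (log_plus (nevanlinna_char r f) / ln r))"

definition simple_zero_count :: "(complex \<Rightarrow> complex) \<Rightarrow> real \<Rightarrow> nat" where
  "simple_zero_count f t = card {z. norm z \<le> t \<and> f z = 0 \<and> zorder f z = 1}"

text \<open>This is \<open>N\<^sub>1\<^sub>)(r, 1/f)\<close>.\<close>

definition simple_zero_counting :: "real \<Rightarrow> (complex \<Rightarrow> complex) \<Rightarrow> real" where
  "simple_zero_counting r f = integrated_count (simple_zero_count f) r"

end

theory Submission
  imports Defs "HOL-Real_Asymp.Real_Asymp"
begin

text \<open>Write \<open>P\<close> for the right-hand side, \<open>F = f\<^sup>2 (f + \<omega> f')\<close> and \<open>H = q e\<^sup>Q f(z + c)\<close>, so that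
  \<open>F + H = P\<close>, and let \<open>W = F H' - F' H\<close>. All counting is done by applying Jensen's formula to entire
  functions on circles that stay away from their zeros.

  If \<open>\<sigma>(f) > 1\<close>, then \<open>P\<close> is small compared with \<open>f\<close>. Cartan's argument for \<open>f\<^sup>3 H / W\<close> bounds
  \<open>3 T(r, f)\<close> by twice the counting function of the distinct zeros of \<open>f\<close> plus that of \<open>f(z + c)\<close>, up
  to \<open>O(r)\<close>: a zero of \<open>f\<close> of order \<open>k\<close> is a zero of \<open>F\<close> of order at least \<open>3 k - 1\<close>, so that
  \<open>f\<^sup>3 / W\<close> keeps at most two of its \<open>3 k\<close> zeros. The first term is at most \<open>N\<^sub>1\<^sub>)(r, 1/f) + T(r, f)\<close> and
  the second at most \<open>(1 + o(1)) T(r, f)\<close> along suitable radii, which contradicts \<open>\<kappa> < 1\<close>. Hence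
  \<open>\<sigma>(f) \<le> 1\<close>; then \<open>e\<^sup>Q = (P - F) / (q f(z + c))\<close> has order at most one, so \<open>deg Q = 1\<close>. Finally, if
  \<open>\<sigma>(f) < 1\<close>, Borel's theorem on the independence of exponentials gives \<open>F = 0\<close>, hence
  \<open>f = k e\<^sup>-\<^sup>z\<^sup>/\<^sup>\<omega>\<close>, and a second application gives \<open>f = 0\<close>.\<close>

section \<open>Circle means and the Poisson formula\<close>

text \<open>Errors of size O(r) are harmless, because the case to be refuted has T(r, f) \<ge> r^s
  with s > 1 for arbitrarily large r. Hence a crude form of the lemma on the logarithmic derivative
  is enough, and it is enough to find one usable circle in every annulus r < |z| < r + 1; zeros are
  sparse enough for such a circle to keep its distance from them. The real obstacle is the shift:
  T(r, f(z + c)) is controlled by T at a radius slightly beyond r + |c|, and the comparison may cost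
  only a factor close to one, since the margin 1 - \<kappa> can be arbitrarily small. Finite order
  supplies large radii at which T grows this slowly and is at least r^s as well; a single one of
  them refutes the bound, whose leading coefficients read 3 \<le> (\<kappa> + 1) + 1. If W vanishes
  identically, the quotient f^3 H / W makes no sense; F is then a constant multiple of P, and T(r,
  f) is bounded directly.\<close>

definition circle_mean :: "real \<Rightarrow> (complex \<Rightarrow> real) \<Rightarrow> real" where
  "circle_mean r u = 1 / (2 * pi) * integral {0..2 * pi} (\<lambda>\<theta>. u (of_real r * cis \<theta>))"

lemma circle_mean_integrable:
  fixes u :: "complex \<Rightarrow> real"
  assumes "0 \<le> r" "continuous_on (sphere 0 r) u"
  shows "(\<lambda>\<theta>. u (of_real r * cis \<theta>)) integrable_on {a..b}"
proof -
  have "continuous_on {a..b} (\<lambda>\<theta>. u (of_real r * cis \<theta>))"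
    by (rule continuous_on_compose2[OF assms(2)])
       (use assms(1) in \<open>auto intro!: continuous_intros simp: norm_mult\<close>)
  then show ?thesis
    by (rule integrable_continuous_real)
qed

lemma circle_mean_cong:
  assumes "0 \<le> r" "\<And>z. norm z = r \<Longrightarrow> u z = v z"
  shows "circle_mean r u = circle_mean r v"
  unfolding circle_mean_def using assms by (simp add: norm_mult)

lemma circle_mean_mono:
  assumes "0 \<le> r" "continuous_on (sphere 0 r) u" "continuous_on (sphere 0 r) v"
    and "\<And>z. norm z = r \<Longrightarrow> u z \<le> v z"
  shows "circle_mean r u \<le> circle_mean r v"
  unfolding circle_mean_def
  by (intro mult_left_mono integral_le circle_mean_integrable assms) (use assms(1) in \<open>auto simp: norm_mult\<close>)

lemma circle_mean_add:
  assumes "0 \<le> r" "continuous_on (sphere 0 r) u" "continuous_on (sphere 0 r) v"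
  shows "circle_mean r (\<lambda>z. u z + v z) = circle_mean r u + circle_mean r v"
  unfolding circle_mean_def
  by (subst integral_add) (auto intro!: circle_mean_integrable assms simp: distrib_left)

lemma circle_mean_cmult: "circle_mean r (\<lambda>z. c * u z) = c * circle_mean r u"
  unfolding circle_mean_def by simp

lemma circle_mean_const [simp]: "circle_mean r (\<lambda>z. c) = c"
  unfolding circle_mean_def by simp

lemma circle_mean_diff:
  assumes "0 \<le> r" "continuous_on (sphere 0 r) u" "continuous_on (sphere 0 r) v"
  shows "circle_mean r (\<lambda>z. u z - v z) = circle_mean r u - circle_mean r v"
  unfolding circle_mean_def
  by (subst integral_diff) (auto intro!: circle_mean_integrable assms simp: right_diff_distrib)

lemma circle_mean_sum:
  assumes "0 \<le> r" "finite I" "\<And>i. i \<in> I \<Longrightarrow> continuous_on (sphere 0 r) (u i)"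
  shows "circle_mean r (\<lambda>z. \<Sum>i\<in>I. u i z) = (\<Sum>i\<in>I. circle_mean r (u i))"
  using assms(2,3)
proof (induction I rule: finite_induct)
  case (insert i I)
  then show ?case
    by (simp add: circle_mean_add assms(1) continuous_on_sum)
qed simp

lemma circle_mean_nonneg:
  assumes "0 \<le> r" "continuous_on (sphere 0 r) u" "\<And>z. norm z = r \<Longrightarrow> 0 \<le> u z"
  shows "0 \<le> circle_mean r u"
  using circle_mean_mono[of r "\<lambda>_. 0" u] assms by simp

lemma circle_mean_le_const:
  assumes "0 \<le> r" "continuous_on (sphere 0 r) u" "\<And>z. norm z = r \<Longrightarrow> u z \<le> c"
  shows "circle_mean r u \<le> c"
  using circle_mean_mono[of r u "\<lambda>_. c"] assms by simp

section \<open>Cauchy's formula on circles, the Poisson kernel and Poisson's formula\<close>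

lemma has_integral_Cauchy_circle:
  assumes "k holomorphic_on cball 0 r" "norm w < r"
  shows "((\<lambda>t. k (of_real r * cis t) * (of_real r * cis t) / (of_real r * cis t - w))
           has_integral (of_real (2 * pi) * k w)) {0..2 * pi}"
proof -
  have "((\<lambda>u. k u / (u - w)) has_contour_integral (2 * of_real pi * \<i> * k w)) (circlepath 0 r)"
    by (rule Cauchy_integral_circlepath_simple) (use assms in auto)
  then have "((\<lambda>t. k (of_real r * cis t) / (of_real r * cis t - w) * of_real r * \<i> * cis t)
      has_integral (2 * of_real pi * \<i> * k w)) {0..2 * pi}"
    unfolding circlepath_def by (subst (asm) has_contour_integral_part_circlepath_iff) auto
  \<comment> \<open>On the circle d\<zeta> = i \<zeta> dt; multiplication by -i leaves the factor
    \<zeta> in the integrand and 2 pi k(w) as the value.\<close>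
  from has_integral_mult_right[OF this, of "- \<i>"]
  show ?thesis
    by (simp add: algebra_simps)
qed

abbreviation poisson_kernel :: "complex \<Rightarrow> complex \<Rightarrow> real" where
  "poisson_kernel z \<zeta> \<equiv> Re ((\<zeta> + z) / (\<zeta> - z))"

lemma poisson_kernel_eq:
  assumes "norm \<zeta> = r" "norm z < r"
  shows "poisson_kernel z \<zeta> = (r\<^sup>2 - (norm z)\<^sup>2) / (norm (\<zeta> - z))\<^sup>2"
proof -
  have "Re ((\<zeta> + z) * cnj (\<zeta> - z)) = r\<^sup>2 - (norm z)\<^sup>2"
    unfolding assms(1)[symmetric] cmod_power2 by (simp add: algebra_simps power2_eq_square)
  then show ?thesis
    by (simp add: complex_div_cnj[of "\<zeta> + z"] Re_divide_of_real flip: of_real_power)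
qed

lemma poisson_kernel_pos:
  assumes "norm \<zeta> = r" "norm z < r"
  shows "poisson_kernel z \<zeta> > 0"
proof -
  have "(norm z)\<^sup>2 < r\<^sup>2" using assms by (intro power_strict_mono) auto
  moreover have "\<zeta> \<noteq> z" using assms by auto
  ultimately show ?thesis unfolding poisson_kernel_eq[OF assms] by simp
qed

lemma poisson_kernel_le:
  assumes "norm \<zeta> = r" "norm z < r"
  shows "poisson_kernel z \<zeta> \<le> (r + norm z) / (r - norm z)"
proof -
  have "norm ((\<zeta> + z) / (\<zeta> - z)) \<le> (r + norm z) / (r - norm z)"
    unfolding norm_divide using assms norm_triangle_ineq[of \<zeta> z] norm_triangle_ineq2[of \<zeta> z]
    by (intro frac_le) auto
  then show ?thesis using complex_Re_le_cmod order_trans by blast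
qed

lemma continuous_on_poisson_kernel:
  assumes "norm z < r"
  shows "continuous_on (sphere 0 r) (poisson_kernel z)"
  using assms by (intro continuous_intros) auto

text \<open>On the circle the conjugate of \<zeta> is r^2 / \<zeta>, so the kernel, half the sum of
  a quotient and its conjugate, equals \<zeta> / (\<zeta> - z) + \<zeta> cnj z / (r^2 - \<zeta> cnj
  z). The first term gives k(z) by Cauchy's formula. The second is holomorphic on the closed disc
  and vanishes at 0, so it contributes nothing.\<close>

lemma poisson_formula:
  assumes k: "k holomorphic_on cball 0 r" and z: "norm z < r"
  shows "circle_mean r (\<lambda>\<zeta>. poisson_kernel z \<zeta> * Re (k \<zeta>)) = Re (k z)"
proof -
  let ?c = "\<lambda>t. of_real r * cis t"
  have r: "0 < r" using z norm_ge_zero order_le_less_trans by blast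
  \<comment> \<open>The pole r^2 / cnj z of the second term lies outside the closed disc.\<close>
  have nz: "of_real (r\<^sup>2) - w * cnj z \<noteq> 0" if "norm w \<le> r" for w
  proof
    assume "of_real (r\<^sup>2) - w * cnj z = 0"
    then have "norm (w * cnj z) = r\<^sup>2"
      by (metis norm_of_real abs_of_nonneg zero_le_power2 eq_iff_diff_eq_0)
    moreover have "norm (w * cnj z) \<le> r * norm z"
      unfolding norm_mult using that by (auto intro: mult_right_mono)
    moreover have "r * norm z < r\<^sup>2" using z r by (simp add: power2_eq_square)
    ultimately show False by linarith
  qed
  have h1: "((\<lambda>t. k (?c t) * ?c t / (?c t - z)) has_integral (of_real (2 * pi) * k z)) {0..2 * pi}"
    by (rule has_integral_Cauchy_circle[OF k z])
  have "(\<lambda>w. k w * (w * cnj z) / (of_real (r\<^sup>2) - w * cnj z)) holomorphic_on cball 0 r"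
    using k nz by (intro holomorphic_intros) auto
  from has_integral_Cauchy_circle[OF this, of 0] r
  have h2: "((\<lambda>t. k (?c t) * (?c t * cnj z) / (of_real (r\<^sup>2) - ?c t * cnj z)) has_integral 0) {0..2 * pi}"
    by simp
  have eq: "k (?c t) * ?c t / (?c t - z) + k (?c t) * (?c t * cnj z) / (of_real (r\<^sup>2) - ?c t * cnj z)
      = of_real (poisson_kernel z (?c t)) * k (?c t)" for t
  proof -
    let ?z = "?c t"
    have n: "norm ?z = r" using r by (simp add: norm_mult)
    have d1: "?z - z \<noteq> 0" using n z by auto
    have d2: "of_real (r\<^sup>2) - ?z * cnj z \<noteq> 0" using nz n by simp
    have sq: "of_real (r\<^sup>2) = ?z * cnj ?z"
      using n complex_norm_square[of ?z] by (simp only: of_real_power)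
    have d3: "cnj ?z - cnj z \<noteq> 0" using d1 by (metis complex_cnj_diff complex_cnj_zero_iff)
    have d4: "?z \<noteq> 0" using n r by auto
    have "of_real (poisson_kernel z ?z) = ((?z + z) / (?z - z) + cnj ((?z + z) / (?z - z))) / 2"
      by (simp only: complex_add_cnj) simp
    also have "\<dots> = ?z / (?z - z) + cnj z / (cnj ?z - cnj z)"
    proof -
      have "(?z + z) / (?z - z) = 2 * (?z / (?z - z)) - 1"
        using d1 by (simp add: field_simps)
      moreover have "cnj ((?z + z) / (?z - z)) = 1 + 2 * (cnj z / (cnj ?z - cnj z))"
        using d3 unfolding complex_cnj_divide complex_cnj_add complex_cnj_diff by (simp add: field_simps)
      ultimately show ?thesis by (simp only:) (simp add: field_simps)
    qed
    also have "cnj z / (cnj ?z - cnj z) = ?z * cnj z / (of_real (r\<^sup>2) - ?z * cnj z)"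
      unfolding sq right_diff_distrib[symmetric]
      by (rule mult_divide_mult_cancel_left[OF d4, symmetric])
    finally show ?thesis by (simp only: distrib_left distrib_right times_divide_eq_left times_divide_eq_right mult.commute mult.left_commute)
  qed
  have "((\<lambda>t. of_real (poisson_kernel z (?c t)) * k (?c t)) has_integral (of_real (2 * pi) * k z)) {0..2 * pi}"
    using has_integral_add[OF h1 h2] unfolding eq by simp
  from has_integral_Re[OF this]
  have "((\<lambda>t. poisson_kernel z (?c t) * Re (k (?c t))) has_integral (2 * pi * Re (k z))) {0..2 * pi}"
    by simp
  then show ?thesis
    unfolding circle_mean_def by (simp add: integral_unique)
qed

text \<open>A zero-free function on a disc has a holomorphic logarithm, whose real part is ln |g|.
  The disc extends beyond the circle so that this logarithm is holomorphic on the closed disc of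
  radius r.\<close>

lemma poisson_formula_ln:
  assumes g: "g holomorphic_on ball 0 R" "\<And>w. norm w < R \<Longrightarrow> g w \<noteq> 0" and "r < R" "norm z < r"
  shows "circle_mean r (\<lambda>\<zeta>. poisson_kernel z \<zeta> * ln (norm (g \<zeta>))) = ln (norm (g z))"
proof -
  have r: "0 < r" using assms(4) norm_ge_zero order_le_less_trans by blast
  obtain k where k: "k holomorphic_on ball 0 R" "\<And>w. w \<in> ball 0 R \<Longrightarrow> exp (k w) = g w"
    using holomorphic_logarithm_exists[of "ball 0 R" g 0] g r assms(3) by auto
  have ln: "ln (norm (g w)) = Re (k w)" if "norm w < R" for w
    using k(2)[of w, symmetric] that by simp
  have "circle_mean r (\<lambda>\<zeta>. poisson_kernel z \<zeta> * ln (norm (g \<zeta>)))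
      = circle_mean r (\<lambda>\<zeta>. poisson_kernel z \<zeta> * Re (k \<zeta>))"
    using r assms(3) by (intro circle_mean_cong) (auto simp: ln)
  also have "\<dots> = Re (k z)"
    using assms(3,4) by (intro poisson_formula holomorphic_on_subset[OF k(1)]) auto
  finally show ?thesis using ln assms by simp
qed

section \<open>Zeros of entire functions\<close>

text \<open>Excluding the zero function keeps zeros isolated and makes \<open>zorder\<close>
  meaningful at every point.\<close>

definition nz_entire :: "(complex \<Rightarrow> complex) \<Rightarrow> bool" where
  "nz_entire G \<longleftrightarrow> G holomorphic_on UNIV \<and> (\<exists>w. G w \<noteq> 0)"

abbreviation zero_mult :: "(complex \<Rightarrow> complex) \<Rightarrow> complex \<Rightarrow> nat" where
  "zero_mult G a \<equiv> nat (zorder G a)"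

abbreviation zeros :: "(complex \<Rightarrow> complex) \<Rightarrow> real \<Rightarrow> complex set" where
  "zeros G r \<equiv> {a. norm a < r \<and> G a = 0}"

text \<open>The contribution of a single zero to the integrated counting function: the integral of
  1/t from |a| to r, and for a = 0 the conventional term ln r.\<close>

definition log_weight :: "real \<Rightarrow> complex \<Rightarrow> real" where
  "log_weight r a = (if a = 0 then ln r else ln (r / norm a))"

text \<open>This and \<open>counting_mult\<close> are Nevanlinna's counting functions of the zeros,
  without and with multiplicity. The open disc in \<open>zeros\<close> loses nothing: a zero on the
  circle would have weight ln 1 = 0.\<close>

abbreviation counting_distinct :: "(complex \<Rightarrow> complex) \<Rightarrow> real \<Rightarrow> real" where
  "counting_distinct G r \<equiv> \<Sum>a\<in>zeros G r. log_weight r a"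

abbreviation counting_mult :: "(complex \<Rightarrow> complex) \<Rightarrow> real \<Rightarrow> real" where
  "counting_mult G r \<equiv> \<Sum>a\<in>zeros G r. zero_mult G a * log_weight r a"

abbreviation mean_ln :: "(complex \<Rightarrow> complex) \<Rightarrow> real \<Rightarrow> real" where
  "mean_ln G r \<equiv> circle_mean r (\<lambda>z. ln (norm (G z)))"

lemma nz_entire_holo: "nz_entire G \<Longrightarrow> G holomorphic_on A"
  unfolding nz_entire_def using holomorphic_on_subset by blast

lemma nz_entire_cont: "nz_entire G \<Longrightarrow> continuous_on A G"
  using nz_entire_holo holomorphic_on_imp_continuous_on by blast

lemma nz_entire_analytic: "nz_entire G \<Longrightarrow> G analytic_on A"
  unfolding nz_entire_def using analytic_on_open analytic_on_subset by blast

lemma nz_entire_eventually: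
  assumes "nz_entire G"
  shows "eventually (\<lambda>w. G w \<noteq> 0) (at z)"
proof -
  from assms obtain w where "G w \<noteq> 0" "G holomorphic_on UNIV"
    by (auto simp: nz_entire_def)
  then have "eventually (\<lambda>w. G w \<noteq> 0 \<and> w \<in> UNIV) (at z)"
    by (intro non_zero_neighbour_alt[of G UNIV z w]) auto
  then show ?thesis by simp
qed

lemma nz_entire_mult:
  assumes "nz_entire f" "nz_entire g"
  shows "nz_entire (\<lambda>z. f z * g z)"
proof -
  have "eventually (\<lambda>w. f w \<noteq> 0 \<and> g w \<noteq> 0) (at 0)"
    using assms nz_entire_eventually eventually_conj by blast
  from eventually_happens'[OF _ this] obtain w where "f w \<noteq> 0 \<and> g w \<noteq> 0"
    by auto
  moreover have "(\<lambda>z. f z * g z) holomorphic_on UNIV"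
    using assms nz_entire_holo by (intro holomorphic_intros) auto
  ultimately show ?thesis unfolding nz_entire_def by auto
qed

lemma nz_entire_power:
  assumes "nz_entire f"
  shows "nz_entire (\<lambda>z. f z ^ n)"
  using assms by (auto simp: nz_entire_def intro!: holomorphic_intros)

lemma nz_entire_shift:
  assumes "nz_entire f"
  shows "nz_entire (\<lambda>z. f (c + z))"
proof -
  obtain w where "f w \<noteq> 0" using assms unfolding nz_entire_def by blast
  then have "f (c + (w - c)) \<noteq> 0" by simp
  moreover have "(f \<circ> (\<lambda>z. c + z)) holomorphic_on UNIV"
    by (intro holomorphic_on_compose nz_entire_holo assms holomorphic_intros)
  ultimately show ?thesis unfolding nz_entire_def o_def by blast
qed

lemma nz_entire_poly: "q \<noteq> 0 \<Longrightarrow> nz_entire (poly q)"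
  unfolding nz_entire_def using poly_all_0_iff_0[of q] by (auto intro!: holomorphic_intros)

lemma nz_entire_exp_poly: "nz_entire (\<lambda>z. exp (poly Q z))"
  unfolding nz_entire_def by (auto intro!: holomorphic_intros)

lemma nz_entire_zorder:
  assumes "nz_entire G"
  shows "int (zero_mult G z) = zorder G z" "0 < zero_mult G z \<longleftrightarrow> G z = 0"
    "zor_poly G z z \<noteq> 0"
    "\<exists>r>0. zor_poly G z holomorphic_on cball z r \<and>
       (\<forall>w\<in>cball z r. G w = zor_poly G z w * (w - z) ^ zero_mult G z)"
proof -
  have *: "(if G z = 0 then zorder G z > 0 else zorder G z = 0) \<and>
      (\<exists>r. r>0 \<and> cball z r \<subseteq> UNIV \<and> zor_poly G z holomorphic_on cball z r
        \<and> (\<forall>w\<in>cball z r. G w = zor_poly G z w * (w - z) ^ nat (zorder G z) \<and> zor_poly G z w \<noteq> 0))"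
    using assms by (intro zorder_exist_zero) (auto simp: nz_entire_def)
  then show "int (zero_mult G z) = zorder G z" "0 < zero_mult G z \<longleftrightarrow> G z = 0"
    by (auto split: if_splits)
  from * obtain r where "r > 0" "zor_poly G z holomorphic_on cball z r"
      "\<forall>w\<in>cball z r. G w = zor_poly G z w * (w - z) ^ zero_mult G z \<and> zor_poly G z w \<noteq> 0"
    by blast
  then show "zor_poly G z z \<noteq> 0" "\<exists>r>0. zor_poly G z holomorphic_on cball z r \<and>
       (\<forall>w\<in>cball z r. G w = zor_poly G z w * (w - z) ^ zero_mult G z)"
    by auto
qed

lemma mult_times:
  assumes "nz_entire f" "nz_entire g"
  shows "zero_mult (\<lambda>z. f z * g z) a = zero_mult f a + zero_mult g a"
proof -
  have "zorder (\<lambda>z. f z * g z) a = zorder f a + zorder g a"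
    using assms nz_entire_eventually[OF nz_entire_mult[OF assms]] nz_entire_analytic
    by (intro zorder_times_analytic) auto
  then show ?thesis using nz_entire_zorder(1)[OF assms(1), of a] nz_entire_zorder(1)[OF assms(2), of a] by linarith
qed

lemma finite_zeros_cball:
  assumes "nz_entire G"
  shows "finite {a. norm a \<le> r \<and> G a = 0}"
proof (cases "G constant_on UNIV")
  case True
  then have "{a. norm a \<le> r \<and> G a = 0} = {}"
    using assms unfolding nz_entire_def constant_on_def by auto
  then show ?thesis by (simp only: finite.emptyI)
next
  case False
  then have "finite {z \<in> cball 0 r. G z = 0}"
    using assms nz_entire_holo by (intro holomorphic_compact_finite_zeros[where S = UNIV]) auto
  then show ?thesis by simp
qed

lemma finite_zeros: "nz_entire G \<Longrightarrow> finite (zeros G r)"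
  by (rule finite_subset[OF _ finite_zeros_cball[of G r]]) auto

lemma zero_free_annulus:
  assumes "nz_entire G" "0 < r" "\<And>w. norm w = r \<Longrightarrow> G w \<noteq> 0"
  obtains R where "R > r" "\<And>w. norm w < R \<Longrightarrow> G w = 0 \<Longrightarrow> norm w < r"
proof -
  define S where "S = norm ` {a. norm a \<le> r + 1 \<and> G a = 0} - {..r}"
  have fin: "finite S" unfolding S_def using finite_zeros_cball[OF assms(1)] by auto
  \<comment> \<open>The element r + 1 covers an annulus without zeros, and keeps R in the range
    where the zeros are known to be finite in number.\<close>
  define R where "R = Min (insert (r + 1) S)"
  have "R > r" unfolding R_def using fin by (subst Min_gr_iff) (auto simp: S_def)
  moreover have "norm w < r" if "norm w < R" "G w = 0" for w
  proof (rule ccontr)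
    assume "\<not> norm w < r"
    then have "norm w > r" using assms(3) that(2) by (meson linorder_neqE_linordered_idom)
    have "R \<le> r + 1" unfolding R_def using fin by (intro Min_le) auto
    then have "norm w \<in> S" using \<open>norm w > r\<close> that unfolding S_def by auto
    then have "R \<le> norm w" unfolding R_def using fin by (intro Min_le) auto
    with that show False by simp
  qed
  ultimately show ?thesis using that by blast
qed

section \<open>Factoring out the zeros in a disc; the Poisson-Jensen formula\<close>

lemma zorder_prod_linear:
  assumes "finite Z"
  shows "zorder (\<lambda>w. \<Prod>a\<in>Z. (w - a) ^ m a) z = (if z \<in> Z then int (m z) else 0)"
proof (rule zorder_eqI[where S = UNIV and g = "\<lambda>w. \<Prod>a\<in>Z-{z}. (w - a) ^ m a"])
  show "(\<Prod>a\<in>Z - {z}. (z - a) ^ m a) \<noteq> 0" using assms by auto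
  fix w assume "w \<noteq> z"
  show "(\<Prod>a\<in>Z. (w - a) ^ m a) = (\<Prod>a\<in>Z - {z}. (w - a) ^ m a) * (w - z) powi (if z \<in> Z then int (m z) else 0)"
    using assms by (auto simp: prod.remove[of Z z] mult.commute)
qed (auto intro!: holomorphic_intros)

text \<open>The product and G have equal order at every point of a slightly larger disc, so their
  quotient extends to a zero-free holomorphic function. The room beyond the circle is what
  \<open>poisson_formula_ln\<close> asks for.\<close>

lemma zero_factorization:
  assumes "nz_entire G" "0 < r" "\<And>w. norm w = r \<Longrightarrow> G w \<noteq> 0"
  obtains R g where "R > r" "g holomorphic_on ball 0 R" "\<And>w. norm w < R \<Longrightarrow> g w \<noteq> 0"
    "\<And>w. norm w < R \<Longrightarrow> G w = (\<Prod>a\<in>zeros G r. (w - a) ^ zero_mult G a) * g w"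
proof -
  obtain R where R: "R > r" "\<And>w. norm w < R \<Longrightarrow> G w = 0 \<Longrightarrow> norm w < r"
    using zero_free_annulus[OF assms] by blast
  let ?B = "\<lambda>w. \<Prod>a\<in>zeros G r. (w - a) ^ zero_mult G a"
  note fin = finite_zeros[OF assms(1), of r]
  note zo = nz_entire_zorder[OF assms(1)]
  have "\<exists>h. h holomorphic_on ball 0 R \<and> (\<forall>z\<in>ball 0 R. h z \<noteq> 0) \<and> (\<forall>z\<in>ball 0 R. G z = h z * ?B z)"
  proof -
    have B0: "?B z = 0 \<longleftrightarrow> G z = 0" if "z \<in> ball 0 R" for z
      using fin R(2)[of z] that zo(2)[of z] by (auto simp: prod_zero_iff)
    have z0: "zorder G z = 0" if "G z \<noteq> 0" for z
      using zo(1,2)[of z] that by linarith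
    have ord: "zorder ?B z = zorder G z" if "z \<in> ball 0 R" for z
      unfolding zorder_prod_linear[OF fin] using R(2)[of z] that zo(1)[of z] z0[of z] by auto
    have holB: "?B holomorphic_on ball 0 R" by (intro holomorphic_intros)
    show ?thesis
    proof (rule holomorphic_zorder_factorization[OF nz_entire_holo[OF assms(1)] open_ball connected_ball holB B0 ord])
      fix h assume "h holomorphic_on ball 0 R" "\<And>z. z \<in> ball 0 R \<Longrightarrow> h z \<noteq> 0"
        "\<And>z. z \<in> ball 0 R \<Longrightarrow> G z = h z * ?B z"
      then show ?thesis by (intro exI[of _ h]) blast
    qed
  qed
  then obtain h where "h holomorphic_on ball 0 R" "\<And>z. z \<in> ball 0 R \<Longrightarrow> h z \<noteq> 0"
      "\<And>z. z \<in> ball 0 R \<Longrightarrow> G z = h z * ?B z" by blast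
  then show ?thesis by (intro that[OF R(1)]) (auto simp: mult.commute)
qed

text \<open>The quotient of \<zeta> - a by this factor is a Blaschke factor, of modulus one on the
  circle; the zero of the reflected factor, r^2 / cnj a, lies outside the disc.\<close>

lemma norm_reflected_linear:
  assumes "norm \<zeta> = r" "0 < r"
  shows "norm (of_real r - cnj a * \<zeta> / of_real r) = norm (\<zeta> - a)"
proof -
  have "of_real r - cnj a * \<zeta> / of_real r = \<zeta> / of_real r * cnj (\<zeta> - a)"
  proof -
    have "of_real r * of_real r = \<zeta> * cnj \<zeta>"
      using complex_norm_square[of \<zeta>] assms by (simp add: power2_eq_square)
    then show ?thesis using assms(2) by (simp add: field_simps)
  qed
  then show ?thesis using assms by (simp add: norm_mult norm_divide del: complex_cnj_diff)
qed

text \<open>A Blaschke factor has modulus at most one inside the disc: the difference of the squared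
  moduli factors as (r^2 - |z|^2) (r^2 - |a|^2) / r^2.\<close>

lemma norm_reflected_linear_ge:
  assumes "norm z \<le> r" "norm a \<le> r" "0 < r"
  shows "norm (z - a) \<le> norm (of_real r - cnj a * z / of_real r)"
proof -
  have "(norm (of_real r - cnj a * z / of_real r))\<^sup>2 - (norm (z - a))\<^sup>2
     = (r\<^sup>2 - (norm z)\<^sup>2) * (r\<^sup>2 - (norm a)\<^sup>2) / r\<^sup>2"
    unfolding cmod_power2 using assms(3) by (simp add: field_simps power2_eq_square)
  also have "\<dots> \<ge> 0" using assms by (intro divide_nonneg_nonneg mult_nonneg_nonneg) (auto intro: power_mono)
  finally have "(norm (z - a))\<^sup>2 \<le> (norm (of_real r - cnj a * z / of_real r))\<^sup>2" by simp
  then show ?thesis by (rule power2_le_imp_le) simp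
qed

text \<open>ln |\<zeta> - a| is singular inside the disc, but on the circle it agrees with the
  logarithm of the reflected factor, to which the zero-free formula applies.\<close>

lemma poisson_linear:
  assumes "norm a < r" "norm z < r"
  shows "circle_mean r (\<lambda>\<zeta>. poisson_kernel z \<zeta> * ln (norm (\<zeta> - a)))
    = ln (norm (of_real r - cnj a * z / of_real r))"
proof -
  have r: "0 < r" using assms norm_ge_zero order_le_less_trans by blast
  \<comment> \<open>r^2 / |a| is the modulus of the reflected zero. For a = 0 the factor is the
    constant r and any larger radius will do.\<close>
  define R where "R = (if a = 0 then r + 1 else r\<^sup>2 / norm a)"
  have R: "R > r"
    unfolding R_def using assms r by (auto simp: field_simps power2_eq_square)
  have nz: "of_real r - cnj a * w / of_real r \<noteq> 0" if "norm w < R" for w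
  proof
    assume "of_real r - cnj a * w / of_real r = 0"
    then have "of_real (r * r) = cnj a * w" using r by (simp add: field_simps)
    then have "norm (cnj a * w) = r\<^sup>2"
      by (metis norm_of_real abs_of_nonneg zero_le_square power2_eq_square)
    then show False using that r unfolding R_def
      by (auto simp: norm_mult field_simps power2_eq_square split: if_splits)
  qed
  have "circle_mean r (\<lambda>\<zeta>. poisson_kernel z \<zeta> * ln (norm (\<zeta> - a)))
     = circle_mean r (\<lambda>\<zeta>. poisson_kernel z \<zeta> * ln (norm (of_real r - cnj a * \<zeta> / of_real r)))"
    using r by (intro circle_mean_cong) (auto simp: norm_reflected_linear)
  also have "\<dots> = ln (norm (of_real r - cnj a * z / of_real r))"
    by (rule poisson_formula_ln[OF _ nz R assms(2)]) (use r in \<open>auto intro!: holomorphic_intros\<close>)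
  finally show ?thesis .
qed

lemma continuous_on_ln_norm:
  assumes "nz_entire G" "\<And>w. norm w = r \<Longrightarrow> G w \<noteq> 0"
  shows "continuous_on (sphere 0 r) (\<lambda>z. ln (norm (G z)))"
  using assms by (intro continuous_intros nz_entire_cont) auto

text \<open>The right-hand side contains g(z) rather than G(z), so it stays meaningful where G
  vanishes, in particular at the origin. The factorisation is a hypothesis so that the caller
  retains access to g.\<close>

lemma poisson_jensen:
  assumes "nz_entire G" "0 < r" "\<And>w. norm w = r \<Longrightarrow> G w \<noteq> 0"
    and Rg: "R > r" "g holomorphic_on ball 0 R" "\<And>w. norm w < R \<Longrightarrow> g w \<noteq> 0"
    "\<And>w. norm w < R \<Longrightarrow> G w = (\<Prod>a\<in>zeros G r. (w - a) ^ zero_mult G a) * g w"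
    and z: "norm z < r"
  shows "circle_mean r (\<lambda>\<zeta>. poisson_kernel z \<zeta> * ln (norm (G \<zeta>)))
       = (\<Sum>a\<in>zeros G r. zero_mult G a * ln (norm (of_real r - cnj a * z / of_real r))) + ln (norm (g z))"
proof -
  note fin = finite_zeros[OF assms(1), of r]
  define p where "p = (\<lambda>\<zeta>. poisson_kernel z \<zeta>)"
  have P: "continuous_on (sphere 0 r) p"
    unfolding p_def by (rule continuous_on_poisson_kernel[OF z])
  have "continuous_on (sphere 0 r) g"
    by (rule continuous_on_subset[OF holomorphic_on_imp_continuous_on[OF Rg(2)]]) (use Rg(1) in auto)
  then have "continuous_on (sphere 0 r) (\<lambda>\<zeta>. ln (norm (g \<zeta>)))"
    using Rg(1,3) by (intro continuous_intros) auto
  then have cg: "continuous_on (sphere 0 r) (\<lambda>\<zeta>. p \<zeta> * ln (norm (g \<zeta>)))"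
    by (intro continuous_on_mult P)
  have cl: "continuous_on (sphere 0 r) (\<lambda>\<zeta>. p \<zeta> * ln (norm (\<zeta> - a)))"
    if "a \<in> zeros G r" for a
    using that by (intro continuous_on_mult P continuous_intros) auto
  have cl': "continuous_on (sphere 0 r) (\<lambda>\<zeta>. zero_mult G a * (p \<zeta> * ln (norm (\<zeta> - a))))"
    if "a \<in> zeros G r" for a
    by (intro continuous_on_mult continuous_on_const cl that)
  have "circle_mean r (\<lambda>\<zeta>. p \<zeta> * ln (norm (G \<zeta>)))
    = circle_mean r (\<lambda>\<zeta>. (\<Sum>a\<in>zeros G r. zero_mult G a * (p \<zeta> * ln (norm (\<zeta> - a))))
         + p \<zeta> * ln (norm (g \<zeta>)))"
  proof (rule circle_mean_cong)
    fix \<zeta> :: complex assume n: "norm \<zeta> = r"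
    let ?B = "\<Prod>a\<in>zeros G r. (\<zeta> - a) ^ zero_mult G a"
    have nz: "\<zeta> - a \<noteq> 0" if "a \<in> zeros G r" for a using that n by auto
    have "?B \<noteq> 0" using nz fin by auto
    moreover have "G \<zeta> = ?B * g \<zeta>" "g \<zeta> \<noteq> 0" using n Rg(1) Rg(3)[of \<zeta>] Rg(4)[of \<zeta>] by auto
    ultimately have e: "ln (norm (G \<zeta>)) = ln (norm ?B) + ln (norm (g \<zeta>))"
      by (simp only: norm_mult) (simp add: ln_mult)
    have e2: "ln (norm ?B) = (\<Sum>a\<in>zeros G r. zero_mult G a * ln (norm (\<zeta> - a)))"
      unfolding prod_norm[symmetric] using nz fin by (subst ln_prod) (auto simp: norm_power ln_realpow)
    show "p \<zeta> * ln (norm (G \<zeta>)) =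
       (\<Sum>a\<in>zeros G r. zero_mult G a * (p \<zeta> * ln (norm (\<zeta> - a)))) + p \<zeta> * ln (norm (g \<zeta>))"
      unfolding e e2 distrib_left sum_distrib_left by (simp only: mult.left_commute)
  qed (use assms(2) in auto)
  also have "\<dots> = circle_mean r (\<lambda>\<zeta>. (\<Sum>a\<in>zeros G r. zero_mult G a * (p \<zeta> * ln (norm (\<zeta> - a)))))
         + circle_mean r (\<lambda>\<zeta>. p \<zeta> * ln (norm (g \<zeta>)))"
    by (rule circle_mean_add) (use assms(2) cg in \<open>auto intro!: continuous_on_sum cl'\<close>)
  also have "circle_mean r (\<lambda>\<zeta>. (\<Sum>a\<in>zeros G r. zero_mult G a * (p \<zeta> * ln (norm (\<zeta> - a)))))
     = (\<Sum>a\<in>zeros G r. circle_mean r (\<lambda>\<zeta>. zero_mult G a * (p \<zeta> * ln (norm (\<zeta> - a)))))"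
    by (rule circle_mean_sum) (use assms(2) fin cl' in auto)
  finally have *: "circle_mean r (\<lambda>\<zeta>. p \<zeta> * ln (norm (G \<zeta>)))
      = (\<Sum>a\<in>zeros G r. zero_mult G a * circle_mean r (\<lambda>\<zeta>. p \<zeta> * ln (norm (\<zeta> - a))))
           + circle_mean r (\<lambda>\<zeta>. p \<zeta> * ln (norm (g \<zeta>)))"
    unfolding circle_mean_cmult .
  have A: "circle_mean r (\<lambda>\<zeta>. poisson_kernel z \<zeta> * ln (norm (g \<zeta>))) = ln (norm (g z))"
    by (rule poisson_formula_ln[OF Rg(2,3,1) z])
  have B: "(\<Sum>a\<in>zeros G r. zero_mult G a * circle_mean r (\<lambda>\<zeta>. poisson_kernel z \<zeta> * ln (norm (\<zeta> - a))))
     = (\<Sum>a\<in>zeros G r. zero_mult G a * ln (norm (of_real r - cnj a * z / of_real r)))"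
  proof (rule sum.cong[OF refl])
    fix a assume "a \<in> zeros G r"
    then have "norm a < r" by simp
    from poisson_linear[OF this z]
    show "zero_mult G a * circle_mean r (\<lambda>\<zeta>. poisson_kernel z \<zeta> * ln (norm (\<zeta> - a)))
      = zero_mult G a * ln (norm (of_real r - cnj a * z / of_real r))" by (simp only:)
  qed
  show ?thesis using * unfolding p_def A B .
qed

section \<open>Jensen's formula and the proximity function\<close>

lemma log_plus_nonneg [simp]: "0 \<le> log_plus x"
  unfolding log_plus_def by simp

lemma ln_le_log_plus: "0 \<le> x \<Longrightarrow> ln x \<le> log_plus x"
  unfolding log_plus_def by (cases "x = 0") (auto intro!: ln_mono)

lemma log_plus_eq_max: "0 < x \<Longrightarrow> log_plus x = max 0 (ln x)"
  unfolding log_plus_def by (auto simp: max_def)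

lemma log_plus_le: "0 \<le> y \<Longrightarrow> x \<le> exp y \<Longrightarrow> log_plus x \<le> y"
  unfolding log_plus_def using ln_mono[of "max 1 x" "exp y"] by auto

lemma le_exp_log_plus: "x \<le> exp (log_plus x)"
  unfolding log_plus_def by (simp add: exp_ln)

lemma continuous_on_log_plus [continuous_intros]:
  assumes "continuous_on S f"
  shows "continuous_on S (\<lambda>x. log_plus (f x))"
  unfolding log_plus_def using assms by (intro continuous_intros) (auto simp: max_def)

lemma log_weight_nonneg: "1 \<le> r \<Longrightarrow> norm a < r \<Longrightarrow> 0 \<le> log_weight r a"
  unfolding log_weight_def by auto

lemma circle_mean_poisson_0:
  assumes "0 < r"
  shows "circle_mean r (\<lambda>\<zeta>. poisson_kernel 0 \<zeta> * u \<zeta>) = circle_mean r u"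
  by (rule circle_mean_cong) (use assms in auto)

lemma circle_mean_Re_holomorphic:
  assumes "k holomorphic_on cball 0 r" "0 < r"
  shows "circle_mean r (\<lambda>z. Re (k z)) = Re (k 0)"
  using poisson_formula[OF assms(1), of 0] circle_mean_poisson_0[OF assms(2), of "\<lambda>z. Re (k z)"] assms(2)
  by simp

text \<open>Both sides are the value at 0 of the continuous extension of G(w) / w^m with m the order
  at 0; they are compared at w \<noteq> 0, where the power cancels.\<close>

lemma factor_at_origin:
  assumes "nz_entire G" "0 < r" "R > r" "g holomorphic_on ball 0 R"
    "\<And>w. norm w < R \<Longrightarrow> G w = (\<Prod>a\<in>zeros G r. (w - a) ^ zero_mult G a) * g w"
  shows "zor_poly G 0 0 = (\<Prod>a\<in>zeros G r - {0}. (- a) ^ zero_mult G a) * g 0"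
proof -
  note zo = nz_entire_zorder[OF assms(1), of 0]
  obtain e where e: "e > 0" "zor_poly G 0 holomorphic_on cball 0 e"
      "\<forall>w\<in>cball 0 e. G w = zor_poly G 0 w * w ^ zero_mult G 0"
    using zo(4) by auto
  define d where "d = min e R"
  have d: "d > 0" unfolding d_def using e assms by auto
  let ?h = "\<lambda>w. (\<Prod>a\<in>zeros G r - {0}. (w - a) ^ zero_mult G a) * g w"
  have eq: "zor_poly G 0 w = ?h w" if "w \<in> ball 0 d - {0}" for w
  proof -
    have pr: "(\<Prod>a\<in>zeros G r. (w - a) ^ zero_mult G a) = w ^ zero_mult G 0 * (\<Prod>a\<in>zeros G r - {0}. (w - a) ^ zero_mult G a)"
    proof (cases "G 0 = 0")
      case True
      then show ?thesis using finite_zeros[OF assms(1), of r] assms(2) by (subst prod.remove[of _ 0]) auto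
    next
      case False
      then have "zero_mult G 0 = 0" using zo(2) by auto
      moreover have "zeros G r - {0} = zeros G r" using False by auto
      ultimately show ?thesis by simp
    qed
    have w: "norm w < R" "w \<in> cball 0 e" "w \<noteq> 0" using that unfolding d_def by auto
    have "zor_poly G 0 w * w ^ zero_mult G 0 = G w" using e(3) w(2) by simp
    also have "\<dots> = ?h w * w ^ zero_mult G 0"
      unfolding assms(5)[OF w(1)] pr by (simp only: mult.assoc mult.commute mult.left_commute)
    finally show ?thesis using w(3) by (subst (asm) mult_cancel_right) simp
  qed
  have "zor_poly G 0 holomorphic_on ball 0 d" "?h holomorphic_on ball 0 d"
    using e(2) assms(4) unfolding d_def by (auto intro!: holomorphic_intros elim!: holomorphic_on_subset)
  then have "continuous (at 0) (zor_poly G 0)" "continuous (at 0) ?h"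
    using d by (auto dest!: holomorphic_on_imp_continuous_on simp: continuous_on_eq_continuous_at)
  then have lim: "(zor_poly G 0 \<longlongrightarrow> zor_poly G 0 0) (at 0)" "(?h \<longlongrightarrow> ?h 0) (at 0)"
    unfolding isCont_def by blast+
  have "eventually (\<lambda>w. zor_poly G 0 w = ?h w) (at 0)"
    unfolding eventually_at using d eq by (intro exI[of _ d]) auto
  from Lim_transform_eventually[OF lim(1) this]
  have "zor_poly G 0 0 = ?h 0"
    by (rule tendsto_unique[OF trivial_limit_at _ lim(2)])
  then show ?thesis by simp
qed

text \<open>\<open>zor_poly G 0 0\<close> is the first non-zero Taylor coefficient of G at 0, which
  replaces G(0) in Jensen's formula when G vanishes at the origin.\<close>

definition leading_ln :: "(complex \<Rightarrow> complex) \<Rightarrow> real" where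
  "leading_ln G = ln (norm (zor_poly G 0 0))"

text \<open>At z = 0 every reflected factor equals r, so a zero a \<noteq> 0 contributes ln r = ln
  (r / |a|) + ln |a|. The terms ln |a| combine with ln |g(0)| to the leading coefficient.\<close>

theorem jensen_formula:
  assumes "nz_entire G" "0 < r" "\<And>w. norm w = r \<Longrightarrow> G w \<noteq> 0"
  shows "mean_ln G r
    = leading_ln G + counting_mult G r"
proof -
  obtain R g where Rg: "R > r" "g holomorphic_on ball 0 R" "\<And>w. norm w < R \<Longrightarrow> g w \<noteq> 0"
    "\<And>w. norm w < R \<Longrightarrow> G w = (\<Prod>a\<in>zeros G r. (w - a) ^ zero_mult G a) * g w"
    using zero_factorization[OF assms] by blast
  note fin = finite_zeros[OF assms(1), of r]
  have g0: "g 0 \<noteq> 0" using Rg(1,3) assms(2) by simp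
  have "circle_mean r (\<lambda>\<zeta>. poisson_kernel 0 \<zeta> * ln (norm (G \<zeta>)))
     = (\<Sum>a\<in>zeros G r. zero_mult G a * ln (norm (of_real r - cnj a * 0 / of_real r))) + ln (norm (g 0))"
    by (rule poisson_jensen[OF assms Rg]) (use assms(2) in auto)
  then have "mean_ln G r = (\<Sum>a\<in>zeros G r. zero_mult G a * ln r) + ln (norm (g 0))"
    unfolding circle_mean_poisson_0[OF assms(2)] using assms(2) by simp
  also have "(\<Sum>a\<in>zeros G r. zero_mult G a * ln r)
     = counting_mult G r
        + (\<Sum>a\<in>zeros G r. if a \<in> zeros G r - {0} then zero_mult G a * ln (norm a) else 0)"
    unfolding sum.distrib[symmetric] log_weight_def using assms(2)
    by (intro sum.cong refl) (auto simp: ln_div right_diff_distrib)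
  also have "(\<Sum>a\<in>zeros G r. if a \<in> zeros G r - {0} then zero_mult G a * ln (norm a) else 0)
     = (\<Sum>a\<in>zeros G r - {0}. zero_mult G a * ln (norm a))"
    using fin by (intro sum.mono_neutral_cong_right) auto
  also have "\<dots> = ln (norm (\<Prod>a\<in>zeros G r - {0}. (- a) ^ zero_mult G a))"
    unfolding prod_norm[symmetric] using fin by (subst ln_prod) (auto simp: norm_power ln_realpow)
  finally have *: "mean_ln G r = counting_mult G r
      + ln (norm (\<Prod>a\<in>zeros G r - {0}. (- a) ^ zero_mult G a)) + ln (norm (g 0))" .
  have p0: "(\<Prod>a\<in>zeros G r - {0}. (- a) ^ zero_mult G a) \<noteq> 0" using fin by auto
  have "leading_ln G = ln (norm (\<Prod>a\<in>zeros G r - {0}. (- a) ^ zero_mult G a)) + ln (norm (g 0))"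
  proof -
    have "zor_poly G 0 0 = (\<Prod>a\<in>zeros G r - {0}. (- a) ^ zero_mult G a) * g 0"
      by (rule factor_at_origin[OF assms(1,2) Rg(1,2,4)])
    then show ?thesis
      unfolding leading_ln_def using p0 g0 by (simp only: norm_mult) (simp add: ln_mult_pos)
  qed
  with * show ?thesis by simp
qed

text \<open>The restriction r \<ge> 1 is due to a zero at the origin, whose weight is ln r.\<close>

lemma jensen_ge:
  assumes "nz_entire G" "1 \<le> r" "\<And>w. norm w = r \<Longrightarrow> G w \<noteq> 0"
  shows "leading_ln G \<le> mean_ln G r"
  using jensen_formula[OF assms(1) _ assms(3)] assms(2)
  by (auto intro!: sum_nonneg mult_nonneg_nonneg log_weight_nonneg)

text \<open>Subharmonicity of ln |G|: compared with the Poisson-Jensen formula, each |z - a| is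
  replaced by the modulus of its reflected factor, which can only be larger.\<close>

lemma poisson_ineq_ln:
  assumes "nz_entire G" "0 < r" "\<And>w. norm w = r \<Longrightarrow> G w \<noteq> 0" "norm z < r" "G z \<noteq> 0"
  shows "ln (norm (G z)) \<le> circle_mean r (\<lambda>\<zeta>. poisson_kernel z \<zeta> * ln (norm (G \<zeta>)))"
proof -
  obtain R g where Rg: "R > r" "g holomorphic_on ball 0 R" "\<And>w. norm w < R \<Longrightarrow> g w \<noteq> 0"
    "\<And>w. norm w < R \<Longrightarrow> G w = (\<Prod>a\<in>zeros G r. (w - a) ^ zero_mult G a) * g w"
    using zero_factorization[OF assms(1-3)] by blast
  note fin = finite_zeros[OF assms(1), of r]
  have zR: "norm z < R" using Rg(1) assms(4) by simp
  have ne: "z - a \<noteq> 0" if "a \<in> zeros G r" for a using that assms(5) by auto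
  let ?B = "\<Prod>a\<in>zeros G r. (z - a) ^ zero_mult G a"
  have "?B \<noteq> 0" using ne fin by auto
  moreover have "g z \<noteq> 0" using Rg(3) zR by auto
  ultimately have e: "ln (norm (G z)) = ln (norm ?B) + ln (norm (g z))"
    unfolding Rg(4)[OF zR] norm_mult by (intro ln_mult_pos) auto
  have e2: "ln (norm ?B) = (\<Sum>a\<in>zeros G r. zero_mult G a * ln (norm (z - a)))"
    unfolding prod_norm[symmetric] using ne fin by (subst ln_prod) (auto simp: norm_power ln_realpow)
  have "(\<Sum>a\<in>zeros G r. zero_mult G a * ln (norm (z - a)))
     \<le> (\<Sum>a\<in>zeros G r. zero_mult G a * ln (norm (of_real r - cnj a * z / of_real r)))"
  proof (intro sum_mono mult_left_mono)
    fix a assume a: "a \<in> zeros G r"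
    have "norm (z - a) \<le> norm (of_real r - cnj a * z / of_real r)"
      using a assms(2,4) by (intro norm_reflected_linear_ge) auto
    then show "ln (norm (z - a)) \<le> ln (norm (of_real r - cnj a * z / of_real r))"
      using ne[OF a] by (intro ln_mono) auto
  qed simp
  moreover have "circle_mean r (\<lambda>\<zeta>. poisson_kernel z \<zeta> * ln (norm (G \<zeta>)))
       = (\<Sum>a\<in>zeros G r. zero_mult G a * ln (norm (of_real r - cnj a * z / of_real r))) + ln (norm (g z))"
    by (rule poisson_jensen[OF assms(1-3) Rg assms(4)])
  ultimately show ?thesis unfolding e e2 by simp
qed

lemma poisson_ineq_log_plus:
  assumes "nz_entire G" "0 < r" "\<And>w. norm w = r \<Longrightarrow> G w \<noteq> 0" "norm z < r"
  shows "log_plus (norm (G z)) \<le> circle_mean r (\<lambda>\<zeta>. poisson_kernel z \<zeta> * log_plus (norm (G \<zeta>)))"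
proof -
  note P = continuous_on_poisson_kernel[OF assms(4)]
  have c: "continuous_on (sphere 0 r) (\<lambda>\<zeta>. poisson_kernel z \<zeta> * log_plus (norm (G \<zeta>)))"
    by (intro continuous_on_mult P continuous_on_log_plus continuous_on_norm nz_entire_cont assms(1))
  have c2: "continuous_on (sphere 0 r) (\<lambda>\<zeta>. poisson_kernel z \<zeta> * ln (norm (G \<zeta>)))"
    by (intro continuous_on_mult P continuous_on_ln_norm assms)
  have n: "0 \<le> circle_mean r (\<lambda>\<zeta>. poisson_kernel z \<zeta> * log_plus (norm (G \<zeta>)))"
    using assms(2) c poisson_kernel_pos[OF _ assms(4)]
    by (intro circle_mean_nonneg mult_nonneg_nonneg) (auto simp: less_imp_le)
  show ?thesis
  proof (cases "norm (G z) \<le> 1")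
    case True
    then show ?thesis using n by (simp add: log_plus_def max_def)
  next
    case False
    then have "log_plus (norm (G z)) = ln (norm (G z))" by (simp add: log_plus_def max_def)
    also have "\<dots> \<le> circle_mean r (\<lambda>\<zeta>. poisson_kernel z \<zeta> * ln (norm (G \<zeta>)))"
      by (rule poisson_ineq_ln[OF assms]) (use False in auto)
    also have "\<dots> \<le> circle_mean r (\<lambda>\<zeta>. poisson_kernel z \<zeta> * log_plus (norm (G \<zeta>)))"
      using assms(2) poisson_kernel_pos[OF _ assms(4)]
      by (intro circle_mean_mono c c2 mult_left_mono ln_le_log_plus) (auto simp: less_imp_le)
    finally show ?thesis .
  qed
qed

section \<open>Proximity functions at different radii and of shifted functions\<close>

lemma poisson_mean_le:
  assumes "norm z < r" "continuous_on (sphere 0 r) u" "\<And>w. norm w = r \<Longrightarrow> 0 \<le> u w"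
  shows "circle_mean r (\<lambda>\<zeta>. poisson_kernel z \<zeta> * u \<zeta>) \<le> (r + norm z) / (r - norm z) * circle_mean r u"
proof -
  have "0 \<le> r" using assms(1) by (meson norm_ge_zero le_less_trans less_imp_le)
  then show ?thesis unfolding circle_mean_cmult[symmetric]
    using poisson_kernel_le[OF _ assms(1)] assms
    by (intro circle_mean_mono continuous_on_mult continuous_on_poisson_kernel mult_right_mono continuous_on_const) auto
qed

lemma log_plus_le_proximity:
  assumes "nz_entire G" "0 < r" "\<And>w. norm w = r \<Longrightarrow> G w \<noteq> 0" "norm z < r"
  shows "log_plus (norm (G z)) \<le> (r + norm z) / (r - norm z) * circle_mean r (\<lambda>\<zeta>. log_plus (norm (G \<zeta>)))"
  by (rule order_trans[OF poisson_ineq_log_plus[OF assms] poisson_mean_le[OF assms(4)]])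
     (auto intro!: continuous_on_log_plus continuous_on_norm nz_entire_cont assms)

text \<open>After exchanging the integrals, the kernel as a function of z is the real part of a
  function holomorphic on |z| \<le> r, because c + z stays away from the circle of radius R. Its
  mean over |z| = r is its value at z = 0.\<close>

lemma circle_mean_swap:
  assumes r: "0 < r" and R: "norm c + r < R" and u: "continuous_on (sphere 0 R) u"
  shows "circle_mean r (\<lambda>z. circle_mean R (\<lambda>\<zeta>. poisson_kernel (c + z) \<zeta> * u \<zeta>))
    = circle_mean R (\<lambda>\<zeta>. poisson_kernel c \<zeta> * u \<zeta>)"
proof -
  have R0: "0 < R" using r R norm_ge_zero[of c] by linarith
  let ?F = "\<lambda>s t. poisson_kernel (c + of_real r * cis s) (of_real R * cis t) * u (of_real R * cis t)"
  have ne: "of_real R * cis t \<noteq> c + of_real r * cis s" for s t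
  proof
    assume "of_real R * cis t = c + of_real r * cis s"
    then have "norm (of_real R * cis t) = norm (c + of_real r * cis s)" by simp
    also have "\<dots> \<le> norm c + norm (of_real r * cis s)" by (rule norm_triangle_ineq)
    also have "\<dots> = norm c + r" using r by (simp add: norm_mult)
    finally show False using R R0 by (simp add: norm_mult)
  qed
  have cu: "continuous_on A (\<lambda>x. u (of_real R * cis (snd x)))" for A :: "(real \<times> real) set"
    by (rule continuous_on_compose2[OF u]) (use R0 in \<open>auto intro!: continuous_intros simp: norm_mult\<close>)
  have "continuous_on (cbox (0, 0) (2 * pi, 2 * pi)) (\<lambda>(s, t). ?F s t)"
    unfolding split_beta using ne by (intro continuous_on_mult cu continuous_intros) auto
  from integral_swap_continuous[OF this]
  have swap: "integral {0..2 * pi} (\<lambda>s. integral {0..2 * pi} (?F s))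
     = integral {0..2 * pi} (\<lambda>t. integral {0..2 * pi} (\<lambda>s. ?F s t))"
    by (simp only: cbox_interval)
  have inner: "integral {0..2 * pi} (\<lambda>s. ?F s t)
      = 2 * pi * (poisson_kernel c (of_real R * cis t) * u (of_real R * cis t))" for t
  proof -
    let ?z = "of_real R * cis t"
    have "?z - (c + w) \<noteq> 0" if "norm w \<le> r" for w
    proof
      assume "?z - (c + w) = 0"
      then have "norm ?z = norm (c + w)" by simp
      also have "\<dots> \<le> norm c + norm w" by (rule norm_triangle_ineq)
      finally show False using R R0 that by (simp add: norm_mult)
    qed
    then have "(\<lambda>w. (?z + (c + w)) / (?z - (c + w))) holomorphic_on cball 0 r"
      by (intro holomorphic_intros) auto
    from circle_mean_Re_holomorphic[OF this r]
    have "integral {0..2 * pi} (\<lambda>s. poisson_kernel (c + of_real r * cis s) ?z) = 2 * pi * poisson_kernel c ?z"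
      unfolding circle_mean_def by (simp add: field_simps)
    then show ?thesis by (simp only: integral_mult_left mult.assoc)
  qed
  show ?thesis unfolding circle_mean_def integral_mult_right swap inner by simp
qed

lemma continuous_on_circle_mean_radius:
  assumes "continuous_on UNIV u"
  shows "continuous_on A (\<lambda>r. circle_mean r u)"
proof -
  have "continuous_on (A \<times> cbox 0 (2 * pi)) (\<lambda>(r, t). u (of_real r * cis t))"
    unfolding split_beta
    by (rule continuous_on_compose2[OF assms]) (auto intro!: continuous_intros)
  from integral_continuous_on_param[OF this]
  show ?thesis unfolding circle_mean_def cbox_interval by (intro continuous_intros)
qed

lemma exists_zero_free_radius:
  assumes "nz_entire G" "0 \<le> a" "a < b"
  obtains r where "a < r" "r < b" "\<And>w. norm w = r \<Longrightarrow> G w \<noteq> 0"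
proof -
  have "finite (norm ` {w. norm w \<le> b \<and> G w = 0})" using finite_zeros_cball[OF assms(1)] by simp
  then have "infinite ({a<..<b} - norm ` {w. norm w \<le> b \<and> G w = 0})"
    using assms(3) by (simp add: infinite_Ioo)
  then obtain r where "r \<in> {a<..<b} - norm ` {w. norm w \<le> b \<and> G w = 0}"
    by (metis infinite_imp_nonempty ex_in_conv)
  then show ?thesis by (intro that[of r]) auto
qed

abbreviation proximity :: "(complex \<Rightarrow> complex) \<Rightarrow> real \<Rightarrow> real" where
  "proximity f r \<equiv> circle_mean r (\<lambda>z. log_plus (norm (f z)))"

text \<open>The subharmonic bound for log+ |f| is averaged over the shifted circle; by
  \<open>circle_mean_swap\<close> only a single Poisson integral at the point c remains. Its
  constant tends to one as R grows, which a pointwise use of the kernel bound would not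
  give.\<close>

lemma proximity_shift_le:
  assumes "nz_entire f" "0 < r" "norm c + r < R" "\<And>w. norm w = R \<Longrightarrow> f w \<noteq> 0"
  shows "proximity (\<lambda>z. f (c + z)) r \<le> (R + norm c) / (R - norm c) * proximity f R"
proof -
  have R0: "0 < R" using assms norm_ge_zero[of c] by linarith
  have cu: "continuous_on A (\<lambda>z. log_plus (norm (f z)))" for A
    by (intro continuous_on_log_plus continuous_on_norm nz_entire_cont assms)
  have z: "norm (c + z) < R" if "norm z = r" for z
    using norm_triangle_ineq[of c z] that assms(3) by linarith
  have cp: "continuous_on (sphere 0 r) (\<lambda>z. circle_mean R (\<lambda>\<zeta>. poisson_kernel (c + z) \<zeta> * log_plus (norm (f \<zeta>))))"
  proof -
    have ne: "of_real R * cis t \<noteq> c + z" if "norm z = r" for z t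
    proof
      assume "of_real R * cis t = c + z"
      then have "norm (of_real R * cis t) < R" using z[OF that] by simp
      then show False using R0 by (simp add: norm_mult)
    qed
    have cu': "continuous_on B (\<lambda>x. log_plus (norm (f (of_real R * cis (snd x)))))" for B :: "(complex \<times> real) set"
      by (rule continuous_on_compose2[OF cu[of UNIV]]) (auto intro!: continuous_intros)
    have "continuous_on (sphere 0 r \<times> cbox 0 (2 * pi))
        (\<lambda>(z, t). poisson_kernel (c + z) (of_real R * cis t) * log_plus (norm (f (of_real R * cis t))))"
      unfolding split_beta using ne by (intro continuous_on_mult cu' continuous_intros) auto
    from integral_continuous_on_param[OF this]
    show ?thesis unfolding circle_mean_def cbox_interval by (intro continuous_intros)
  qed
  have cf: "continuous_on A (\<lambda>z. log_plus (norm (f (c + z))))" for A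
    by (rule continuous_on_compose2[OF cu[of UNIV]]) (auto intro!: continuous_intros)
  have "proximity (\<lambda>z. f (c + z)) r \<le> circle_mean r (\<lambda>z. circle_mean R (\<lambda>\<zeta>. poisson_kernel (c + z) \<zeta> * log_plus (norm (f \<zeta>))))"
    using assms(2) R0 z by (intro circle_mean_mono cf cp poisson_ineq_log_plus assms(1,4)) auto
  also have "\<dots> = circle_mean R (\<lambda>\<zeta>. poisson_kernel c \<zeta> * log_plus (norm (f \<zeta>)))"
    by (rule circle_mean_swap[OF assms(2,3) cu])
  also have "\<dots> \<le> (R + norm c) / (R - norm c) * proximity f R"
    using assms(2,3) by (intro poisson_mean_le cu) auto
  finally show ?thesis .
qed

text \<open>The case c = 0 of the shift estimate gives monotonicity towards zero-free radii;
  continuity of the mean in the radius removes that restriction.\<close>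

lemma proximity_mono:
  assumes "nz_entire f" "0 < r" "r \<le> R"
  shows "proximity f r \<le> proximity f R"
proof (rule ccontr)
  assume neg: "\<not> ?thesis"
  then have "r < R" using assms(3) by (cases "r = R") auto
  have "continuous_on UNIV (\<lambda>r. proximity f r)"
    by (intro continuous_on_circle_mean_radius continuous_on_log_plus continuous_on_norm nz_entire_cont assms)
  then have "isCont (\<lambda>r. proximity f r) R" by (simp add: continuous_on_eq_continuous_at)
  moreover have "proximity f r - proximity f R > 0" using neg by simp
  ultimately obtain d where d: "d > 0" "\<And>x. dist x R < d \<Longrightarrow> dist (proximity f x) (proximity f R) < proximity f r - proximity f R"
    unfolding continuous_at_eps_delta by metis
  obtain s where s: "R < s" "s < R + d" "\<And>w. norm w = s \<Longrightarrow> f w \<noteq> 0"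
    using exists_zero_free_radius[OF assms(1), of R "R + d"] d assms by auto
  have "proximity f r \<le> proximity f s"
    using proximity_shift_le[OF assms(1,2), of 0 s] s assms by auto
  moreover have "proximity f s < proximity f r"
    using d(2)[of s] s by (auto simp: dist_real_def)
  ultimately show False by simp
qed

lemma nevanlinna_char_entire:
  assumes "f holomorphic_on UNIV"
  shows "nevanlinna_char r f = proximity f r"
proof -
  have "\<not> is_pole f z" for z
    by (rule not_is_pole_holomorphic[OF open_UNIV _ assms]) auto
  then have "pole_count f = (\<lambda>_. 0)" unfolding pole_count_def by auto
  then show ?thesis
    unfolding nevanlinna_char_def proximity_fun_def circle_mean_def integrated_count_def by simp
qed

lemma proximity_nonneg: "nz_entire f \<Longrightarrow> 0 \<le> r \<Longrightarrow> 0 \<le> proximity f r"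
  by (intro circle_mean_nonneg continuous_on_log_plus continuous_on_norm nz_entire_cont) auto

section \<open>Growth and logarithmic derivatives\<close>

lemma le_exp_trans: "x \<le> exp a \<Longrightarrow> a \<le> b \<Longrightarrow> x \<le> exp (b :: real)"
  by (rule order_trans[of x "exp a"]) auto

text \<open>Order at most \<rho> with finite type. The base 1 + |z| allows one constant on the whole
  plane, so that closure properties need no passage to large |z|.\<close>

definition growth_le :: "real \<Rightarrow> (complex \<Rightarrow> complex) \<Rightarrow> bool" where
  "growth_le \<rho> G \<longleftrightarrow> G holomorphic_on UNIV \<and>
     (\<exists>C\<ge>0. \<forall>z. norm (G z) \<le> exp (C * (1 + norm z) powr \<rho>))"

lemma growth_leI:
  assumes "G holomorphic_on UNIV" "0 \<le> C" "\<And>z. norm (G z) \<le> exp (C * (1 + norm z) powr \<rho>)"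
  shows "growth_le \<rho> G"
  using assms unfolding growth_le_def by blast

lemma growth_leE:
  assumes "growth_le \<rho> G"
  obtains C where "0 \<le> C" "\<And>z. norm (G z) \<le> exp (C * (1 + norm z) powr \<rho>)"
  using assms unfolding growth_le_def by blast

lemma growth_le_holo: "growth_le \<rho> G \<Longrightarrow> G holomorphic_on A"
  unfolding growth_le_def using holomorphic_on_subset by blast

lemma growth_le_mono:
  assumes "growth_le \<rho> G" "\<rho> \<le> \<rho>'"
  shows "growth_le \<rho>' G"
proof -
  obtain C where C: "0 \<le> C" "\<And>z. norm (G z) \<le> exp (C * (1 + norm z) powr \<rho>)"
    using growth_leE[OF assms(1)] by blast
  show ?thesis
  proof (rule growth_leI[OF growth_le_holo[OF assms(1)] C(1)])
    fix z :: complex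
    have "C * (1 + norm z) powr \<rho> \<le> C * (1 + norm z) powr \<rho>'"
      using C(1) assms(2) by (intro mult_left_mono powr_mono) auto
    then show "norm (G z) \<le> exp (C * (1 + norm z) powr \<rho>')"
      using C(2)[of z] by (blast intro: le_exp_trans)
  qed
qed

lemma growth_le_const: "0 \<le> \<rho> \<Longrightarrow> growth_le \<rho> (\<lambda>z. c)"
proof (rule growth_leI[where C = "norm c"])
  fix z :: complex assume "0 \<le> \<rho>"
  then have "1 \<le> (1 + norm z) powr \<rho>" by (simp add: ge_one_powr_ge_zero)
  then have "norm c * 1 \<le> norm c * (1 + norm z) powr \<rho>" by (intro mult_left_mono) auto
  moreover have "norm c \<le> exp (norm c)" using exp_ge_add_one_self[of "norm c"] by linarith
  ultimately show "norm c \<le> exp (norm c * (1 + norm z) powr \<rho>)"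
    by (simp add: le_exp_trans)
qed auto

lemma growth_le_mult:
  assumes "growth_le \<rho> F" "growth_le \<rho> G"
  shows "growth_le \<rho> (\<lambda>z. F z * G z)"
proof -
  obtain C where C: "0 \<le> C" "\<And>z. norm (F z) \<le> exp (C * (1 + norm z) powr \<rho>)"
    using growth_leE[OF assms(1)] by blast
  obtain D where D: "0 \<le> D" "\<And>z. norm (G z) \<le> exp (D * (1 + norm z) powr \<rho>)"
    using growth_leE[OF assms(2)] by blast
  show ?thesis
  proof (rule growth_leI[where C = "C + D"])
    show "(\<lambda>z. F z * G z) holomorphic_on UNIV"
      using assms growth_le_holo by (intro holomorphic_intros) auto
    show "norm (F z * G z) \<le> exp ((C + D) * (1 + norm z) powr \<rho>)" for z
      unfolding norm_mult distrib_right exp_add by (intro mult_mono C D) auto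
  qed (use C D in auto)
qed

lemma growth_le_add:
  assumes "growth_le \<rho> F" "growth_le \<rho> G" "0 \<le> \<rho>"
  shows "growth_le \<rho> (\<lambda>z. F z + G z)"
proof -
  obtain C where C: "0 \<le> C" "\<And>z. norm (F z) \<le> exp (C * (1 + norm z) powr \<rho>)"
    using growth_leE[OF assms(1)] by blast
  obtain D where D: "0 \<le> D" "\<And>z. norm (G z) \<le> exp (D * (1 + norm z) powr \<rho>)"
    using growth_leE[OF assms(2)] by blast
  show ?thesis
  \<comment> \<open>The summand 1 absorbs the factor 2 that the sum of two exponentials
    costs.\<close>
  proof (rule growth_leI[where C = "C + D + 1"])
    show "(\<lambda>z. F z + G z) holomorphic_on UNIV"
      using assms growth_le_holo by (intro holomorphic_intros) auto
    fix z :: complex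
    define X where "X = (1 + norm z) powr \<rho>"
    have X: "1 \<le> X" unfolding X_def using assms(3) by (simp add: ge_one_powr_ge_zero)
    have "norm (F z + G z) \<le> exp (C * X) + exp (D * X)"
      using C(2)[of z] D(2)[of z] norm_triangle_ineq[of "F z" "G z"] unfolding X_def by linarith
    also have "\<dots> \<le> 2 * exp ((C + D) * X)"
    proof -
      have "exp (C * X) \<le> exp ((C + D) * X)" "exp (D * X) \<le> exp ((C + D) * X)"
        using C(1) D(1) X by (auto intro!: mult_right_mono)
      then show ?thesis by linarith
    qed
    also have "\<dots> \<le> exp X * exp ((C + D) * X)"
    proof (rule mult_right_mono)
      show "2 \<le> exp X" using X exp_ge_add_one_self[of X] by linarith
    qed simp
    also have "\<dots> = exp ((C + D + 1) * X)" by (simp add: exp_add[symmetric] algebra_simps)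
    finally show "norm (F z + G z) \<le> exp ((C + D + 1) * (1 + norm z) powr \<rho>)" unfolding X_def .
  qed (use C D in auto)
qed

lemma growth_le_cmult: "0 \<le> \<rho> \<Longrightarrow> growth_le \<rho> G \<Longrightarrow> growth_le \<rho> (\<lambda>z. c * G z)"
  by (intro growth_le_mult growth_le_const)

lemma growth_le_diff:
  assumes "growth_le \<rho> F" "growth_le \<rho> G" "0 \<le> \<rho>"
  shows "growth_le \<rho> (\<lambda>z. F z - G z)"
  using growth_le_add[OF assms(1) growth_le_cmult[OF assms(3,2), of "- 1"] assms(3)] by simp

lemma growth_le_power:
  assumes "growth_le \<rho> G" "0 \<le> \<rho>"
  shows "growth_le \<rho> (\<lambda>z. G z ^ n)"
  by (induction n) (auto intro!: growth_le_mult growth_le_const assms)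

lemma one_add_powr_le:
  assumes "0 \<le> \<rho>" "0 \<le> x" "1 \<le> k" "1 + y \<le> k * (1 + x)" "0 \<le> y"
  shows "(1 + y) powr \<rho> \<le> k powr \<rho> * (1 + x) powr (\<rho> :: real)"
proof -
  have "(1 + y) powr \<rho> \<le> (k * (1 + x)) powr \<rho>" using assms by (intro powr_mono2) auto
  also have "\<dots> = k powr \<rho> * (1 + x) powr \<rho>" using assms by (simp add: powr_mult)
  finally show ?thesis .
qed

lemma growth_le_shift:
  assumes "growth_le \<rho> G" "0 \<le> \<rho>"
  shows "growth_le \<rho> (\<lambda>z. G (c + z))"
proof -
  obtain C where C: "0 \<le> C" "\<And>z. norm (G z) \<le> exp (C * (1 + norm z) powr \<rho>)"
    using growth_leE[OF assms(1)] by blast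
  show ?thesis
  proof (rule growth_leI[where C = "C * (1 + norm c) powr \<rho>"])
    have "(\<lambda>z. c + z) holomorphic_on UNIV" by (intro holomorphic_intros)
    from holomorphic_on_compose[OF this growth_le_holo[OF assms(1)]]
    show "(\<lambda>z. G (c + z)) holomorphic_on UNIV" by (simp add: o_def)
    fix z :: complex
    have "(1 + norm c) * (1 + norm z) = 1 + norm c + norm z + norm c * norm z" by (simp add: algebra_simps)
    then have "1 + norm (c + z) \<le> (1 + norm c) * (1 + norm z)"
      using norm_triangle_ineq[of c z] mult_nonneg_nonneg[OF norm_ge_zero[of c] norm_ge_zero[of z]]
      by linarith
    then have "(1 + norm (c + z)) powr \<rho> \<le> (1 + norm c) powr \<rho> * (1 + norm z) powr \<rho>"
      using assms(2) by (intro one_add_powr_le) auto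
    then have "C * (1 + norm (c + z)) powr \<rho> \<le> C * (1 + norm c) powr \<rho> * (1 + norm z) powr \<rho>"
      using C(1) by (simp add: mult_left_mono mult.assoc)
    then show "norm (G (c + z)) \<le> exp (C * (1 + norm c) powr \<rho> * (1 + norm z) powr \<rho>)"
      using C(2)[of "c + z"] by (blast intro: le_exp_trans)
  qed (use C in auto)
qed

text \<open>Cauchy's estimate on circles of radius one.\<close>

lemma growth_le_deriv:
  assumes "growth_le \<rho> G" "0 \<le> \<rho>"
  shows "growth_le \<rho> (deriv G)"
proof -
  obtain C where C: "0 \<le> C" "\<And>z. norm (G z) \<le> exp (C * (1 + norm z) powr \<rho>)"
    using growth_leE[OF assms(1)] by blast
  show ?thesis
  proof (rule growth_leI[where C = "C * 2 powr \<rho>"])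
    show "deriv G holomorphic_on UNIV"
      using growth_le_holo[OF assms(1)] by (intro holomorphic_deriv) auto
    fix z :: complex
    have "norm ((deriv ^^ 1) G z) \<le> fact 1 * exp (C * 2 powr \<rho> * (1 + norm z) powr \<rho>) / 1 ^ 1"
    proof (rule Cauchy_inequality)
      show "continuous_on (cball z 1) G" "G holomorphic_on ball z 1"
        using growth_le_holo[OF assms(1)] holomorphic_on_imp_continuous_on by blast+
      fix x assume "norm (z - x) = 1"
      then have "norm x \<le> norm z + 1" using norm_triangle_ineq3[of z x] by auto
      then have "(1 + norm x) powr \<rho> \<le> 2 powr \<rho> * (1 + norm z) powr \<rho>"
      proof (intro one_add_powr_le)
        have "1 + norm x \<le> 1 + (norm z + 1)" using \<open>norm x \<le> norm z + 1\<close> by (rule add_left_mono)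
        also have "\<dots> \<le> 2 * (1 + norm z)" by simp
        finally show "1 + norm x \<le> 2 * (1 + norm z)" .
      qed (use assms(2) in auto)
      then have "C * (1 + norm x) powr \<rho> \<le> C * 2 powr \<rho> * (1 + norm z) powr \<rho>"
        using C(1) by (simp add: mult_left_mono mult.assoc)
      then show "norm (G x) \<le> exp (C * 2 powr \<rho> * (1 + norm z) powr \<rho>)"
        using C(2)[of x] by (blast intro: le_exp_trans)
    qed auto
    then show "norm (deriv G z) \<le> exp (C * 2 powr \<rho> * (1 + norm z) powr \<rho>)" by simp
  qed (use C in auto)
qed

lemma growth_le_ident: "0 < \<rho> \<Longrightarrow> growth_le \<rho> (\<lambda>z. z)"
proof (rule growth_leI[where C = "1 / \<rho>"])
  fix z :: complex assume "0 < \<rho>"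
  then have "ln (1 + norm z) \<le> (1 + norm z) powr \<rho> / \<rho>" by (intro ln_powr_bound) auto
  then have "exp (ln (1 + norm z)) \<le> exp (1 / \<rho> * (1 + norm z) powr \<rho>)" by simp
  moreover have "norm z \<le> exp (ln (1 + norm z))" by (subst exp_ln) (auto simp: add_pos_nonneg)
  ultimately show "norm z \<le> exp (1 / \<rho> * (1 + norm z) powr \<rho>)" by linarith
qed auto

lemma growth_le_poly: "0 < \<rho> \<Longrightarrow> growth_le \<rho> (poly p)"
proof (induction p)
  case 0
  then show ?case using growth_le_const[of \<rho> 0] by (simp add: poly_0[abs_def])
next
  case (pCons a p)
  have "poly (pCons a p) = (\<lambda>z. a + z * poly p z)" by (simp add: fun_eq_iff)
  then show ?case using pCons by (auto intro!: growth_le_add growth_le_mult growth_le_const growth_le_ident)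
qed

lemma growth_le_exp_linear: "1 \<le> \<rho> \<Longrightarrow> growth_le \<rho> (\<lambda>z. exp (a * z))"
proof (rule growth_leI[where C = "norm a"])
  fix z :: complex assume "1 \<le> \<rho>"
  then have "(1 + norm z) powr 1 \<le> (1 + norm z) powr \<rho>" by (intro powr_mono) auto
  then have "norm z \<le> (1 + norm z) powr \<rho>" by simp
  then have "norm (a * z) \<le> norm a * (1 + norm z) powr \<rho>"
    unfolding norm_mult by (rule mult_left_mono) simp
  then show "norm (exp (a * z)) \<le> exp (norm a * (1 + norm z) powr \<rho>)"
    using norm_exp[of "a * z"] by (blast intro: le_exp_trans)
qed (auto intro!: holomorphic_intros)

lemma norm_poly_le:
  fixes p :: "complex poly"
  shows "\<exists>C\<ge>0. \<forall>z. norm (poly p z) \<le> C * (1 + norm z) ^ degree p"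
proof (induction p)
  case 0
  then show ?case by (intro exI[of _ 0]) auto
next
  case (pCons a p)
  then obtain C where C: "C \<ge> 0" "\<And>z. norm (poly p z) \<le> C * (1 + norm z) ^ degree p" by blast
  show ?case
  proof (intro exI[of _ "norm a + C"] conjI allI)
    fix z :: complex
    show "norm (poly (pCons a p) z) \<le> (norm a + C) * (1 + norm z) ^ degree (pCons a p)"
    proof (cases "p = 0")
      case True
      then show ?thesis using C(1) by simp
    next
      case False
      have "norm (poly (pCons a p) z) \<le> norm a + norm z * norm (poly p z)"
        by (simp add: norm_triangle_ineq flip: norm_mult)
      also have "\<dots> \<le> norm a * 1 + (1 + norm z) * (C * (1 + norm z) ^ degree p)"
        using C by (intro add_mono mult_mono) auto
      also have "\<dots> \<le> norm a * (1 + norm z) ^ Suc (degree p) + (1 + norm z) * (C * (1 + norm z) ^ degree p)"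
        by (intro add_mono mult_left_mono order_refl one_le_power) auto
      also have "\<dots> = (norm a + C) * (1 + norm z) ^ degree (pCons a p)"
        using False by (simp add: algebra_simps)
      finally show ?thesis .
    qed
  qed (use C in auto)
qed

lemma growth_le_exp_poly: "growth_le (real (degree p)) (\<lambda>z. exp (poly p z))"
proof -
  obtain C where C: "C \<ge> 0" "\<And>z. norm (poly p z) \<le> C * (1 + norm z) ^ degree p"
    using norm_poly_le by blast
  show ?thesis
  proof (rule growth_leI[OF _ C(1)])
    fix z :: complex
    have "norm (poly p z) \<le> C * (1 + norm z) powr real (degree p)"
      using C(2)[of z] by (subst powr_realpow) (auto simp: add_pos_nonneg)
    then show "norm (exp (poly p z)) \<le> exp (C * (1 + norm z) powr real (degree p))"
      using norm_exp[of "poly p z"] by (blast intro: le_exp_trans)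
  qed (auto intro!: holomorphic_intros)
qed

section \<open>Passing between pointwise growth, proximity functions and numbers of zeros\<close>

lemma proximity_le_growth:
  assumes "growth_le \<rho> G"
  obtains C where "0 \<le> C" "\<And>r. 0 \<le> r \<Longrightarrow> proximity G r \<le> C * (1 + r) powr \<rho>"
proof -
  obtain C where C: "0 \<le> C" "\<And>z. norm (G z) \<le> exp (C * (1 + norm z) powr \<rho>)"
    using growth_leE[OF assms(1)] by blast
  have "proximity G r \<le> C * (1 + r) powr \<rho>" if "0 \<le> r" for r
  proof (rule circle_mean_le_const[OF that])
    show "continuous_on (sphere 0 r) (\<lambda>z. log_plus (norm (G z)))"
      by (intro continuous_on_log_plus continuous_on_norm holomorphic_on_imp_continuous_on growth_le_holo[OF assms])
    fix z :: complex assume "norm z = r"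
    then show "log_plus (norm (G z)) \<le> C * (1 + r) powr \<rho>"
      using C(1) C(2)[of z] by (intro log_plus_le) auto
  qed
  with C(1) that show ?thesis by blast
qed

text \<open>Poisson's inequality on a circle of radius just above 2 |z| bounds log+ |f(z)| by three
  times the proximity there; the finitely large remaining disc is covered by compactness.\<close>

lemma growth_le_if_proximity:
  assumes "nz_entire f" "0 \<le> \<rho>" "eventually (\<lambda>r. proximity f r \<le> r powr \<rho>) at_top"
  shows "growth_le \<rho> f"
proof -
  obtain r0 where r0: "\<And>r. r \<ge> r0 \<Longrightarrow> proximity f r \<le> r powr \<rho>"
    using assms(3) unfolding eventually_at_top_linorder by blast
  have "compact (f ` cball 0 r0)"
    by (intro compact_continuous_image nz_entire_cont assms) auto
  then obtain M where M: "M > 0" "\<And>z. norm z \<le> r0 \<Longrightarrow> norm (f z) \<le> M"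
    using compact_imp_bounded[of "f ` cball 0 r0"] unfolding bounded_pos by auto
  show ?thesis
  proof (rule growth_leI[where C = "3 * 2 powr \<rho> + M"])
    fix z :: complex
    define X where "X = (1 + norm z) powr \<rho>"
    have X: "1 \<le> X" unfolding X_def using assms(2) by (simp add: ge_one_powr_ge_zero)
    have "norm (f z) \<le> exp ((3 * 2 powr \<rho> + M) * X)"
    proof (cases "norm z \<le> r0")
      case True
      have "M * 1 \<le> (3 * 2 powr \<rho> + M) * X" using X M by (intro mult_mono) auto
      then show ?thesis using M(2)[OF True] exp_ge_add_one_self[of "(3 * 2 powr \<rho> + M) * X"] by linarith
    next
      case False
      obtain R where R: "2 * norm z < R" "R < 2 * norm z + 1" "\<And>w. norm w = R \<Longrightarrow> f w \<noteq> 0"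
        using exists_zero_free_radius[OF assms(1), of "2 * norm z" "2 * norm z + 1"] by auto
      have R0: "0 < R" using R(1) norm_ge_zero[of z] by linarith
      have "log_plus (norm (f z)) \<le> (R + norm z) / (R - norm z) * proximity f R"
        using R norm_ge_zero[of z] R0 by (intro log_plus_le_proximity assms(1) R(3)) linarith+
      also have "\<dots> \<le> 3 * R powr \<rho>"
      proof (intro mult_mono)
        show "(R + norm z) / (R - norm z) \<le> 3" using R norm_ge_zero[of z] R0 by (simp add: field_simps)
        show "proximity f R \<le> R powr \<rho>" using False R(1) norm_ge_zero[of z] by (intro r0) linarith
        show "0 \<le> proximity f R" using R0 by (intro proximity_nonneg assms(1)) auto
      qed auto
      also have "R powr \<rho> \<le> (1 + (2 * norm z)) powr \<rho>"
        using R R0 assms(2) by (intro powr_mono2) auto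
      also have "\<dots> \<le> 2 powr \<rho> * X"
        unfolding X_def using assms(2) by (intro one_add_powr_le) auto
      finally have "log_plus (norm (f z)) \<le> 3 * 2 powr \<rho> * X" by simp
      also have "\<dots> \<le> (3 * 2 powr \<rho> + M) * X" using M X by (intro mult_right_mono) auto
      finally show ?thesis using le_exp_log_plus[of "norm (f z)"] by (blast intro: le_exp_trans)
    qed
    then show "norm (f z) \<le> exp ((3 * 2 powr \<rho> + M) * (1 + norm z) powr \<rho>)" unfolding X_def .
  qed (use assms nz_entire_holo M in auto)
qed

text \<open>The inequality in Nevanlinna's first main theorem: log+ (1/x) = log+ x - ln x, and
  Jensen's formula bounds the mean of ln |G| from below.\<close>

lemma proximity_inverse_le:
  assumes "nz_entire G" "1 \<le> r" "\<And>w. norm w = r \<Longrightarrow> G w \<noteq> 0"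
  shows "circle_mean r (\<lambda>z. log_plus (1 / norm (G z))) \<le> proximity G r - leading_ln G"
proof -
  have "circle_mean r (\<lambda>z. log_plus (1 / norm (G z)))
      = circle_mean r (\<lambda>z. log_plus (norm (G z)) - ln (norm (G z)))"
  proof (rule circle_mean_cong)
    fix z :: complex assume "norm z = r"
    then have "0 < norm (G z)" using assms(3) by auto
    then show "log_plus (1 / norm (G z)) = log_plus (norm (G z)) - ln (norm (G z))"
      by (simp add: log_plus_eq_max ln_div max_def)
  qed (use assms in auto)
  also have "\<dots> = proximity G r - mean_ln G r"
    using assms by (intro circle_mean_diff continuous_on_log_plus continuous_on_norm nz_entire_cont continuous_on_ln_norm) auto
  also have "\<dots> \<le> proximity G r - leading_ln G"
    using jensen_ge[OF assms] by simp
  finally show ?thesis .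
qed

lemma circle_mean_ln_le_proximity:
  assumes "nz_entire G" "0 \<le> r" "\<And>w. norm w = r \<Longrightarrow> G w \<noteq> 0"
  shows "mean_ln G r \<le> proximity G r"
  by (intro circle_mean_mono continuous_on_log_plus continuous_on_norm nz_entire_cont
      continuous_on_ln_norm ln_le_log_plus assms norm_ge_zero)

text \<open>On a circle of radius R > 2 r each zero of modulus at most r has weight at least ln 2,
  also one at the origin since R > 2. Hence Jensen's formula bounds their number by the proximity at
  R.\<close>

lemma card_zeros_le:
  assumes "nz_entire G" "growth_le \<rho> G" "0 \<le> \<rho>"
  obtains C where "0 \<le> C" "\<And>r. 1 \<le> r \<Longrightarrow> real (card {a. norm a \<le> r \<and> G a = 0}) \<le> C * (1 + r) powr \<rho>"
proof -
  obtain D where D: "0 \<le> D" "\<And>r. 0 \<le> r \<Longrightarrow> proximity G r \<le> D * (1 + r) powr \<rho>"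
    using proximity_le_growth[OF assms(2)] by blast
  define C where "C = (D * 2 powr \<rho> + \<bar>leading_ln G\<bar>) / ln 2"
  have "real (card {a. norm a \<le> r \<and> G a = 0}) \<le> C * (1 + r) powr \<rho>" if r: "1 \<le> r" for r
  proof -
    define X where "X = (1 + r) powr \<rho>"
    have X: "1 \<le> X" unfolding X_def using assms(3) r by (simp add: ge_one_powr_ge_zero)
    obtain R where R: "2 * r < R" "R < 2 * r + 1" "\<And>w. norm w = R \<Longrightarrow> G w \<noteq> 0"
      using exists_zero_free_radius[OF assms(1), of "2 * r" "2 * r + 1"] r by auto
    have w: "0 \<le> log_weight R a" if "norm a < R" for a
      using R r that by (intro log_weight_nonneg) auto
    have "real (card {a. norm a \<le> r \<and> G a = 0}) * ln 2 = (\<Sum>a | norm a \<le> r \<and> G a = 0. ln 2)" by simp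
    also have "\<dots> \<le> (\<Sum>a | norm a \<le> r \<and> G a = 0. zero_mult G a * log_weight R a)"
    proof (rule sum_mono)
      fix a assume a: "a \<in> {a. norm a \<le> r \<and> G a = 0}"
      then have "0 < zero_mult G a" using nz_entire_zorder(2)[OF assms(1), of a] by blast
      then have m: "1 \<le> real (zero_mult G a)" by linarith
      have "ln 2 \<le> log_weight R a"
        unfolding log_weight_def using a R(1) r by (auto intro!: ln_mono simp: field_simps)
      then have "1 * ln 2 \<le> zero_mult G a * log_weight R a" using m by (intro mult_mono) auto
      then show "ln 2 \<le> zero_mult G a * log_weight R a" by simp
    qed
    also have "\<dots> \<le> counting_mult G R"
      using R r w by (intro sum_mono2 finite_zeros assms(1)) auto
    also have "\<dots> = mean_ln G R - leading_ln G"
      using jensen_formula[OF assms(1) _ R(3)] R(1) r by simp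
    also have "\<dots> \<le> D * (1 + R) powr \<rho> + \<bar>leading_ln G\<bar>"
    proof -
      have "mean_ln G R \<le> proximity G R"
        by (rule circle_mean_ln_le_proximity[OF assms(1) _ R(3)]) (use R r in auto)
      then show ?thesis using D(2)[of R] R(1) r by linarith
    qed
    also have "\<dots> \<le> D * (2 powr \<rho> * X) + \<bar>leading_ln G\<bar> * X"
    proof (intro add_mono mult_left_mono)
      show "(1 + R) powr \<rho> \<le> 2 powr \<rho> * X"
        unfolding X_def using R r assms(3) by (intro one_add_powr_le) auto
      show "\<bar>leading_ln G\<bar> \<le> \<bar>leading_ln G\<bar> * X" using X by (simp add: mult_le_cancel_left1)
    qed (use D in auto)
    finally have "real (card {a. norm a \<le> r \<and> G a = 0}) * ln 2 \<le> (D * 2 powr \<rho> + \<bar>leading_ln G\<bar>) * X"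
      by (simp add: algebra_simps)
    then show ?thesis unfolding C_def X_def by (simp add: field_simps)
  qed
  moreover have "0 \<le> C" unfolding C_def using D(1) by simp
  ultimately show ?thesis using that by blast
qed

section \<open>Circles at a distance from the zeros, and logarithmic derivatives\<close>

lemma ln_le_self: "0 < x \<Longrightarrow> ln x \<le> (x :: real)"
  using ln_le_minus_one[of x] by linarith

text \<open>Pigeonhole principle: the candidates are the midpoints of N + 1 equal parts of
  [r, r + 1]. The open intervals of half a part's length around them are disjoint, so N points
  cannot meet all of them.\<close>

lemma separated_radius_aux:
  assumes "finite A" "card A \<le> N"
  shows "\<exists>i\<in>{..N}. \<forall>a\<in>A. 1 / (2 * (real N + 1)) \<le> \<bar>a - (r + (2 * real i + 1) / (2 * (real N + 1)))\<bar>"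
proof (rule ccontr)
  define h where "h = 1 / (2 * (real N + 1))"
  have h: "h > 0" unfolding h_def by simp
  assume "\<not> ?thesis"
  then have "\<forall>i\<in>{..N}. \<exists>a\<in>A. \<bar>a - (r + (2 * real i + 1) * h)\<bar> < h"
    unfolding h_def by (simp add: not_le)
  then obtain p where p: "\<And>i. i \<in> {..N} \<Longrightarrow> p i \<in> A" "\<And>i. i \<in> {..N} \<Longrightarrow> \<bar>p i - (r + (2 * real i + 1) * h)\<bar> < h"
    by metis
  have "inj_on p {..N}"
  proof (rule inj_onI)
    fix i j assume ij: "i \<in> {..N}" "j \<in> {..N}" "p i = p j"
    have "\<bar>(2 * real i + 1) * h - (2 * real j + 1) * h\<bar> < 2 * h"
      using p(2)[OF ij(1)] p(2)[OF ij(2)] ij(3) by (smt (verit))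
    also have "(2 * real i + 1) * h - (2 * real j + 1) * h = 2 * h * (real i - real j)" by (simp add: algebra_simps)
    finally have "\<bar>real i - real j\<bar> < 1" using h by (simp add: abs_mult)
    then show "i = j" by linarith
  qed
  then have "card {..N} \<le> card A" using p(1) assms(1) by (intro card_inj_on_le) auto
  then show False using assms(2) by simp
qed

text \<open>The number of zeros grows at most polynomially, so \<eta> can be an inverse polynomial
  and ln (1 / \<eta>) is of logarithmic size; the linear bound is all that is used later.\<close>

lemma separated_radius:
  assumes "nz_entire G" "growth_le \<rho> G" "0 \<le> \<rho>"
  shows "\<exists>C\<ge>0. \<forall>r\<ge>1. \<exists>s \<eta>. r < s \<and> s < r + 1 \<and> 0 < \<eta> \<and> \<eta> \<le> 1 \<and>
     ln (1 / \<eta>) \<le> C * (1 + r) \<and> (\<forall>w. G w = 0 \<longrightarrow> \<eta> \<le> \<bar>norm w - s\<bar>)"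
proof -
  obtain D where D: "0 \<le> D" "\<And>r. 1 \<le> r \<Longrightarrow> real (card {a. norm a \<le> r \<and> G a = 0}) \<le> D * (1 + r) powr \<rho>"
    using card_zeros_le[OF assms] by blast
  have "\<exists>s \<eta>. r < s \<and> s < r + 1 \<and> 0 < \<eta> \<and> \<eta> \<le> 1 \<and>
     ln (1 / \<eta>) \<le> (2 + D + 2 * \<rho>) * (1 + r) \<and> (\<forall>w. G w = 0 \<longrightarrow> \<eta> \<le> \<bar>norm w - s\<bar>)" if r: "1 \<le> r" for r
  proof -
    \<comment> \<open>Zeros of modulus above r + 2 keep a distance of at least one from s < r + 1,
      so only those up to r + 2 compete.\<close>
    define Z where "Z = {a. norm a \<le> r + 2 \<and> G a = 0}"
    define N where "N = card Z"
    define \<eta> where "\<eta> = 1 / (2 * (real N + 1))"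
    have fin: "finite Z" unfolding Z_def by (rule finite_zeros_cball[OF assms(1)])
    have "card (norm ` Z) \<le> N" unfolding N_def by (rule card_image_le[OF fin])
    from separated_radius_aux[OF _ this, of r] fin
    obtain i where i: "i \<le> N" "\<And>a. a \<in> Z \<Longrightarrow> \<eta> \<le> \<bar>norm a - (r + (2 * real i + 1) / (2 * (real N + 1)))\<bar>"
      unfolding \<eta>_def by auto
    define s where "s = r + (2 * real i + 1) / (2 * (real N + 1))"
    have s: "r < s" "s < r + 1" unfolding s_def using i(1) by (auto simp: field_simps)
    have eta: "0 < \<eta>" "\<eta> \<le> 1" unfolding \<eta>_def by (auto simp: field_simps)
    have sep: "\<eta> \<le> \<bar>norm w - s\<bar>" if "G w = 0" for w
    proof (cases "norm w \<le> r + 2")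
      case True
      then show ?thesis using i(2)[of w] that unfolding Z_def s_def by auto
    next
      case False
      then show ?thesis using s eta by linarith
    qed
    have "ln (1 / \<eta>) \<le> (2 + D + 2 * \<rho>) * (1 + r)"
    proof -
      have "1 / \<eta> = 2 * (real N + 1)" unfolding \<eta>_def by simp
      also have "\<dots> \<le> 2 * (D + 1) * (3 + r) powr \<rho>"
      proof -
        have "real N \<le> D * (1 + (r + 2)) powr \<rho>" unfolding N_def Z_def using r by (intro D(2)) auto
        moreover have "1 \<le> (3 + r) powr \<rho>" using r assms(3) by (intro ge_one_powr_ge_zero) auto
        ultimately show ?thesis by (simp add: algebra_simps)
      qed
      finally have "ln (1 / \<eta>) \<le> ln (2 * (D + 1) * (3 + r) powr \<rho>)" using eta by (intro ln_mono) auto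
      also have "\<dots> = ln (2 * (D + 1)) + \<rho> * ln (3 + r)" using D(1) r by (simp add: ln_mult ln_powr)
      also have "\<dots> \<le> 2 * (D + 1) + \<rho> * (2 * (1 + r))"
        using D(1) r assms(3) ln_le_self[of "2 * (D + 1)"] ln_le_minus_one[of "3 + r"]
        by (intro add_mono mult_left_mono) auto
      also have "\<dots> \<le> (2 + D + 2 * \<rho>) * (1 + r)"
      proof -
        have "2 * (D + 1) \<le> (2 + D) * (1 + r)" using D(1) r mult_left_mono[of 1 r "2 + D"] by (simp add: algebra_simps)
        then show ?thesis by (simp add: algebra_simps)
      qed
      finally show ?thesis .
    qed
    with s eta sep show ?thesis by blast
  qed
  moreover have "0 \<le> 2 + D + 2 * \<rho>" using D(1) assms(3) by simp
  ultimately show ?thesis by blast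
qed

text \<open>The centred logarithm x of G, on the disc rescaled to radius one, takes values in the
  half-plane Re < D. The Moebius map x / (2 D - x) sends this half-plane into the unit disc and
  fixes 0, and Schwarz's lemma bounds the derivative at the centre.\<close>

lemma borel_caratheodory_log_deriv:
  assumes G: "G holomorphic_on ball z \<eta>" and \<eta>: "0 < \<eta>"
    and nz: "\<And>w. w \<in> ball z \<eta> \<Longrightarrow> G w \<noteq> 0" and A: "\<And>w. w \<in> ball z \<eta> \<Longrightarrow> ln (norm (G w)) \<le> A"
  shows "norm (deriv G z / G z) \<le> 2 * (A + 1 - ln (norm (G z))) / \<eta>"
proof -
  obtain k where k: "k holomorphic_on ball z \<eta>" "\<And>w. w \<in> ball z \<eta> \<Longrightarrow> exp (k w) = G w"
    using holomorphic_logarithm_exists[of "ball z \<eta>" G z] G \<eta> nz by auto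
  have z: "z \<in> ball z \<eta>" using \<eta> by simp
  have ln: "ln (norm (G w)) = Re (k w)" if "w \<in> ball z \<eta>" for w
    using k(2)[OF that, symmetric] by simp
  \<comment> \<open>The summand 1 makes \<open>D\<close> positive and the inequality Re x < D strict
    even if ln |G| attains the bound A.\<close>
  define D where "D = A + 1 - Re (k z)"
  have D: "D > 0" unfolding D_def using A[OF z] ln[OF z] by linarith
  have w: "z + of_real \<eta> * x \<in> ball z \<eta>" if "norm x < 1" for x
    using that \<eta> by (simp add: dist_norm norm_mult)
  define x where "x w = k (z + of_real \<eta> * w) - k z" for w
  define \<psi> where "\<psi> w = x w / (2 * of_real D - x w)" for w
  have Re_x: "Re (x w) < D" if "norm w < 1" for w
    unfolding x_def D_def using A[OF w[OF that]] ln[OF w[OF that]] by simp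
  have x_ne: "2 * of_real D - x w \<noteq> 0" if "norm w < 1" for w
  proof
    assume "2 * of_real D - x w = 0"
    then have "Re (2 * of_real D - x w) = 0" by (simp only:) simp
    then show False using Re_x[OF that] D by simp
  qed
  have kd: "(k has_field_derivative deriv k z) (at z)"
    using k(1) z by (intro holomorphic_derivI[where S = "ball z \<eta>"]) auto
  have xholo: "x holomorphic_on ball 0 1"
  proof -
    have "(\<lambda>w. z + of_real \<eta> * w) holomorphic_on ball 0 1" by (intro holomorphic_intros)
    moreover have "(\<lambda>w. z + of_real \<eta> * w) ` ball 0 1 \<subseteq> ball z \<eta>" using w by auto
    ultimately have "(k \<circ> (\<lambda>w. z + of_real \<eta> * w)) holomorphic_on ball 0 1"
      using k(1) holomorphic_on_compose_gen by blast
    then have "(\<lambda>w. k (z + of_real \<eta> * w)) holomorphic_on ball 0 1" by (simp add: o_def)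
    then show ?thesis unfolding x_def by (intro holomorphic_intros)
  qed
  have "norm (deriv \<psi> 0) \<le> 1"
  proof (rule Schwarz_Lemma(2)[of \<psi> 0])
    show "\<psi> holomorphic_on ball 0 1"
      unfolding \<psi>_def using xholo x_ne by (intro holomorphic_intros) auto
    show "\<psi> 0 = 0" unfolding \<psi>_def x_def by simp
    fix w :: complex assume "norm w < 1"
    have "(norm (2 * of_real D - x w))\<^sup>2 - (norm (x w))\<^sup>2 = 4 * D * (D - Re (x w))"
      unfolding cmod_power2 by (simp add: power2_eq_square algebra_simps)
    also have "\<dots> > 0" using D Re_x[OF \<open>norm w < 1\<close>] by simp
    finally have "(norm (x w))\<^sup>2 < (norm (2 * of_real D - x w))\<^sup>2" by simp
    then have "norm (x w) < norm (2 * of_real D - x w)" by (rule power2_less_imp_less) simp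
    then show "norm (\<psi> w) < 1" unfolding \<psi>_def norm_divide using x_ne[OF \<open>norm w < 1\<close>] by simp
  qed simp
  moreover have "(\<psi> has_field_derivative of_real \<eta> * deriv k z / (2 * of_real D)) (at 0)"
  proof -
    have "((\<lambda>w. k (z + of_real \<eta> * w)) has_field_derivative deriv k z * of_real \<eta>) (at 0)"
      by (rule DERIV_chain2[where g = "\<lambda>w. z + of_real \<eta> * w"]) (use kd in \<open>auto intro!: derivative_eq_intros\<close>)
    then have dx: "(x has_field_derivative deriv k z * of_real \<eta>) (at 0)"
      unfolding x_def by (auto intro!: derivative_eq_intros)
    have "x 0 = 0" unfolding x_def by simp
    then show ?thesis unfolding \<psi>_def using dx D
      by (auto intro!: derivative_eq_intros simp: field_simps)
  qed
  then have "deriv \<psi> 0 = of_real \<eta> * deriv k z / (2 * of_real D)" by (rule DERIV_imp_deriv)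
  ultimately have "\<eta> * norm (deriv k z) \<le> 2 * D"
    using \<eta> D by (simp add: norm_divide norm_mult field_simps)
  moreover have "deriv k z = deriv G z / G z"
  proof -
    have "((\<lambda>w. exp (k w)) has_field_derivative exp (k z) * deriv k z) (at z)"
      using kd by (auto intro!: derivative_eq_intros)
    then have "(G has_field_derivative exp (k z) * deriv k z) (at z)"
      by (rule has_field_derivative_transform_within_open[where S = "ball z \<eta>"]) (use k(2) z in auto)
    then have "deriv G z = G z * deriv k z" using DERIV_imp_deriv k(2)[OF z] by metis
    then show ?thesis using nz[OF z] by simp
  qed
  ultimately show ?thesis using \<eta> ln[OF z] unfolding D_def by (simp add: field_simps)
qed

text \<open>A circle at distance \<eta> from the zeros of a product is at that distance from the
  zeros of every factor, so bounds for several functions can be used on one circle. \<eta> stays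
  free because it depends on the circle.\<close>

abbreviation on_separated_circles :: "(complex \<Rightarrow> complex) \<Rightarrow> (real \<Rightarrow> real \<Rightarrow> bool) \<Rightarrow> bool" where
  "on_separated_circles G X \<equiv> \<forall>r \<eta>. 1 \<le> r \<longrightarrow> 0 < \<eta> \<longrightarrow> \<eta> \<le> 1 \<longrightarrow>
     (\<forall>w. G w = 0 \<longrightarrow> \<eta> \<le> \<bar>norm w - r\<bar>) \<longrightarrow> X r \<eta>"

text \<open>Keeping a distance \<open>\<eta>\<close> from the zeros allows a pointwise Borel-Caratheodory estimate on discs of
  radius \<open>\<eta>\<close>, and makes the usual integration over the zeros in the lemma on the logarithmic derivative
  unnecessary.\<close>

lemma log_deriv_mean:
  assumes "nz_entire G" "growth_le \<rho> G" "0 \<le> \<rho>"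
  shows "\<exists>C\<ge>0. on_separated_circles G (\<lambda>r \<eta>.
     circle_mean r (\<lambda>z. ln (1 + norm (deriv G z / G z))) \<le> C * (1 + r) + ln (1 / \<eta>))"
proof -
  obtain D where D: "0 \<le> D" "\<And>z. norm (G z) \<le> exp (D * (1 + norm z) powr \<rho>)"
    using growth_leE[OF assms(2)] by blast
  define C where "C = 3 + \<bar>leading_ln G\<bar> + D * 2 powr \<rho> + \<rho>"
  have "circle_mean r (\<lambda>z. ln (1 + norm (deriv G z / G z))) \<le> C * (1 + r) + ln (1 / \<eta>)"
    if r: "1 \<le> r" and eta: "0 < \<eta>" "\<eta> \<le> 1" and sep': "\<forall>w. G w = 0 \<longrightarrow> \<eta> \<le> \<bar>norm w - r\<bar>" for r \<eta>
  proof -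
    note sep = sep'[rule_format]
    define B where "B = (1 + r) powr \<rho>"
    define A where "A = D * 2 powr \<rho> * B"
    have B: "1 \<le> B" unfolding B_def using assms(3) r by (simp add: ge_one_powr_ge_zero)
    have good: "G w \<noteq> 0" if "norm w = r" for w using sep[of w] that eta by auto
    have lnA: "ln (norm (G w)) \<le> A" if "G w \<noteq> 0" "norm w \<le> r + 1" for w
    proof -
      have "(1 + norm w) powr \<rho> \<le> 2 powr \<rho> * (1 + r) powr \<rho>"
        using that(2) r assms(3) by (intro one_add_powr_le) auto
      then have "D * (1 + norm w) powr \<rho> \<le> A"
        unfolding A_def B_def using D(1) by (simp add: mult_left_mono mult.assoc)
      then have "norm (G w) \<le> exp A" using D(2)[of w] by (blast intro: le_exp_trans)
      then have "ln (norm (G w)) \<le> ln (exp A)" using that by (intro ln_mono) auto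
      then show ?thesis by simp
    qed
    \<comment> \<open>\<open>Y - 1\<close> is the bracket in the Borel-Caratheodory bound; the extra
      one absorbs the summand 1 in 1 + |G'/G|, and Y \<ge> 2 keeps its logarithm under
      control.\<close>
    define Y where "Y z = 2 + A - ln (norm (G z))" for z
    have Y2: "2 \<le> Y z" if "norm z = r" for z
      unfolding Y_def using lnA[of z] good[OF that] that by simp
    have cl: "continuous_on (sphere 0 r) (\<lambda>z. ln (norm (G z)))" by (rule continuous_on_ln_norm[OF assms(1) good])
    have cY: "continuous_on (sphere 0 r) Y" unfolding Y_def by (intro continuous_intros cl)
    have cd: "continuous_on (sphere 0 r) (deriv G)"
      by (intro holomorphic_on_imp_continuous_on holomorphic_on_subset[OF holomorphic_deriv[of G UNIV]] nz_entire_holo assms) auto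
    \<comment> \<open>By Jensen's formula the mean of Y is at most a constant multiple of B, so Y /
      B has bounded mean. Splitting ln Y = ln B + ln (Y / B) and using ln x \<le> x therefore does
      the work of concavity of the logarithm.\<close>
    have "circle_mean r (\<lambda>z. ln (1 + norm (deriv G z / G z))) \<le> circle_mean r (\<lambda>z. ln (2 / \<eta>) + ln B + 1 / B * Y z)"
    proof (rule circle_mean_mono)
      show "continuous_on (sphere 0 r) (\<lambda>z. ln (1 + norm (deriv G z / G z)))"
        using good by (intro continuous_intros cd nz_entire_cont assms) (auto simp: add_pos_nonneg less_imp_neq[symmetric])
      show "continuous_on (sphere 0 r) (\<lambda>z. ln (2 / \<eta>) + ln B + 1 / B * Y z)" by (intro continuous_intros cY)
      fix z :: complex assume z: "norm z = r"
      have nz: "G w \<noteq> 0" "norm w \<le> r + 1" if "w \<in> ball z \<eta>" for w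
      proof -
        have "\<bar>norm w - r\<bar> < \<eta>" using that z norm_triangle_ineq3[of w z]
          by (simp add: dist_norm norm_minus_commute)
        then show "G w \<noteq> 0" "norm w \<le> r + 1" using sep[of w] eta by auto
      qed
      have "norm (deriv G z / G z) \<le> 2 * (A + 1 - ln (norm (G z))) / \<eta>"
        using nz lnA eta by (intro borel_caratheodory_log_deriv nz_entire_holo assms) auto
      then have "1 + norm (deriv G z / G z) \<le> 1 + 2 * (Y z - 1) / \<eta>" unfolding Y_def by (simp add: algebra_simps)
      also have "\<dots> \<le> 2 / \<eta> * Y z" using eta by (simp add: field_simps)
      finally have "ln (1 + norm (deriv G z / G z)) \<le> ln (2 / \<eta> * Y z)"
        by (intro ln_mono) (auto simp: add_pos_nonneg)
      also have "\<dots> = ln (2 / \<eta>) + ln (B * (Y z / B))" using eta Y2[OF z] B by (subst ln_mult) auto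
      also have "ln (B * (Y z / B)) = ln B + ln (Y z / B)" using Y2[OF z] B by (subst ln_mult) auto
      also have "ln (Y z / B) \<le> Y z / B" using Y2[OF z] B by (intro ln_le_self) auto
      finally show "ln (1 + norm (deriv G z / G z)) \<le> ln (2 / \<eta>) + ln B + 1 / B * Y z" by simp
    qed (use r in auto)
    also have "\<dots> = ln (2 / \<eta>) + ln B + 1 / B * circle_mean r Y"
      using r by (subst circle_mean_add) (auto intro!: continuous_intros cY simp: circle_mean_cmult simp del: times_divide_eq_left)
    also have "circle_mean r Y = 2 + A - mean_ln G r"
      unfolding Y_def using r by (subst circle_mean_diff) (auto intro!: cl)
    also have "ln (2 / \<eta>) + ln B + 1 / B * (2 + A - mean_ln G r)
        \<le> (1 + ln (1 / \<eta>)) + \<rho> * (1 + r) + (2 + \<bar>leading_ln G\<bar> + D * 2 powr \<rho>)"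
    proof (intro add_mono)
      show "ln (2 / \<eta>) \<le> 1 + ln (1 / \<eta>)" using eta ln_le_minus_one[of 2] by (simp add: ln_div)
      show "ln B \<le> \<rho> * (1 + r)" unfolding B_def using r assms(3) ln_le_self[of "1 + r"]
        by (simp add: ln_powr mult_left_mono)
      have "2 + A - mean_ln G r \<le> (2 + \<bar>leading_ln G\<bar>) * 1 + A"
        using jensen_ge[OF assms(1) r good] by simp
      also have "\<dots> \<le> (2 + \<bar>leading_ln G\<bar>) * B + A" using B by (intro add_mono mult_left_mono) auto
      also have "\<dots> = B * (2 + \<bar>leading_ln G\<bar> + D * 2 powr \<rho>)" unfolding A_def by (simp add: algebra_simps)
      finally show "1 / B * (2 + A - mean_ln G r) \<le> 2 + \<bar>leading_ln G\<bar> + D * 2 powr \<rho>"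
        using B by (simp add: field_simps)
    qed
    also have "\<dots> \<le> C * (1 + r) + ln (1 / \<eta>)"
    proof -
      define E where "E = 3 + \<bar>leading_ln G\<bar> + D * 2 powr \<rho>"
      have "E * 1 \<le> E * (1 + r)" unfolding E_def using D(1) r by (intro mult_left_mono) auto
      then show ?thesis unfolding C_def E_def by (simp add: algebra_simps)
    qed
    finally show ?thesis .
  qed
  moreover have "0 \<le> C" unfolding C_def using D(1) assms(3) by simp
  ultimately show ?thesis by blast
qed

section \<open>Borel's theorem on exponential sums\<close>

lemma log_plus_mult_le: "0 \<le> x \<Longrightarrow> 0 \<le> y \<Longrightarrow> log_plus (x * y) \<le> log_plus x + log_plus y"
proof (rule log_plus_le)
  assume "0 \<le> x" "0 \<le> y"
  then show "x * y \<le> exp (log_plus x + log_plus y)"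
    unfolding exp_add by (intro mult_mono le_exp_log_plus) auto
qed auto

text \<open>The integrand is continuous and non-negative, and at z = u it equals 1 - \<gamma> >
  0.\<close>

lemma circle_mean_cap_pos:
  assumes "norm u = 1" "\<gamma> < 1"
  shows "circle_mean 1 (\<lambda>z. max 0 (Re (cnj u * z) - \<gamma>)) > 0"
proof -
  let ?f = "\<lambda>\<theta>. max 0 (Re (cnj u * (of_real 1 * cis \<theta>)) - \<gamma>)"
  have c: "continuous_on {0..2*pi} ?f" by (intro continuous_intros)
  have "Arg2pi u \<in> {0..2*pi}" using Arg2pi_ge_0[of u] Arg2pi_lt_2pi[of u] by simp
  moreover have "?f (Arg2pi u) \<noteq> 0"
  proof -
    have "u = cis (Arg2pi u)" using Arg2pi_eq[of u] assms(1) by (simp add: cis_conv_exp mult.commute)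
    then have "cnj u * cis (Arg2pi u) = cnj u * u" by simp
    also have "\<dots> = 1" using complex_norm_square[of u] assms(1) by (simp add: mult.commute)
    finally show ?thesis using assms(2) by simp
  qed
  ultimately have "integral {0..2*pi} ?f \<noteq> 0"
    using integral_eq_0_iff[OF c] by force
  moreover have "integral {0..2*pi} ?f \<ge> 0"
    by (intro integral_nonneg integrable_continuous_real c) auto
  ultimately show ?thesis unfolding circle_mean_def by simp
qed

text \<open>By Jensen's formula the circle means of \<open>ln |A|\<close> are bounded below.\<close>

lemma no_exponential_decay_in_sector:
  assumes A: "nz_entire A" and u: "norm u = 1" "\<gamma> < 1" and s: "s < 1" and \<delta>: "0 < \<delta>"
    and bound: "\<And>z. 1 \<le> norm z \<Longrightarrow> A z \<noteq> 0 \<Longrightarrow>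
      ln (norm (A z)) \<le> D * (1 + norm z) powr s - \<delta> * norm z * max 0 (Re (cnj u * z) / norm z - \<gamma>)"
  shows False
proof -
  define m where "m = circle_mean 1 (\<lambda>z. max 0 (Re (cnj u * z) - \<gamma>))"
  have m: "m > 0" unfolding m_def by (rule circle_mean_cap_pos[OF u])
  have main: "leading_ln A \<le> D * (1 + r) powr s - \<delta> * r * m"
    if r: "1 \<le> r" and good: "\<And>w. norm w = r \<Longrightarrow> A w \<noteq> 0" for r
  proof -
    have mr: "circle_mean r (\<lambda>z. max 0 (Re (cnj u * z) / r - \<gamma>)) = m"
    proof -
      have "Re (cnj u * (of_real r * cis \<theta>)) / r = Re (cnj u * (of_real 1 * cis \<theta>))" for \<theta>
        using r by (simp add: field_simps)
      then show ?thesis unfolding m_def circle_mean_def by (simp only:)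
    qed
    have cm: "continuous_on (sphere 0 r) (\<lambda>z. max 0 (Re (cnj u * z) / r - \<gamma>))"
      using r by (intro continuous_intros) auto
    have "leading_ln A \<le> mean_ln A r" by (rule jensen_ge[OF A r good])
    also have "\<dots> \<le> circle_mean r (\<lambda>z. D * (1 + r) powr s - \<delta> * r * max 0 (Re (cnj u * z) / r - \<gamma>))"
    proof (rule circle_mean_mono)
      show "continuous_on (sphere 0 r) (\<lambda>z. ln (norm (A z)))" by (rule continuous_on_ln_norm[OF A good])
      fix z :: complex assume "norm z = r"
      then show "ln (norm (A z)) \<le> D * (1 + r) powr s - \<delta> * r * max 0 (Re (cnj u * z) / r - \<gamma>)"
        using bound[of z] good[of z] r by auto
    qed (use r in \<open>auto intro!: continuous_intros cm\<close>)
    also have "\<dots> = D * (1 + r) powr s - \<delta> * r * m"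
      using r mr by (subst circle_mean_diff) (auto intro!: continuous_intros cm simp: circle_mean_cmult)
    finally show ?thesis .
  qed
  \<comment> \<open>After division by r the growth term vanishes in the limit because s < 1, whereas
    the decay leaves the fixed amount \<delta> m > 0.\<close>
  have "((\<lambda>r::real. D * ((1 + r) powr s / r) - leading_ln A / r) \<longlongrightarrow> D * 0 - 0) at_top"
  proof (intro tendsto_diff tendsto_mult tendsto_const)
    show "((\<lambda>r::real. (1 + r) powr s / r) \<longlongrightarrow> 0) at_top" using s by real_asymp
    have "((\<lambda>r::real. c / r) \<longlongrightarrow> 0) at_top" for c by real_asymp
    then show "((\<lambda>r::real. leading_ln A / r) \<longlongrightarrow> 0) at_top" .
  qed
  then have "eventually (\<lambda>r. D * ((1 + r) powr s / r) - leading_ln A / r < \<delta> * m) at_top"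
    using m \<delta> by (intro order_tendstoD(2)) auto
  then obtain r0 where r0: "\<And>r. r \<ge> r0 \<Longrightarrow> D * ((1 + r) powr s / r) - leading_ln A / r < \<delta> * m"
    unfolding eventually_at_top_linorder by blast
  obtain r where r: "max 1 r0 < r" "\<And>w. norm w = r \<Longrightarrow> A w \<noteq> 0"
    using exists_zero_free_radius[OF A, of "max 1 r0" "max 1 r0 + 1"] by (auto simp: le_max_iff_disj)
  then have "D * (1 + r) powr s - leading_ln A < \<delta> * m * r"
    using r0[of r] by (simp add: field_simps)
  moreover have "leading_ln A \<le> D * (1 + r) powr s - \<delta> * r * m" by (rule main) (use r in auto)
  ultimately show False by (simp add: algebra_simps)
qed

text \<open>A point of maximal modulus is strictly extremal in its own direction: |b'| \<le> |b| and
  b' \<noteq> b force Re ((b' - b) cnj b) < 0, by expanding |b' - b|^2. Finiteness of the set turns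
  this into a uniform gap.\<close>

lemma extremal_direction:
  fixes B :: "complex set"
  assumes "finite B" "b \<in> B" "\<And>b'. b' \<in> B \<Longrightarrow> norm b' \<le> norm b" "b \<noteq> 0"
  obtains \<eta> where "0 < \<eta>" "\<And>b'. b' \<in> B - {b} \<Longrightarrow> Re ((b' - b) * (cnj b / of_real (norm b))) \<le> - \<eta>"
proof -
  define e where "e b' = - Re ((b' - b) * (cnj b / of_real (norm b)))" for b'
  have pos: "e b' > 0" if "b' \<in> B - {b}" for b'
  proof -
    have "0 < (norm (b' - b))\<^sup>2" using that by simp
    also have "\<dots> = (norm b')\<^sup>2 - (norm b)\<^sup>2 - 2 * Re ((b' - b) * cnj b)"
      unfolding cmod_power2 by (simp add: power2_eq_square algebra_simps)
    finally have *: "0 < (norm b')\<^sup>2 - (norm b)\<^sup>2 - 2 * Re ((b' - b) * cnj b)" .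
    have "2 * Re ((b' - b) * cnj b) < 0"
    proof -
      have "(norm b')\<^sup>2 \<le> (norm b)\<^sup>2" using that by (intro power_mono assms(3)) auto
      with * show ?thesis by linarith
    qed
    then have "Re ((b' - b) * cnj b) / norm b < 0" using assms(4) by (simp add: divide_neg_pos)
    moreover have "(b' - b) * (cnj b / of_real (norm b)) = (b' - b) * cnj b / of_real (norm b)" by simp
    ultimately show ?thesis unfolding e_def by (simp only: Re_divide_of_real)
  qed
  define \<eta> where "\<eta> = Min (insert 1 (e ` (B - {b})))"
  have "0 < \<eta>" unfolding \<eta>_def using assms(1) pos by (subst Min_gr_iff) auto
  moreover have "\<eta> \<le> e b'" if "b' \<in> B - {b}" for b'
    unfolding \<eta>_def using assms(1) that by (intro Min_le) auto
  ultimately show ?thesis unfolding e_def by (intro that[of \<eta>]) (auto simp: le_minus_iff)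
qed

text \<open>Division by exp(b z) expresses A_b through the other terms, whose factors exp((b' - b)
  z) all decay exponentially in a sector around cnj b / |b|. A non-zero function of order below one
  cannot be that small there.\<close>

lemma borel_top_coefficient:
  assumes B: "finite B" "b \<in> B" "\<And>b'. b' \<in> B \<Longrightarrow> norm b' \<le> norm b" and s: "0 \<le> s" "s < 1"
    and A: "\<And>b. b \<in> B \<Longrightarrow> growth_le s (A b)"
    and eq: "\<And>z. (\<Sum>b\<in>B. A b z * exp (b * z)) = 0"
  shows "A b z = 0"
proof (cases "b = 0")
  case True
  then have "B = {0}" using B(2,3) by fastforce
  then show ?thesis using eq[of z] True by simp
next
  case b0: False
  show ?thesis
  proof (rule ccontr)
    assume "A b z \<noteq> 0"
    then have nz: "nz_entire (A b)" unfolding nz_entire_def using growth_le_holo[OF A[OF B(2)]] by auto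
    obtain \<eta> where \<eta>: "0 < \<eta>" "\<And>b'. b' \<in> B - {b} \<Longrightarrow> Re ((b' - b) * (cnj b / of_real (norm b))) \<le> - \<eta>"
      using extremal_direction[OF B b0] by blast
    define u where "u = cnj b / of_real (norm b)"
    have u: "norm u = 1" unfolding u_def using b0 by (simp add: norm_divide)
    \<comment> \<open>Moving the direction by at most \<rho> changes Re ((b' - b) w) by at most 2
      |b| \<rho> \<le> \<eta> / 2, which leaves half of the gap.\<close>
    define \<rho> where "\<rho> = min 1 (\<eta> / (4 * norm b))"
    have \<rho>: "0 < \<rho>" "\<rho> \<le> 1" "2 * norm b * \<rho> \<le> \<eta> / 2"
      unfolding \<rho>_def using \<eta> b0 by (auto simp: min_def field_simps)
    have "\<forall>b'\<in>B. \<exists>C\<ge>0. \<forall>z. norm (A b' z) \<le> exp (C * (1 + norm z) powr s)"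
      using A unfolding growth_le_def by blast
    then obtain C where C: "\<And>b'. b' \<in> B \<Longrightarrow> 0 \<le> C b'"
      "\<And>b' z. b' \<in> B \<Longrightarrow> norm (A b' z) \<le> exp (C b' * (1 + norm z) powr s)"
      by metis
    define D where "D = sum C B"
    have D0: "0 \<le> D" unfolding D_def using C(1) by (intro sum_nonneg) auto
    have D: "norm (A b' z) \<le> exp (D * (1 + norm z) powr s)" if "b' \<in> B" for b' z
    proof (rule le_exp_trans[OF C(2)[OF that]])
      have "C b' \<le> D" unfolding D_def using C(1) that B(1) by (intro member_le_sum) auto
      then show "C b' * (1 + norm z) powr s \<le> D * (1 + norm z) powr s" by (intro mult_right_mono) auto
    qed
    \<comment> \<open>For unit vectors, Re (cnj u w) > 1 - \<rho>^2 / 2 means |w - u| < \<rho>,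
      hence the threshold. The summand \<open>card B\<close> pays for the number of terms in the
      sum.\<close>
    show False
    proof (rule no_exponential_decay_in_sector[OF nz u, of "1 - \<rho>\<^sup>2 / 2" s "\<eta> / 2" "D + card B"])
      fix z :: complex assume z: "1 \<le> norm z" "A b z \<noteq> 0"
      define X where "X = (1 + norm z) powr s"
      have X: "1 \<le> X" unfolding X_def using s(1) by (simp add: ge_one_powr_ge_zero)
      define cap where "cap = max 0 (Re (cnj u * z) / norm z - (1 - \<rho>\<^sup>2 / 2))"
      have "norm (A b z) \<le> exp ((D + card B) * X - \<eta> / 2 * norm z * cap)"
      proof (cases "Re (cnj u * z) / norm z \<le> 1 - \<rho>\<^sup>2 / 2")
        case True
        then have "cap = 0" unfolding cap_def by simp
        moreover have "D * X \<le> (D + card B) * X" using X by (intro mult_right_mono) auto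
        ultimately show ?thesis using D[OF B(2), of z] unfolding X_def by (auto intro: le_exp_trans)
      next
        case False
        define w where "w = z / of_real (norm z)"
        have w: "norm w = 1" "z = of_real (norm z) * w" unfolding w_def using z by (auto simp: norm_divide)
        have Rew: "Re (cnj u * z) / norm z = Re (cnj u * w)"
          unfolding w_def times_divide_eq_right Re_divide_of_real ..
        have "(norm (w - u))\<^sup>2 = (norm w)\<^sup>2 + (norm u)\<^sup>2 - 2 * Re (cnj u * w)"
          unfolding cmod_power2 by (simp add: power2_eq_square algebra_simps)
        also have "\<dots> \<le> \<rho>\<^sup>2" using False w(1) u unfolding Rew by simp
        finally have wu: "norm (w - u) \<le> \<rho>" by (rule power2_le_imp_le) (use \<rho>(1) in simp)
        have "cap \<le> 1"
        proof -
          have "Re (cnj u * w) \<le> norm (cnj u * w)" by (rule complex_Re_le_cmod)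
          then have "Re (cnj u * w) \<le> 1" using w u by (simp add: norm_mult)
          moreover have "\<rho>\<^sup>2 \<le> 1" using \<rho> by (simp add: power_le_one)
          ultimately show ?thesis unfolding cap_def Rew by simp
        qed
        have decay: "norm (exp ((b' - b) * z)) \<le> exp (- (\<eta> / 2 * norm z))" if "b' \<in> B - {b}" for b'
        proof -
          have "Re ((b' - b) * w) = Re ((b' - b) * u) + Re ((b' - b) * (w - u))" by (simp add: algebra_simps)
          also have "\<dots> \<le> - \<eta> + norm ((b' - b) * (w - u))"
            using \<eta>(2)[OF that] complex_Re_le_cmod[of "(b' - b) * (w - u)"] unfolding u_def by linarith
          also have "norm ((b' - b) * (w - u)) \<le> (2 * norm b) * \<rho>"
            unfolding norm_mult using wu norm_triangle_ineq4[of b' b] B(3)[of b'] that by (intro mult_mono) auto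
          finally have "Re ((b' - b) * w) \<le> - (\<eta> / 2)" using \<rho>(3) by linarith
          then have "norm z * Re ((b' - b) * w) \<le> norm z * (- (\<eta> / 2))" by (intro mult_left_mono) auto
          moreover have "Re ((b' - b) * z) = norm z * Re ((b' - b) * w)"
            by (subst w(2)) (simp add: algebra_simps)
          ultimately show ?thesis by (simp add: mult.commute)
        qed
        have "0 = (\<Sum>b'\<in>B. A b' z * exp (b' * z)) * exp (- b * z)" using eq by simp
        also have "\<dots> = (\<Sum>b'\<in>B. A b' z * exp ((b' - b) * z))"
          unfolding sum_distrib_right by (intro sum.cong refl) (simp add: mult.assoc exp_add[symmetric] algebra_simps)
        also have "\<dots> = A b z + (\<Sum>b'\<in>B - {b}. A b' z * exp ((b' - b) * z))"
          using B(1,2) by (subst sum.remove[of B b]) auto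
        finally have "A b z = - (\<Sum>b'\<in>B - {b}. A b' z * exp ((b' - b) * z))"
          by (simp add: eq_neg_iff_add_eq_0)
        then have "norm (A b z) = norm (\<Sum>b'\<in>B - {b}. A b' z * exp ((b' - b) * z))"
          by (simp only: norm_minus_cancel)
        also have "\<dots> \<le> (\<Sum>b'\<in>B - {b}. exp (D * X) * exp (- (\<eta> / 2 * norm z)))"
          by (rule sum_norm_le) (use D decay in \<open>auto simp: norm_mult X_def simp del: norm_exp_eq_Re intro!: mult_mono\<close>)
        also have "\<dots> = card (B - {b}) * exp (D * X - \<eta> / 2 * norm z)" by (simp add: mult_exp_exp)
        also have "\<dots> \<le> exp (card B * X) * exp (D * X - \<eta> / 2 * norm z)"
        proof (rule mult_right_mono)
          have "real (card (B - {b})) \<le> real (card B) * 1" using B(1) by (simp add: card_mono)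
          also have "\<dots> \<le> card B * X" using X by (intro mult_left_mono) auto
          finally show "real (card (B - {b})) \<le> exp (card B * X)"
            using exp_ge_add_one_self[of "card B * X"] by linarith
        qed simp
        also have "\<dots> = exp ((D + card B) * X - \<eta> / 2 * norm z)"
          by (simp add: exp_add[symmetric] algebra_simps)
        also have "\<dots> \<le> exp ((D + card B) * X - \<eta> / 2 * norm z * cap)"
        proof -
          have "\<eta> / 2 * norm z * cap \<le> \<eta> / 2 * norm z * 1" using \<open>cap \<le> 1\<close> \<eta>(1) by (intro mult_left_mono) auto
          then show ?thesis by simp
        qed
        finally show ?thesis .
      qed
      then have "ln (norm (A b z)) \<le> ln (exp ((D + card B) * X - \<eta> / 2 * norm z * cap))"
        using z(2) by (intro ln_mono) auto
      then show "ln (norm (A b z)) \<le> (D + card B) * (1 + norm z) powr s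
          - \<eta> / 2 * norm z * max 0 (Re (cnj u * z) / norm z - (1 - \<rho>\<^sup>2 / 2))"
        unfolding X_def cap_def by simp
    qed (use \<rho> \<eta> s in auto)
  qed
qed

text \<open>Induction on the number of exponents, each time removing one of largest modulus, whose
  coefficient has just been shown to vanish.\<close>

theorem borel_exponential_independence:
  assumes "finite B" and s: "0 \<le> s" "s < 1"
    and "\<And>b. b \<in> B \<Longrightarrow> growth_le s (A b)"
    and "\<And>z. (\<Sum>b\<in>B. A b z * exp (b * z)) = 0"
    and "b \<in> B"
  shows "A b z = 0"
  using assms(1,4,5,6)
proof (induction "card B" arbitrary: B b z rule: less_induct)
  case less
  have "\<exists>m\<in>B. \<forall>b'\<in>B. norm b' \<le> norm m"
  proof -
    have fin: "finite (norm ` B)" "norm ` B \<noteq> {}" using less.prems(1,4) by auto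
    then obtain m where "m \<in> B" "Max (norm ` B) = norm m" using Max_in[OF fin] by (metis imageE)
    then show ?thesis using fin Max_ge[OF fin(1)] by (intro bexI[of _ m]) auto
  qed
  then obtain m where m: "m \<in> B" "\<And>b'. b' \<in> B \<Longrightarrow> norm b' \<le> norm m" by blast
  have A0: "A m z = 0" for z
    by (rule borel_top_coefficient[OF less.prems(1) m s less.prems(2,3)])
  show ?case
  proof (cases "b = m")
    case True
    then show ?thesis using A0 by simp
  next
    case False
    show ?thesis
    proof (rule less.hyps[of "B - {m}" b])
      show "card (B - {m}) < card B" using m(1) less.prems(1) by (intro psubset_card_mono) auto
      show "(\<Sum>b\<in>B - {m}. A b z * exp (b * z)) = 0" for z
        using less.prems(3)[of z] less.prems(1) m(1) A0[of z] by (simp add: sum.remove[of B m])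
    qed (use less.prems False in auto)
  qed
qed

section \<open>The degree of Q from the growth of exp(Q)\<close>

lemma poly_Re_growth_degree:
  fixes Q :: "complex poly"
  assumes "degree Q > 0" "\<And>z. Re (poly Q z) \<le> C * (1 + norm z) powr \<rho>"
  shows "real (degree Q) \<le> \<rho>"
proof (rule ccontr)
  assume neg: "\<not> real (degree Q) \<le> \<rho>"
  define d where "d = degree Q"
  define a where "a = lead_coeff Q"
  have a: "a \<noteq> 0" unfolding a_def using assms(1) by auto
  \<comment> \<open>Along this ray the leading term a (t w)^d is the positive number |a| t^d, so Re
    Q(t w) / t^d tends to |a| > 0.\<close>
  define w where "w = cis (- Arg a / real d)"
  have "w ^ d = cis (- Arg a)" unfolding w_def Complex.DeMoivre using assms(1) by (simp add: d_def)
  moreover have "a = of_real (norm a) * cis (Arg a)"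
    using rcis_cmod_Arg[of a] unfolding rcis_def by simp
  ultimately have "a * w ^ d = of_real (norm a) * cis (Arg a) * cis (- Arg a)" by metis
  then have awd: "a * w ^ d = of_real (norm a)" by (simp add: cis_mult mult.assoc)
  have w: "norm w = 1" unfolding w_def by simp
  have lim: "((\<lambda>x. poly Q x / x ^ d) \<longlongrightarrow> a) at_infinity"
    unfolding d_def a_def by (rule poly_divide_tendsto_aux)
  have "filterlim (\<lambda>t::real. of_real t * w) at_infinity at_top"
    unfolding filterlim_at_infinity_conv_norm_at_top norm_mult w by simp real_asymp
  from filterlim_compose[OF lim this]
  have "((\<lambda>t::real. poly Q (of_real t * w) / (of_real t * w) ^ d * w ^ d) \<longlongrightarrow> a * w ^ d) at_top"
    by (intro tendsto_mult tendsto_const)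
  from tendsto_Re[OF this]
  have lim1: "((\<lambda>t::real. Re (poly Q (of_real t * w) / (of_real t * w) ^ d * w ^ d)) \<longlongrightarrow> norm a) at_top"
    unfolding awd by simp
  have "\<rho> < real d" using neg unfolding d_def by simp
  then have "((\<lambda>t::real. (1 + t) powr \<rho> / t powr real d) \<longlongrightarrow> 0) at_top" by real_asymp
  then have lim2: "((\<lambda>t::real. C * ((1 + t) powr \<rho> / t powr real d)) \<longlongrightarrow> C * 0) at_top"
    by (intro tendsto_intros)
  have "eventually (\<lambda>t::real. Re (poly Q (of_real t * w) / (of_real t * w) ^ d * w ^ d)
      \<le> C * ((1 + t) powr \<rho> / t powr real d)) at_top"
    using eventually_gt_at_top[of 0]
  proof eventually_elim
    case (elim t)
    have "w ^ d \<noteq> 0" using w by auto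
    then have "poly Q (of_real t * w) / (of_real t * w) ^ d * w ^ d = poly Q (of_real t * w) / of_real (t ^ d)"
      by (simp add: power_mult_distrib)
    then have "Re (poly Q (of_real t * w) / (of_real t * w) ^ d * w ^ d) = Re (poly Q (of_real t * w)) / t ^ d"
      by (simp only: Re_divide_of_real)
    also have "\<dots> \<le> C * (1 + t) powr \<rho> / t ^ d"
      using assms(2)[of "of_real t * w"] elim w by (intro divide_right_mono) (auto simp: norm_mult)
    finally show ?case using elim by (simp add: powr_realpow)
  qed
  from tendsto_le[OF _ lim2 lim1 this] have "norm a \<le> 0" by simp
  then show False using a by simp
qed

text \<open>The quotient E / h cannot be bounded pointwise near the zeros of h. Its mean can: log+
  |exp(Q)| \<le> log+ |E| + log+ (1 / |h|), and the first main theorem controls the last term. Since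
  exp(Q) is entire, Poisson's inequality returns from the mean to a pointwise bound for Re
  Q.\<close>

theorem degree_le_growth:
  fixes Q :: "complex poly"
  assumes h: "nz_entire h" "growth_le \<rho> h" and E: "growth_le \<rho> E" and "0 \<le> \<rho>"
    and eq: "\<And>z. exp (poly Q z) * h z = E z" and "degree Q > 0"
  shows "real (degree Q) \<le> \<rho>"
proof -
  have Q: "nz_entire (\<lambda>z. exp (poly Q z))"
    by (rule nz_entire_exp_poly)
  have Enz: "nz_entire E" using nz_entire_mult[OF Q h(1)] eq by simp
  obtain C1 where C1: "0 \<le> C1" "\<And>r. 0 \<le> r \<Longrightarrow> proximity h r \<le> C1 * (1 + r) powr \<rho>"
    using proximity_le_growth[OF h(2)] by blast
  obtain C2 where C2: "0 \<le> C2" "\<And>r. 0 \<le> r \<Longrightarrow> proximity E r \<le> C2 * (1 + r) powr \<rho>"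
    using proximity_le_growth[OF E] by blast
  define C where "C = 3 * ((C1 + C2) * 3 powr \<rho> + \<bar>leading_ln h\<bar>)"
  have "Re (poly Q z) \<le> C * (1 + norm z) powr \<rho>" for z
  proof -
    define X where "X = (1 + norm z) powr \<rho>"
    have X: "1 \<le> X" unfolding X_def using assms(4) by (simp add: ge_one_powr_ge_zero)
    obtain R where R: "2 * norm z + 1 < R" "R < 2 * norm z + 2" "\<And>w. norm w = R \<Longrightarrow> h w \<noteq> 0"
      using exists_zero_free_radius[OF h(1), of "2 * norm z + 1" "2 * norm z + 2"] by auto
    have R1: "1 \<le> R" using R(1) norm_ge_zero[of z] by linarith
    note cont = continuous_on_log_plus continuous_on_norm nz_entire_cont
    have cinv: "continuous_on (sphere 0 R) (\<lambda>z. log_plus (1 / norm (h z)))"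
      using R(3) by (intro continuous_intros nz_entire_cont h(1)) auto
    have "proximity (\<lambda>z. exp (poly Q z)) R \<le> circle_mean R (\<lambda>z. log_plus (norm (E z)) + log_plus (1 / norm (h z)))"
    proof (rule circle_mean_mono)
      fix z :: complex assume "norm z = R"
      then have "h z \<noteq> 0" using R(3) by blast
      then have "norm (exp (poly Q z)) = norm (E z) * (1 / norm (h z))"
        unfolding eq[symmetric] norm_mult by simp
      then show "log_plus (norm (exp (poly Q z))) \<le> log_plus (norm (E z)) + log_plus (1 / norm (h z))"
        using log_plus_mult_le[of "norm (E z)" "1 / norm (h z)"] by simp
    qed (use R1 in \<open>auto intro!: continuous_on_add cont Q Enz cinv simp del: norm_exp_eq_Re\<close>)
    also have "\<dots> = proximity E R + circle_mean R (\<lambda>z. log_plus (1 / norm (h z)))"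
      using R1 by (intro circle_mean_add cont Enz cinv) auto
    also have "circle_mean R (\<lambda>z. log_plus (1 / norm (h z))) \<le> proximity h R - leading_ln h"
      by (rule proximity_inverse_le[OF h(1) R1 R(3)])
    also have "proximity E R + (proximity h R - leading_ln h) \<le> (C1 + C2) * (1 + R) powr \<rho> + \<bar>leading_ln h\<bar>"
      using C1(2)[of R] C2(2)[of R] R1 by (simp add: algebra_simps)
    also have "\<dots> \<le> (C1 + C2) * (3 powr \<rho> * X) + \<bar>leading_ln h\<bar> * X"
    proof (intro add_mono mult_left_mono)
      show "(1 + R) powr \<rho> \<le> 3 powr \<rho> * X"
      proof -
        have "1 + R \<le> 3 + 2 * norm z" using R(2) by linarith
        also have "\<dots> \<le> 3 * (1 + norm z)" by simp
        finally show ?thesis unfolding X_def using R1 assms(4) by (intro one_add_powr_le) auto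
      qed
      show "\<bar>leading_ln h\<bar> \<le> \<bar>leading_ln h\<bar> * X" using X by (simp add: mult_le_cancel_left1)
    qed (use C1 C2 in auto)
    finally have prox: "proximity (\<lambda>z. exp (poly Q z)) R \<le> ((C1 + C2) * 3 powr \<rho> + \<bar>leading_ln h\<bar>) * X"
      by (simp add: algebra_simps)
    have "Re (poly Q z) = ln (norm (exp (poly Q z)))" by simp
    also have "\<dots> \<le> log_plus (norm (exp (poly Q z)))" by (rule ln_le_log_plus) simp
    also have "\<dots> \<le> (R + norm z) / (R - norm z) * proximity (\<lambda>z. exp (poly Q z)) R"
    proof (rule log_plus_le_proximity[OF Q])
      show "0 < R" using R1 by linarith
      show "norm z < R" using R(1) norm_ge_zero[of z] by linarith
    qed simp
    also have "\<dots> \<le> 3 * (((C1 + C2) * 3 powr \<rho> + \<bar>leading_ln h\<bar>) * X)"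
    proof (intro mult_mono prox)
      have "(R + n) / (R - n) \<le> 3" if "0 \<le> n" "2 * n + 1 < R" for n
        using that by (simp add: field_simps)
      then show "(R + norm z) / (R - norm z) \<le> 3" using R(1) norm_ge_zero by blast
      show "0 \<le> proximity (\<lambda>z. exp (poly Q z)) R" using R1 by (intro proximity_nonneg Q) auto
    qed auto
    finally show ?thesis unfolding C_def X_def by (simp only: mult.assoc)
  qed
  then show ?thesis using poly_Re_growth_degree[OF assms(6)] by blast
qed

section \<open>Multiplicities of Wronskians\<close>

text \<open>V may vanish at a, which is why only an inequality results. The identity is required off
  a only, so that it may be obtained by dividing by w - a.\<close>

lemma zero_mult_geI:
  assumes W: "nz_entire W" and V: "V holomorphic_on ball a e" "0 < e"
    and eq: "\<And>w. w \<in> ball a e \<Longrightarrow> w \<noteq> a \<Longrightarrow> W w = (w - a) ^ n * V w"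
  shows "n \<le> zero_mult W a"
proof (rule ccontr)
  assume neg: "\<not> ?thesis"
  define m where "m = zero_mult W a"
  have mn: "m < n" using neg unfolding m_def by simp
  obtain d where d: "d > 0" "zor_poly W a holomorphic_on cball a d"
      "\<forall>w\<in>cball a d. W w = zor_poly W a w * (w - a) ^ m"
    using nz_entire_zorder(4)[OF W, of a] unfolding m_def by blast
  have "zor_poly W a w = (w - a) ^ (n - m) * V w" if "w \<in> ball a (min d e)" "w \<noteq> a" for w
  proof -
    have "zor_poly W a w * (w - a) ^ m = (w - a) ^ n * V w"
      using d(3) eq[of w] that by auto
    also have "(w - a) ^ n = (w - a) ^ (n - m) * (w - a) ^ m"
      using mn by (simp add: power_add[symmetric])
    finally show ?thesis using that(2) by simp
  qed
  then have ev: "eventually (\<lambda>w. zor_poly W a w = (w - a) ^ (n - m) * V w) (at a)"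
    unfolding eventually_at using d(1) V(2) by (intro exI[of _ "min d e"]) (auto simp: dist_commute)
  have "isCont (zor_poly W a) a" "isCont V a"
    using d(1) V holomorphic_on_imp_continuous_on[OF holomorphic_on_subset[OF d(2) ball_subset_cball]]
      holomorphic_on_imp_continuous_on[OF V(1)]
    by (auto simp: continuous_on_eq_continuous_at)
  then have "isCont (zor_poly W a) a" "isCont (\<lambda>w. (w - a) ^ (n - m) * V w) a"
    by (auto intro!: continuous_intros)
  then have lim: "(zor_poly W a \<longlongrightarrow> zor_poly W a a) (at a)" "((\<lambda>w. (w - a) ^ (n - m) * V w) \<longlongrightarrow> (a - a) ^ (n - m) * V a) (at a)"
    unfolding isCont_def by blast+
  from Lim_transform_eventually[OF lim(1) ev]
  have "zor_poly W a a = (a - a) ^ (n - m) * V a"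
    by (rule tendsto_unique[OF trivial_limit_at _ lim(2)])
  then have "zor_poly W a a = 0" using mn by simp
  then show False using nz_entire_zorder(3)[OF W] by blast
qed

text \<open>The derivative is multiplied by w - a so that its formula carries the exponent m rather
  than m - 1 and includes the case m = 0.\<close>

lemma nz_entire_local_factor:
  assumes "nz_entire G"
  obtains u d where "d > 0" "u holomorphic_on ball a d"
    "\<And>w. w \<in> ball a d \<Longrightarrow> G w = (w - a) ^ zero_mult G a * u w"
    "\<And>w. w \<in> ball a d \<Longrightarrow> w \<noteq> a \<Longrightarrow> (w - a) * deriv G w
        = (w - a) ^ zero_mult G a * (of_nat (zero_mult G a) * u w + (w - a) * deriv u w)"
proof -
  define m where "m = zero_mult G a"
  obtain d where d: "d > 0" "zor_poly G a holomorphic_on cball a d"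
      "\<forall>w\<in>cball a d. G w = zor_poly G a w * (w - a) ^ m"
    using nz_entire_zorder(4)[OF assms, of a] unfolding m_def by blast
  define u where "u = zor_poly G a"
  have u: "u holomorphic_on ball a d" unfolding u_def by (rule holomorphic_on_subset[OF d(2) ball_subset_cball])
  have G: "G w = (w - a) ^ m * u w" if "w \<in> ball a d" for w
    using d(3) that unfolding u_def by (auto simp: mult.commute)
  have "(w - a) * deriv G w = (w - a) ^ m * (of_nat m * u w + (w - a) * deriv u w)"
    if w: "w \<in> ball a d" "w \<noteq> a" for w
  proof -
    have du: "(u has_field_derivative deriv u w) (at w)"
      by (rule holomorphic_derivI[OF u open_ball w(1)])
    have "((\<lambda>w. (w - a) ^ m * u w) has_field_derivative
        (of_nat m * (w - a) ^ (m - 1) * u w + (w - a) ^ m * deriv u w)) (at w)"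
      using du by (auto intro!: derivative_eq_intros)
    then have "(G has_field_derivative (of_nat m * (w - a) ^ (m - 1) * u w + (w - a) ^ m * deriv u w)) (at w)"
      by (rule has_field_derivative_transform_within_open[OF _ open_ball w(1)]) (use G in simp)
    then have d: "deriv G w = of_nat m * (w - a) ^ (m - 1) * u w + (w - a) ^ m * deriv u w"
      by (rule DERIV_imp_deriv)
    have e: "of_nat m * ((w - a) * (w - a) ^ (m - 1)) = of_nat m * (w - a) ^ m"
      by (cases m) auto
    have "(w - a) * deriv G w = of_nat m * ((w - a) * (w - a) ^ (m - 1)) * u w + (w - a) ^ m * ((w - a) * deriv u w)"
      unfolding d by (simp only: distrib_left mult_ac)
    also have "\<dots> = (w - a) ^ m * (of_nat m * u w + (w - a) * deriv u w)"
      unfolding e by (simp only: distrib_left mult_ac)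
    finally show ?thesis .
  qed
  with d(1) u G show ?thesis unfolding m_def by (intro that[of d u]) auto
qed

text \<open>(w - a) times the Wronskian carries the full power (w - a)^(p + b), so a single order is
  lost. The loss is written as + 1 on the right, away from truncated subtraction.\<close>

lemma wronskian_mult:
  assumes F: "nz_entire F" and H: "nz_entire H" and W: "nz_entire (\<lambda>z. F z * deriv H z - deriv F z * H z)"
  shows "zero_mult F a + zero_mult H a \<le> zero_mult (\<lambda>z. F z * deriv H z - deriv F z * H z) a + 1"
proof -
  define p b where "p = zero_mult F a" and "b = zero_mult H a"
  obtain U d where U: "d > 0" "U holomorphic_on ball a d" "\<And>w. w \<in> ball a d \<Longrightarrow> F w = (w - a) ^ p * U w"
    "\<And>w. w \<in> ball a d \<Longrightarrow> w \<noteq> a \<Longrightarrow> (w - a) * deriv F w = (w - a) ^ p * (of_nat p * U w + (w - a) * deriv U w)"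
    unfolding p_def by (rule nz_entire_local_factor[OF F, of a]) (rule that[unfolded p_def])
  obtain V e where V: "e > 0" "V holomorphic_on ball a e" "\<And>w. w \<in> ball a e \<Longrightarrow> H w = (w - a) ^ b * V w"
    "\<And>w. w \<in> ball a e \<Longrightarrow> w \<noteq> a \<Longrightarrow> (w - a) * deriv H w = (w - a) ^ b * (of_nat b * V w + (w - a) * deriv V w)"
    unfolding b_def by (rule nz_entire_local_factor[OF H, of a]) (rule that[unfolded b_def])
  let ?X = "\<lambda>w. (of_nat b - of_nat p) * U w * V w + (w - a) * (U w * deriv V w - deriv U w * V w)"
  have X: "?X holomorphic_on ball a (min d e)"
    by (intro holomorphic_intros) (auto intro!: holomorphic_on_subset[OF U(2)] holomorphic_on_subset[OF V(2)]
        holomorphic_on_subset[OF holomorphic_deriv[OF U(2) open_ball]] holomorphic_on_subset[OF holomorphic_deriv[OF V(2) open_ball]])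
  have "p + b - 1 \<le> zero_mult (\<lambda>z. F z * deriv H z - deriv F z * H z) a"
  proof (cases "p + b = 0")
    case False
    show ?thesis
    proof (rule zero_mult_geI[OF W X])
      fix w assume w: "w \<in> ball a (min d e)" "w \<noteq> a"
      have "(w - a) * (F w * deriv H w - deriv F w * H w)
         = F w * ((w - a) * deriv H w) - ((w - a) * deriv F w) * H w" by (simp add: algebra_simps)
      also have "\<dots> = (w - a) ^ p * (w - a) ^ b * ?X w"
      proof -
        have wd: "w \<in> ball a d" "w \<in> ball a e" using w by auto
        show ?thesis unfolding U(3)[OF wd(1)] V(3)[OF wd(2)] U(4)[OF wd(1) w(2)] V(4)[OF wd(2) w(2)]
          by (simp add: algebra_simps)
      qed
      also have "(w - a) ^ p * (w - a) ^ b = (w - a) * (w - a) ^ (p + b - 1)"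
        using False by (simp add: power_add[symmetric] power_Suc[symmetric] del: power_Suc)
      finally show "F w * deriv H w - deriv F w * H w = (w - a) ^ (p + b - 1) * ?X w"
        using w(2) by simp
    qed (use U V in auto)
  qed simp
  then show ?thesis unfolding p_def b_def by linarith
qed

text \<open>Differentiation lowers the order of a zero by at most one; with the factor f^2 this
  gives F order at least 3 k - 1 at a zero of f of order k.\<close>

lemma mult_first_order_op:
  assumes f: "nz_entire f" and g: "nz_entire (\<lambda>z. f z + \<omega> * deriv f z)"
  shows "zero_mult f a \<le> zero_mult (\<lambda>z. f z + \<omega> * deriv f z) a + 1"
proof (cases "zero_mult f a = 0")
  case False
  define k where "k = zero_mult f a"
  obtain u d where u: "d > 0" "u holomorphic_on ball a d" "\<And>w. w \<in> ball a d \<Longrightarrow> f w = (w - a) ^ k * u w"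
    "\<And>w. w \<in> ball a d \<Longrightarrow> w \<noteq> a \<Longrightarrow> (w - a) * deriv f w = (w - a) ^ k * (of_nat k * u w + (w - a) * deriv u w)"
    unfolding k_def by (rule nz_entire_local_factor[OF f, of a]) (rule that[unfolded k_def])
  let ?X = "\<lambda>w. (w - a) * u w + \<omega> * (of_nat k * u w + (w - a) * deriv u w)"
  have X: "?X holomorphic_on ball a d"
    by (intro holomorphic_intros u holomorphic_deriv) auto
  have "k - 1 \<le> zero_mult (\<lambda>z. f z + \<omega> * deriv f z) a"
  proof (rule zero_mult_geI[OF g X])
    fix w assume w: "w \<in> ball a d" "w \<noteq> a"
    have "(w - a) * (f w + \<omega> * deriv f w) = (w - a) * f w + \<omega> * ((w - a) * deriv f w)" by (simp add: algebra_simps)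
    also have "\<dots> = (w - a) ^ k * ?X w"
      unfolding u(3)[OF w(1)] u(4)[OF w] by (simp add: algebra_simps)
    also have "(w - a) ^ k = (w - a) * (w - a) ^ (k - 1)" using False unfolding k_def by (cases k) (auto simp: k_def power_eq_if)
    finally show "f w + \<omega> * deriv f w = (w - a) ^ (k - 1) * ?X w" using w(2) by simp
  qed (use u in auto)
  then show ?thesis unfolding k_def by linarith
qed simp

section \<open>Comparison of the counting functions of f, H and W\<close>

lemma weighted_sum_mult_extend:
  assumes "nz_entire G" "finite U" "zeros G r \<subseteq> U"
  shows "counting_mult G r = (\<Sum>a\<in>U \<inter> ball 0 r. zero_mult G a * log_weight r a)"
proof (rule sum.mono_neutral_left)
  show "\<forall>a\<in>U \<inter> ball 0 r - zeros G r. zero_mult G a * log_weight r a = 0"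
  proof
    fix a assume "a \<in> U \<inter> ball 0 r - zeros G r"
    then have "G a \<noteq> 0" by simp
    then have "zero_mult G a = 0" using nz_entire_zorder(2)[OF assms(1), of a] by blast
    then show "zero_mult G a * log_weight r a = 0" by simp
  qed
qed (use assms in auto)

lemma weighted_sum_indicator:
  assumes "finite U" "zeros G r \<subseteq> U"
  shows "counting_distinct G r = (\<Sum>a\<in>U \<inter> ball 0 r. (if G a = 0 then log_weight r a else 0))"
  using assms by (intro sum.mono_neutral_cong_left) auto

text \<open>Jensen's formula reduces the claim to an inequality of multiplicities at each point: F
  has order at least 3 k - 1 at a zero of f, and the Wronskian loses one more. So at most two orders
  are lost where f vanishes, and at most one where only H does. All sums are taken over the union of
  the zero sets, where absent zeros have multiplicity 0.\<close>

lemma jensen_wronskian_le: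
  assumes f: "nz_entire f" and g: "nz_entire (\<lambda>z. f z + \<omega> * deriv f z)" and H: "nz_entire H"
    and F: "F = (\<lambda>z. f z ^ 2 * (f z + \<omega> * deriv f z))"
    and W: "nz_entire W" "W = (\<lambda>z. F z * deriv H z - deriv F z * H z)"
    and r: "1 \<le> r" and good: "\<And>w. norm w = r \<Longrightarrow> f w \<noteq> 0 \<and> H w \<noteq> 0 \<and> W w \<noteq> 0"
  shows "3 * mean_ln f r + mean_ln H r - mean_ln W r
    \<le> 3 * leading_ln f + leading_ln H - leading_ln W
       + 2 * counting_distinct f r + counting_distinct H r"
proof -
  have F': "nz_entire F" unfolding F by (intro nz_entire_mult nz_entire_power f g)
  have ineq: "3 * zero_mult f a + zero_mult H a
      \<le> zero_mult W a + 2 * (if f a = 0 then 1 else 0) + (if H a = 0 then 1 else 0)" for a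
  proof -
    have "zero_mult F a = 2 * zero_mult f a + zero_mult (\<lambda>z. f z + \<omega> * deriv f z) a"
      unfolding F power2_eq_square by (simp add: mult_times f g nz_entire_mult)
    then have "3 * zero_mult f a \<le> zero_mult F a + 1"
      using mult_first_order_op[OF f g, of a] by linarith
    moreover have "zero_mult F a + zero_mult H a \<le> zero_mult W a + 1"
      using wronskian_mult[OF F' H] W by simp
    ultimately show ?thesis
      using nz_entire_zorder(2)[OF f, of a] nz_entire_zorder(2)[OF H, of a] by (auto; linarith)
  qed
  define U where "U = zeros f r \<union> zeros H r \<union> zeros W r"
  define V where "V = U \<inter> ball 0 r"
  have fin: "finite U" unfolding U_def using finite_zeros f H W(1) by blast
  have "3 * (\<Sum>a\<in>V. zero_mult f a * log_weight r a) + (\<Sum>a\<in>V. zero_mult H a * log_weight r a)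
      = (\<Sum>a\<in>V. real (3 * zero_mult f a + zero_mult H a) * log_weight r a)"
    by (simp add: sum_distrib_left sum.distrib[symmetric] algebra_simps)
  also have "\<dots> \<le> (\<Sum>a\<in>V. real (zero_mult W a + 2 * (if f a = 0 then 1 else 0) + (if H a = 0 then 1 else 0)) * log_weight r a)"
    using r by (intro sum_mono mult_right_mono of_nat_mono ineq log_weight_nonneg) (auto simp: V_def)
  also have "\<dots> = (\<Sum>a\<in>V. zero_mult W a * log_weight r a) + 2 * (\<Sum>a\<in>V. if f a = 0 then log_weight r a else 0)
       + (\<Sum>a\<in>V. if H a = 0 then log_weight r a else 0)"
    unfolding sum_distrib_left sum.distrib[symmetric] by (intro sum.cong refl) (auto simp: algebra_simps)
  finally have *: "3 * (\<Sum>a\<in>V. zero_mult f a * log_weight r a) + (\<Sum>a\<in>V. zero_mult H a * log_weight r a)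
     \<le> (\<Sum>a\<in>V. zero_mult W a * log_weight r a) + 2 * (\<Sum>a\<in>V. if f a = 0 then log_weight r a else 0)
       + (\<Sum>a\<in>V. if H a = 0 then log_weight r a else 0)" .
  have sub: "zeros f r \<subseteq> U" "zeros H r \<subseteq> U" "zeros W r \<subseteq> U" unfolding U_def by auto
  have "3 * counting_mult f r + counting_mult H r
     \<le> counting_mult W r + 2 * counting_distinct f r + counting_distinct H r"
    using * unfolding V_def
    unfolding weighted_sum_mult_extend[OF f fin sub(1)] weighted_sum_mult_extend[OF H fin sub(2)]
      weighted_sum_mult_extend[OF W(1) fin sub(3)] weighted_sum_indicator[OF fin sub(1)] weighted_sum_indicator[OF fin sub(2)] .
  moreover have "mean_ln f r = leading_ln f + counting_mult f r"
    by (rule jensen_formula[OF f]) (use r good in auto)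
  moreover have "mean_ln H r = leading_ln H + counting_mult H r"
    by (rule jensen_formula[OF H]) (use r good in auto)
  moreover have "mean_ln W r = leading_ln W + counting_mult W r"
    by (rule jensen_formula[OF W(1)]) (use r good in auto)
  ultimately show ?thesis by (simp add: algebra_simps)
qed

text \<open>With \<open>E\<close> the product of the error factors, \<open>W = F P' - F' P = P H' - P' H\<close> gives
  \<open>|W| \<le> min(|f|\<^sup>3, |H|) E\<close>, whereas \<open>|P| \<le> max(|f|\<^sup>3, |H|) E\<close>.\<close>

lemma wronskian_pointwise:
  fixes f0 f1 f2 H0 H1 P0 P1 \<omega> :: complex
  assumes F0: "F0 = f0 ^ 3 + \<omega> * f0 ^ 2 * f1"
    and F1: "F1 = 3 * f0 ^ 2 * f1 + 2 * \<omega> * f0 * f1 ^ 2 + \<omega> * f0 ^ 2 * f2"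
    and P: "F0 + H0 = P0" "F1 + H1 = P1" and W: "W = F0 * H1 - F1 * H0"
    and nz: "f0 \<noteq> 0" "f1 \<noteq> 0" "H0 \<noteq> 0" "P0 \<noteq> 0" "W \<noteq> 0"
    and B: "1 \<le> B" "norm P0 \<le> B" "norm P1 \<le> B"
  shows "3 * log_plus (norm f0) \<le> 3 * ln (norm f0) + ln (norm H0) - ln (norm W) + log_plus (1 / norm P0)
    + 2 * (ln (6 * (1 + norm \<omega>)) + ln B + 3 * ln (1 + norm (f1 / f0)) + ln (1 + norm (f2 / f1)) + ln (1 + norm (H1 / H0)))"
proof -
  define x where "x = norm (f1 / f0)"
  define x' where "x' = norm (f2 / f1)"
  define h where "h = norm (H1 / H0)"
  define w where "w = norm \<omega>"
  define E where "E = 6 * (1 + w) * B * (1 + x) ^ 3 * (1 + x') * (1 + h)"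
  have x0: "0 \<le> x" "0 \<le> x'" "0 \<le> h" "0 \<le> w" unfolding x_def x'_def h_def w_def by auto
  have lnE: "ln E = ln (6 * (1 + w)) + ln B + 3 * ln (1 + x) + ln (1 + x') + ln (1 + h)"
    unfolding E_def using x0 B(1) by (simp add: ln_mult ln_realpow)
  have f1: "f1 = f0 * (f1 / f0)" and f2: "f2 = f0 * (f1 / f0) * (f2 / f1)" and H1: "H1 = H0 * (H1 / H0)"
    using nz by auto
  define M where "M = max (norm f0 ^ 3) (norm H0)"
  have big: "1 + w * x + 3 * x + 2 * w * x ^ 2 + w * x * x' \<le> 6 * (1 + w) * (1 + x) ^ 3 * (1 + x')"
  proof -
    define Y where "Y = (1 + x) ^ 3 * (1 + x')"
    have x3: "1 + x \<le> (1 + x) ^ 3" "(1 + x) ^ 2 \<le> (1 + x) ^ 3"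
      using x0 by (auto intro: self_le_power power_increasing)
    have up: "t * 1 \<le> Y" if "t \<le> (1 + x) ^ 3" "0 \<le> t" for t
      unfolding Y_def using that x0 by (intro mult_mono) auto
    have Y: "1 \<le> Y" "x \<le> Y" "x ^ 2 \<le> Y" "x * x' \<le> Y"
    proof -
      show "1 \<le> Y" using up[of 1] x0 by simp
      show "x \<le> Y" using up[of x] x3(1) x0 by simp
      have "x ^ 2 \<le> (1 + x) ^ 2" using x0 by (intro power_mono) auto
      then show "x ^ 2 \<le> Y" using up[of "x ^ 2"] x3(2) by simp
      show "x * x' \<le> Y" unfolding Y_def using x0 x3(1) by (intro mult_mono) auto
    qed
    have "1 + w * x + 3 * x + 2 * w * x ^ 2 + w * x * x' = 1 + 3 * x + w * (x + 2 * x ^ 2 + x * x')"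
      by (simp add: algebra_simps)
    also have "\<dots> \<le> 6 * Y + w * (6 * Y)"
      using Y x0 by (intro add_mono mult_left_mono) linarith+
    also have "\<dots> = 6 * (1 + w) * (1 + x) ^ 3 * (1 + x')" unfolding Y_def by (simp add: algebra_simps)
    finally show ?thesis .
  qed
  have one: "1 \<le> (1 + x) ^ 3" "1 \<le> 1 + x'" "1 \<le> 1 + h" using x0 by auto
  have W1: "norm W \<le> norm f0 ^ 3 * E"
  proof -
    \<comment> \<open>The relation F + H = P eliminates H from the Wronskian; f^3 can then be
      factored out, and only logarithmic derivatives remain.\<close>
    have "W = F0 * P1 - F1 * P0" unfolding W P[symmetric] by (simp add: algebra_simps)
    also have "\<dots> = f0 ^ 3 * ((1 + \<omega> * (f1 / f0)) * P1
        - (3 * (f1 / f0) + 2 * \<omega> * (f1 / f0) ^ 2 + \<omega> * (f1 / f0) * (f2 / f1)) * P0)"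
      unfolding F0 F1 using nz by (simp add: field_simps power2_eq_square power3_eq_cube)
    finally have "norm W = norm f0 ^ 3 * norm ((1 + \<omega> * (f1 / f0)) * P1
        - (3 * (f1 / f0) + 2 * \<omega> * (f1 / f0) ^ 2 + \<omega> * (f1 / f0) * (f2 / f1)) * P0)"
      by (simp only: norm_mult norm_power)
    also have "\<dots> \<le> norm f0 ^ 3 * ((1 + w * x) * B + (3 * x + 2 * w * x ^ 2 + w * x * x') * B)"
    proof (intro mult_left_mono)
      have a: "norm (1 + \<omega> * (f1 / f0)) \<le> 1 + w * x"
        using norm_triangle_ineq[of 1 "\<omega> * (f1 / f0)"] unfolding w_def x_def norm_mult by simp
      have b: "norm (3 * (f1 / f0) + 2 * \<omega> * (f1 / f0) ^ 2 + \<omega> * (f1 / f0) * (f2 / f1)) \<le> 3 * x + 2 * w * x ^ 2 + w * x * x'"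
      proof -
        have "norm (3 * X + 2 * \<omega> * X ^ 2 + \<omega> * X * Y) \<le> 3 * norm X + 2 * norm \<omega> * norm X ^ 2 + norm \<omega> * norm X * norm Y"
          for X Y :: complex
          by (intro order_trans[OF norm_triangle_ineq] add_mono) (simp_all add: norm_mult norm_power)
        then show ?thesis unfolding w_def x_def x'_def .
      qed
      show "norm ((1 + \<omega> * (f1 / f0)) * P1 - (3 * (f1 / f0) + 2 * \<omega> * (f1 / f0) ^ 2 + \<omega> * (f1 / f0) * (f2 / f1)) * P0)
          \<le> (1 + w * x) * B + (3 * x + 2 * w * x ^ 2 + w * x * x') * B"
        by (rule order_trans[OF norm_triangle_ineq4], unfold norm_mult, intro add_mono mult_mono a b B) (use x0 in auto)
    qed simp
    also have "\<dots> = norm f0 ^ 3 * ((1 + w * x + 3 * x + 2 * w * x ^ 2 + w * x * x') * B)" by (simp add: algebra_simps)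
    also have "\<dots> \<le> norm f0 ^ 3 * ((6 * (1 + w) * (1 + x) ^ 3 * (1 + x')) * B * (1 + h))"
    proof (intro mult_left_mono)
      have "(1 + w * x + 3 * x + 2 * w * x ^ 2 + w * x * x') * B * 1 \<le> (6 * (1 + w) * (1 + x) ^ 3 * (1 + x')) * B * (1 + h)"
        using x0 B(1) by (intro mult_mono big) auto
      then show "(1 + w * x + 3 * x + 2 * w * x ^ 2 + w * x * x') * B \<le> (6 * (1 + w) * (1 + x) ^ 3 * (1 + x')) * B * (1 + h)"
        by simp
    qed simp
    finally show ?thesis unfolding E_def by (simp add: mult_ac)
  qed
  have EB: "B * (1 + h) \<le> E"
  proof -
    have "1 * 1 * 1 * (B * (1 + h)) \<le> (6 * (1 + w)) * (1 + x) ^ 3 * (1 + x') * (B * (1 + h))"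
      using x0 one B(1) by (intro mult_mono) auto
    then show ?thesis unfolding E_def by (simp add: mult_ac)
  qed
  have W2: "norm W \<le> norm H0 * E"
  proof -
    \<comment> \<open>Eliminating F instead exposes the factor H.\<close>
    have "W = P0 * H1 - P1 * H0" unfolding W P[symmetric] by (simp add: algebra_simps)
    also have "\<dots> = H0 * (P0 * (H1 / H0) - P1)" using nz by (simp add: field_simps)
    finally have "norm W = norm H0 * norm (P0 * (H1 / H0) - P1)" by (simp only: norm_mult)
    also have "\<dots> \<le> norm H0 * (B * h + B)"
      by (intro mult_left_mono order_trans[OF norm_triangle_ineq4] add_mono B)
        (use x0 B in \<open>auto simp: norm_mult h_def simp del: times_divide_eq_right intro!: mult_right_mono\<close>)
    also have "\<dots> \<le> norm H0 * E" using EB by (intro mult_left_mono) (auto simp: algebra_simps)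
    finally show ?thesis .
  qed
  have E1: "1 \<le> E" using EB B(1) one mult_mono[of 1 B 1 "1 + h"] by linarith
  have M_ge: "norm f0 ^ 3 \<le> M" "norm H0 \<le> M" unfolding M_def by simp_all
  have M_nonneg: "0 \<le> M" unfolding M_def by (rule order_trans[OF norm_ge_zero max.cobounded2])
  have PM: "norm P0 \<le> M * E"
  proof -
    have "P0 = f0 ^ 3 * (1 + \<omega> * (f1 / f0)) + H0"
      unfolding P(1)[symmetric] F0 using nz by (simp add: field_simps power2_eq_square power3_eq_cube)
    then have "norm P0 \<le> norm f0 ^ 3 * norm (1 + \<omega> * (f1 / f0)) + norm H0"
      by (metis norm_mult norm_power norm_triangle_ineq)
    also have "\<dots> \<le> M * (1 + w * x) + M * 1"
    proof (intro add_mono mult_mono)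
      show "norm (1 + \<omega> * (f1 / f0)) \<le> 1 + w * x"
        using norm_triangle_ineq[of 1 "\<omega> * (f1 / f0)"] unfolding w_def x_def norm_mult by simp
    qed (use M_ge M_nonneg in auto)
    also have "\<dots> = M * (2 + w * x)" by (simp add: algebra_simps)
    also have "\<dots> \<le> M * E"
    proof (intro mult_left_mono)
      have "2 + w * x \<le> 6 * (1 + w) * (1 + x) ^ 3 * (1 + x')"
      proof -
        have "2 + w * x = 2 + 1 * (w * x)" by simp
        also have "\<dots> \<le> 6 * (1 + w) + 6 * (1 + w) * x"
        proof (rule add_mono)
          have "1 * (w * x) \<le> 6 * ((1 + w) * x)" using x0 by (intro mult_mono mult_right_mono) auto
          then show "1 * (w * x) \<le> 6 * (1 + w) * x" by (simp only: mult.assoc)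
        qed (use x0 in simp)
        finally have "2 + w * x \<le> 6 * (1 + w) * (1 + x)" by (simp add: distrib_left)
        moreover have "6 * (1 + w) * (1 + x) * 1 \<le> 6 * (1 + w) * (1 + x) ^ 3 * (1 + x')"
          using x0 by (intro mult_mono self_le_power) auto
        ultimately show ?thesis by simp
      qed
      also have "\<dots> = (6 * (1 + w) * (1 + x) ^ 3 * (1 + x')) * (1 * 1)" by simp
      also have "\<dots> \<le> (6 * (1 + w) * (1 + x) ^ 3 * (1 + x')) * (B * (1 + h))"
        using x0 B(1) by (intro mult_left_mono mult_mono) auto
      finally show "2 + w * x \<le> E" unfolding E_def by (simp add: mult_ac)
    qed (rule M_nonneg)
    finally show ?thesis .
  qed
  have M0: "0 < M" unfolding M_def using nz by (simp add: less_max_iff_disj)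
  \<comment> \<open>The larger of the two quantities |f|^3 and |H| times the smaller is their
    product, so the better of the two bounds for W is used in each case.\<close>
  have MW: "M * norm W \<le> norm f0 ^ 3 * norm H0 * E"
  proof (cases "norm f0 ^ 3 \<le> norm H0")
    case True
    then have "M * norm W = norm H0 * norm W" unfolding M_def by simp
    also have "\<dots> \<le> norm H0 * (norm f0 ^ 3 * E)" using W1 by (intro mult_left_mono) auto
    finally show ?thesis by (simp add: mult_ac)
  next
    case False
    then have "M * norm W = norm f0 ^ 3 * norm W" unfolding M_def by simp
    also have "\<dots> \<le> norm f0 ^ 3 * (norm H0 * E)" using W2 by (intro mult_left_mono) auto
    finally show ?thesis by (simp add: mult_ac)
  qed
  have "ln (M * norm W) \<le> ln (norm f0 ^ 3 * norm H0 * E)" using MW M0 nz by (intro ln_mono) auto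
  then have lnMW: "ln M + ln (norm W) \<le> 3 * ln (norm f0) + ln (norm H0) + ln E"
    using M0 nz E1 by (simp add: ln_mult ln_realpow)
  \<comment> \<open>Where |f| < 1 the left-hand side is 0 but ln M may be negative. There |P| \<le>
    M E bounds ln M from below, at the price of log+ (1 / |P|) and a second ln E.\<close>
  have "3 * log_plus (norm f0) \<le> ln M + log_plus (1 / norm P0) + ln E"
  proof (cases "1 \<le> norm f0")
    case True
    then have "3 * log_plus (norm f0) = ln (norm f0 ^ 3)" unfolding log_plus_def by (simp add: max_def ln_realpow)
    also have "\<dots> \<le> ln M" unfolding M_def using nz by (intro ln_mono) auto
    finally show ?thesis using E1 log_plus_nonneg[of "1 / norm P0"] ln_ge_zero[OF E1] by linarith
  next
    case False
    then have "log_plus (norm f0) = 0" unfolding log_plus_def by simp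
    moreover have "ln (norm P0) \<le> ln M + ln E"
      using PM M0 E1 nz ln_mono[of "norm P0" "M * E"] by (simp add: ln_mult)
    moreover have "- ln (norm P0) \<le> log_plus (1 / norm P0)"
      using ln_le_log_plus[of "1 / norm P0"] nz by (simp add: ln_div)
    ultimately show ?thesis by linarith
  qed
  then have "3 * log_plus (norm f0) \<le> 3 * ln (norm f0) + ln (norm H0) - ln (norm W) + log_plus (1 / norm P0) + 2 * ln E"
    using lnMW by linarith
  then show ?thesis unfolding lnE x_def x'_def h_def w_def .
qed

section \<open>The bound by distinct zeros\<close>

lemma holomorphic_entire_deriv: "f holomorphic_on UNIV \<Longrightarrow> deriv f holomorphic_on A"
  by (rule holomorphic_on_subset[OF holomorphic_deriv[OF _ open_UNIV]]) auto

text \<open>F / P has zero derivative near a point where P does not vanish; the identity theorem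
  spreads the resulting relation to the plane.\<close>

lemma zero_wronskian_proportional:
  assumes P: "nz_entire P" and F: "F holomorphic_on UNIV"
    and W: "\<And>z. F z * deriv P z - deriv F z * P z = 0"
  shows "\<exists>k. \<forall>z. F z = k * P z"
proof -
  obtain z0 where z0: "P z0 \<noteq> 0" using P unfolding nz_entire_def by auto
  have "continuous (at z0) P" using nz_entire_cont[OF P, of UNIV] by (simp add: continuous_on_eq_continuous_at)
  then obtain e where e: "e > 0" "\<And>w. w \<in> ball z0 e \<Longrightarrow> P w \<noteq> 0"
    using continuous_at_avoid[where f = P and x = z0 and a = 0] z0 by (auto simp: dist_norm norm_minus_commute ball_def)
  have "((\<lambda>z. F z / P z) has_field_derivative 0) (at z within ball z0 e)" if "z \<in> ball z0 e" for z
  proof -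
    have dF: "(F has_field_derivative deriv F z) (at z)" by (rule holomorphic_derivI[OF F open_UNIV UNIV_I])
    have dP: "(P has_field_derivative deriv P z) (at z)"
      by (rule holomorphic_derivI[OF nz_entire_holo[OF P] open_UNIV UNIV_I])
    have "((\<lambda>z. F z / P z) has_field_derivative (deriv F z * P z - F z * deriv P z) / (P z * P z)) (at z)"
      by (rule DERIV_divide[OF dF dP e(2)[OF that]])
    moreover have "deriv F z * P z - F z * deriv P z = 0" using W[of z] by simp
    ultimately show ?thesis by (simp add: has_field_derivative_at_within)
  qed
  then have "\<exists>k. \<forall>z\<in>ball z0 e. F z / P z = k"
    by (rule has_field_derivative_zero_constant[OF convex_ball])
  then obtain k where k: "\<And>z. z \<in> ball z0 e \<Longrightarrow> F z / P z = k" by blast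
  have "F z = k * P z" for z
  proof (rule ccontr)
    assume "F z \<noteq> k * P z"
    then have "nz_entire (\<lambda>z. F z - k * P z)"
      unfolding nz_entire_def using F nz_entire_holo[OF P] by (auto intro!: holomorphic_intros exI[of _ z])
    from nz_entire_eventually[OF this, of z0]
    have "eventually (\<lambda>w. F w - k * P w \<noteq> 0) (at z0)" .
    moreover have "eventually (\<lambda>w. w \<in> ball z0 e) (at z0)" using e(1) by (intro eventually_at_in_open') auto
    ultimately have "eventually (\<lambda>w. False) (at z0)"
    proof eventually_elim
      case (elim w)
      then show ?case using k[of w] e(2)[of w] by (auto simp: field_simps)
    qed
    then show False by simp
  qed
  then show ?thesis by blast
qed

lemma norm_le_exp_linear:
  assumes "growth_le 1 P"
  obtains D where "0 \<le> D" "\<And>z. norm (P z) \<le> exp (D * (1 + norm z))"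
proof -
  obtain C where C: "0 \<le> C" "\<And>z. norm (P z) \<le> exp (C * (1 + norm z) powr 1)"
    using growth_leE[OF assms] by blast
  then show ?thesis by (intro that[of C]) auto
qed

text \<open>The argument depends on the shifted term and the right-hand side only through F + H = P,
  finite growth of H and growth at most one of P. That f' and f + \<omega> f' are not identically
  zero is needed to divide by f' in a logarithmic derivative and to speak of multiplicities of
  F.\<close>

locale tumura_clunie =
  fixes f H P F :: "complex \<Rightarrow> complex" and \<omega> :: complex and K :: real
  assumes f: "nz_entire f" "growth_le K f" and f': "nz_entire (deriv f)"
    and g: "nz_entire (\<lambda>z. f z + \<omega> * deriv f z)"
    and H: "nz_entire H" "growth_le K H" and P: "nz_entire P" "growth_le 1 P" and K: "1 \<le> K"
    and F_def: "F = (\<lambda>z. f z ^ 2 * (f z + \<omega> * deriv f z))"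
    and eq: "\<And>z. F z + H z = P z"
begin

definition W where "W = (\<lambda>z. F z * deriv H z - deriv F z * H z)"

lemma derivs:
  shows "(f has_field_derivative deriv f z) (at z)" "(deriv f has_field_derivative deriv (deriv f) z) (at z)"
    "(H has_field_derivative deriv H z) (at z)" "(P has_field_derivative deriv P z) (at z)"
  using f f' H P by (auto intro!: holomorphic_derivI[OF _ open_UNIV UNIV_I] nz_entire_holo)

lemma deriv_F: "deriv F z = 3 * f z ^ 2 * deriv f z + 2 * \<omega> * f z * deriv f z ^ 2 + \<omega> * f z ^ 2 * deriv (deriv f) z"
  unfolding F_def
  by (rule DERIV_imp_deriv) (auto intro!: derivative_eq_intros derivs simp: algebra_simps power2_eq_square)

lemma F: "nz_entire F" "growth_le K F"
proof -
  have K0: "0 \<le> K" using K by simp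
  show "nz_entire F" unfolding F_def by (intro nz_entire_mult nz_entire_power f g)
  show "growth_le K F" unfolding F_def
    by (intro growth_le_mult growth_le_power growth_le_add growth_le_cmult growth_le_deriv f K0)
qed

lemma deriv_P: "deriv F z + deriv H z = deriv P z"
proof -
  have "(F has_field_derivative deriv F z) (at z)"
    using F by (intro holomorphic_derivI[OF _ open_UNIV UNIV_I] nz_entire_holo)
  then have "((\<lambda>z. F z + H z) has_field_derivative deriv F z + deriv H z) (at z)"
    by (intro derivative_intros derivs)
  then show ?thesis unfolding eq using DERIV_imp_deriv by metis
qed

lemma W_holo: "W holomorphic_on UNIV"
  unfolding W_def using F H nz_entire_holo
  by (intro holomorphic_intros holomorphic_entire_deriv) auto

lemma W_growth: "growth_le K W"
  unfolding W_def using K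
  by (intro growth_le_diff growth_le_mult growth_le_deriv F H) auto

text \<open>The pointwise estimate is averaged over the circle: Jensen's formula turns the three
  pure logarithms into counting functions, and P contributes O(r). The logarithmic derivatives of f,
  f' and H enter with coefficients 6, 2 and 2, whose sum is the 10 in front of ln (1 /
  \<eta>).\<close>

lemma bound_nonzero_wronskian:
  assumes W: "nz_entire W"
  shows "\<exists>C\<ge>0. on_separated_circles (\<lambda>w. f w * deriv f w * H w * P w * W w) (\<lambda>r \<eta>.
     3 * proximity f r \<le> 2 * counting_distinct f r + counting_distinct H r
        + C * (1 + r) + 10 * ln (1 / \<eta>))"
proof -
  have K0: "0 \<le> K" using K by simp
  obtain C1 where C1: "0 \<le> C1" "on_separated_circles f (\<lambda>r \<eta>.
     circle_mean r (\<lambda>z. ln (1 + norm (deriv f z / f z))) \<le> C1 * (1 + r) + ln (1 / \<eta>))"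
    using log_deriv_mean[OF f K0] by blast
  obtain C2 where C2: "0 \<le> C2" "on_separated_circles (deriv f) (\<lambda>r \<eta>.
     circle_mean r (\<lambda>z. ln (1 + norm (deriv (deriv f) z / deriv f z))) \<le> C2 * (1 + r) + ln (1 / \<eta>))"
    using log_deriv_mean[OF f' growth_le_deriv[OF f(2) K0] K0] by blast
  obtain C3 where C3: "0 \<le> C3" "on_separated_circles H (\<lambda>r \<eta>.
     circle_mean r (\<lambda>z. ln (1 + norm (deriv H z / H z))) \<le> C3 * (1 + r) + ln (1 / \<eta>))"
    using log_deriv_mean[OF H K0] by blast
  obtain D where D: "0 \<le> D" "\<And>z. norm (P z) \<le> exp (D * (1 + norm z))"
    using norm_le_exp_linear[OF P(2)] by blast
  have P'g: "growth_le 1 (deriv P)" by (rule growth_le_deriv[OF P(2)]) simp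
  obtain D' where D': "0 \<le> D'" "\<And>z. norm (deriv P z) \<le> exp (D' * (1 + norm z))"
    using norm_le_exp_linear[OF P'g] by blast
  define c where "c = \<bar>3 * leading_ln f + leading_ln H - leading_ln W - leading_ln P\<bar> + 2 * \<bar>ln (6 * (1 + norm \<omega>))\<bar>"
  define C where "C = c + D + 2 * (D + D') + 6 * C1 + 2 * C2 + 2 * C3"
  have "3 * proximity f r \<le> 2 * counting_distinct f r + counting_distinct H r
        + C * (1 + r) + 10 * ln (1 / \<eta>)"
    if r: "1 \<le> r" and eta: "0 < \<eta>" "\<eta> \<le> 1"
      and sep: "\<forall>w. f w * deriv f w * H w * P w * W w = 0 \<longrightarrow> \<eta> \<le> \<bar>norm w - r\<bar>" for r \<eta>
  proof -
    have r0: "0 \<le> r" using r by simp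
    have good: "f w \<noteq> 0 \<and> deriv f w \<noteq> 0 \<and> H w \<noteq> 0 \<and> P w \<noteq> 0 \<and> W w \<noteq> 0" if "norm w = r" for w
      using sep[rule_format, of w] that eta by auto
    define L1 where "L1 = (\<lambda>z. ln (1 + norm (deriv f z / f z)))"
    define L2 where "L2 = (\<lambda>z. ln (1 + norm (deriv (deriv f) z / deriv f z)))"
    define L3 where "L3 = (\<lambda>z. ln (1 + norm (deriv H z / H z)))"
    have cl: "continuous_on (sphere 0 r) (\<lambda>z. ln (1 + norm (deriv G z / G z)))"
      if "nz_entire G" "\<And>w. norm w = r \<Longrightarrow> G w \<noteq> 0" for G
    proof -
      have "continuous_on (sphere 0 r) (deriv G)"
        using that(1) by (intro holomorphic_on_imp_continuous_on holomorphic_entire_deriv nz_entire_holo)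
      moreover have "continuous_on (sphere 0 r) G" by (rule nz_entire_cont[OF that(1)])
      ultimately show ?thesis using that(2)
        by (intro continuous_intros) (auto simp: add_pos_nonneg less_imp_neq[symmetric])
    qed
    have cL: "continuous_on (sphere 0 r) L1" "continuous_on (sphere 0 r) L2" "continuous_on (sphere 0 r) L3"
      unfolding L1_def L2_def L3_def using good by (auto intro!: cl f f' H)
    have clnf: "continuous_on (sphere 0 r) (\<lambda>z. ln (norm (f z)))"
      and clnH: "continuous_on (sphere 0 r) (\<lambda>z. ln (norm (H z)))"
      and clnW: "continuous_on (sphere 0 r) (\<lambda>z. ln (norm (W z)))"
      using good by (auto intro!: continuous_on_ln_norm f H W)
    have clP: "continuous_on (sphere 0 r) (\<lambda>z. log_plus (1 / norm (P z)))"
      using good by (intro continuous_intros nz_entire_cont P) auto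
    have clf: "continuous_on (sphere 0 r) (\<lambda>z. log_plus (norm (f z)))"
      by (intro continuous_on_log_plus continuous_on_norm nz_entire_cont f)
    let ?k = "2 * (ln (6 * (1 + norm \<omega>)) + (D + D') * (1 + r))"
    let ?R = "\<lambda>z. (3 * ln (norm (f z)) + ln (norm (H z)) - ln (norm (W z))) + log_plus (1 / norm (P z))
       + (?k + (6 * L1 z + 2 * L2 z + 2 * L3 z))"
    have "circle_mean r (\<lambda>z. 3 * log_plus (norm (f z))) \<le> circle_mean r ?R"
    proof (rule circle_mean_mono[OF r0])
      fix z :: complex assume z: "norm z = r"
      let ?B = "exp ((D + D') * (1 + r))"
      have "3 * log_plus (norm (f z)) \<le> 3 * ln (norm (f z)) + ln (norm (H z)) - ln (norm (W z)) + log_plus (1 / norm (P z))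
        + 2 * (ln (6 * (1 + norm \<omega>)) + ln ?B + 3 * L1 z + L2 z + L3 z)"
        unfolding L1_def L2_def L3_def
      proof (rule wronskian_pointwise)
        show "F z = f z ^ 3 + \<omega> * f z ^ 2 * deriv f z" unfolding F_def by (simp add: algebra_simps power2_eq_square power3_eq_cube)
        show "norm (P z) \<le> ?B" "norm (deriv P z) \<le> ?B"
          using D(2)[of z] D'(2)[of z] z D(1) D'(1) r
          by (auto elim!: le_exp_trans intro!: mult_right_mono)
      qed (use eq deriv_P deriv_F good[OF z] D(1) D'(1) r in \<open>auto simp: W_def\<close>)
      then show "3 * log_plus (norm (f z)) \<le> ?R z" by (simp add: algebra_simps)
    qed (intro continuous_intros clnf clnH clnW clP clf cL)+
    also have "circle_mean r ?R = (3 * mean_ln f r + mean_ln H r - mean_ln W r)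
       + circle_mean r (\<lambda>z. log_plus (1 / norm (P z))) + (?k + (6 * circle_mean r L1 + 2 * circle_mean r L2 + 2 * circle_mean r L3))"
      by (simp only: circle_mean_add[OF r0] circle_mean_diff[OF r0] circle_mean_cmult circle_mean_const
          continuous_on_add continuous_on_diff continuous_on_mult continuous_on_const clnf clnH clnW clP cL)
    also have "\<dots> \<le> (3 * leading_ln f + leading_ln H - leading_ln W
         + 2 * counting_distinct f r + counting_distinct H r)
       + (D * (1 + r) - leading_ln P) + (?k + (6 * (C1 * (1 + r) + ln (1 / \<eta>)) + 2 * (C2 * (1 + r) + ln (1 / \<eta>)) + 2 * (C3 * (1 + r) + ln (1 / \<eta>))))"
    proof (intro add_mono mult_left_mono order_refl)
      show "3 * mean_ln f r + mean_ln H r - mean_ln W r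
        \<le> 3 * leading_ln f + leading_ln H - leading_ln W
         + 2 * counting_distinct f r + counting_distinct H r"
        by (rule jensen_wronskian_le[OF f(1) g H(1) F_def W W_def r]) (use good in auto)
      have "circle_mean r (\<lambda>z. log_plus (1 / norm (P z))) \<le> proximity P r - leading_ln P"
        by (rule proximity_inverse_le[OF P(1) r]) (use good in auto)
      also have "proximity P r \<le> D * (1 + r)"
      proof (rule circle_mean_le_const[OF r0])
        show "continuous_on (sphere 0 r) (\<lambda>z. log_plus (norm (P z)))"
          by (intro continuous_on_log_plus continuous_on_norm nz_entire_cont P)
        fix z :: complex assume "norm z = r"
        then show "log_plus (norm (P z)) \<le> D * (1 + r)" using D(1) D(2)[of z] r by (intro log_plus_le) auto
      qed
      finally show "circle_mean r (\<lambda>z. log_plus (1 / norm (P z))) \<le> D * (1 + r) - leading_ln P" by simp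
      show "circle_mean r L1 \<le> C1 * (1 + r) + ln (1 / \<eta>)" unfolding L1_def by (rule C1(2)[rule_format, OF r eta]) (use sep in auto)
      show "circle_mean r L2 \<le> C2 * (1 + r) + ln (1 / \<eta>)" unfolding L2_def by (rule C2(2)[rule_format, OF r eta]) (use sep in auto)
      show "circle_mean r L3 \<le> C3 * (1 + r) + ln (1 / \<eta>)" unfolding L3_def by (rule C3(2)[rule_format, OF r eta]) (use sep in auto)
    qed (use D(1) D'(1) r in auto)
    also have "\<dots> \<le> 2 * counting_distinct f r + counting_distinct H r
        + (c + D * (1 + r) + 2 * (D + D') * (1 + r) + 6 * C1 * (1 + r) + 2 * C2 * (1 + r) + 2 * C3 * (1 + r)) + 10 * ln (1 / \<eta>)"
      unfolding c_def by (simp add: algebra_simps)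
    also have "c + D * (1 + r) + 2 * (D + D') * (1 + r) + 6 * C1 * (1 + r) + 2 * C2 * (1 + r) + 2 * C3 * (1 + r) \<le> C * (1 + r)"
    proof -
      have "c * 1 \<le> c * (1 + r)" unfolding c_def using r by (intro mult_left_mono) auto
      then show ?thesis unfolding C_def by (simp add: algebra_simps)
    qed
    finally show ?thesis unfolding circle_mean_cmult by simp
  qed
  moreover have "0 \<le> C" unfolding C_def c_def using C1 C2 C3 D D' by simp
  ultimately show ?thesis by blast
qed

text \<open>Here F = f^2 g, with g = f + \<omega> f', is a multiple of P. Writing |f|^3 = |F| |f /
  g| and log+ |f / g| = ln |f| - ln |g| + log+ |g / f| leaves ln |f|, which is at most half of log+
  |F| - ln |g|. Hence the factors 3/2; the mean of ln |g| is bounded below by Jensen's formula, and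
  g / f = 1 + \<omega> f' / f. The 10 only matches the other case.\<close>

lemma bound_zero_wronskian:
  assumes W: "\<And>z. W z = 0"
  shows "\<exists>C\<ge>0. on_separated_circles (\<lambda>w. f w * (f w + \<omega> * deriv f w) * H w * P w) (\<lambda>r \<eta>.
     3 * proximity f r \<le> C * (1 + r) + 10 * ln (1 / \<eta>))"
proof -
  have K0: "0 \<le> K" using K by simp
  define g where "g = (\<lambda>z. f z + \<omega> * deriv f z)"
  have gnz: "nz_entire g" unfolding g_def by (rule g)
  have "F z * deriv P z - deriv F z * P z = 0" for z
    using W[of z] unfolding W_def eq[symmetric] deriv_P[symmetric] by (simp add: algebra_simps)
  then obtain k where k: "\<And>z. F z = k * P z"
    using zero_wronskian_proportional[OF P(1) nz_entire_holo[OF F(1)]] by blast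
  have "F = (\<lambda>z. k * P z)" using k by (rule ext)
  then have Fg: "growth_le 1 F" using growth_le_cmult[OF _ P(2), of k] by simp
  obtain C1 where C1: "0 \<le> C1" "on_separated_circles f (\<lambda>r \<eta>.
     circle_mean r (\<lambda>z. ln (1 + norm (deriv f z / f z))) \<le> C1 * (1 + r) + ln (1 / \<eta>))"
    using log_deriv_mean[OF f K0] by blast
  obtain D where D: "0 \<le> D" "\<And>z. norm (F z) \<le> exp (D * (1 + norm z))"
    using norm_le_exp_linear[OF Fg] by blast
  define c where "c = \<bar>3/2 * leading_ln g\<bar> + ln (1 + norm \<omega>)"
  define C where "C = 3/2 * D + c + C1"
  have "3 * proximity f r \<le> C * (1 + r) + 10 * ln (1 / \<eta>)"
    if r: "1 \<le> r" and eta: "0 < \<eta>" "\<eta> \<le> 1"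
      and sep: "\<forall>w. f w * (f w + \<omega> * deriv f w) * H w * P w = 0 \<longrightarrow> \<eta> \<le> \<bar>norm w - r\<bar>" for r \<eta>
  proof -
    have r0: "0 \<le> r" using r by simp
    have good: "f w \<noteq> 0 \<and> g w \<noteq> 0" if "norm w = r" for w
      using sep[rule_format, of w] that eta unfolding g_def by auto
    define L1 where "L1 = (\<lambda>z. ln (1 + norm (deriv f z / f z)))"
    have cL: "continuous_on (sphere 0 r) L1"
    proof -
      have "continuous_on (sphere 0 r) (deriv f)" "continuous_on (sphere 0 r) f"
        by (intro nz_entire_cont f f')+
      then show ?thesis unfolding L1_def using good
        by (intro continuous_intros) (auto simp: add_pos_nonneg less_imp_neq[symmetric])
    qed
    have clng: "continuous_on (sphere 0 r) (\<lambda>z. ln (norm (g z)))"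
      using good by (auto intro!: continuous_on_ln_norm gnz)
    have clf: "continuous_on (sphere 0 r) (\<lambda>z. log_plus (norm (f z)))"
      by (intro continuous_on_log_plus continuous_on_norm nz_entire_cont f)
    let ?k = "3/2 * (D * (1 + r)) + ln (1 + norm \<omega>)"
    have "circle_mean r (\<lambda>z. 3 * log_plus (norm (f z))) \<le> circle_mean r (\<lambda>z. ?k + L1 z - 3/2 * ln (norm (g z)))"
    proof (rule circle_mean_mono[OF r0])
      fix z :: complex assume z: "norm z = r"
      have fz: "f z \<noteq> 0" "g z \<noteq> 0" using good[OF z] by auto
      have Fz: "F z = f z ^ 2 * g z" unfolding F_def g_def ..
      have "norm (F z) \<le> exp (D * (1 + r))" using D(2)[of z] z by simp
      then have lF: "log_plus (norm (F z)) \<le> D * (1 + r)" using D(1) r by (intro log_plus_le) auto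
      have lnF: "ln (norm (F z)) = 2 * ln (norm (f z)) + ln (norm (g z))"
        unfolding Fz using fz by (simp add: norm_mult norm_power ln_mult ln_realpow)
      have "3 * log_plus (norm (f z)) = log_plus (norm (f z) ^ 3)"
        using fz by (simp add: log_plus_eq_max ln_realpow max_def)
      also have "norm (f z) ^ 3 = norm (F z) * (norm (f z) / norm (g z))"
        unfolding Fz using fz by (simp add: norm_mult norm_power power2_eq_square power3_eq_cube)
      also have "log_plus \<dots> \<le> log_plus (norm (F z)) + log_plus (norm (f z) / norm (g z))"
        by (rule log_plus_mult_le) auto
      also have "log_plus (norm (f z) / norm (g z)) = ln (norm (f z)) - ln (norm (g z)) + log_plus (norm (g z) / norm (f z))"
        using fz by (simp add: log_plus_eq_max ln_div max_def)
      also have "log_plus (norm (g z) / norm (f z)) \<le> ln (1 + norm \<omega>) + L1 z"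
      proof -
        have "norm (g z) / norm (f z) = norm (1 + \<omega> * (deriv f z / f z))"
          unfolding g_def norm_divide[symmetric] using fz by (simp add: field_simps)
        also have "\<dots> \<le> 1 + norm \<omega> * norm (deriv f z / f z)"
          using norm_triangle_ineq[of 1 "\<omega> * (deriv f z / f z)"] unfolding norm_mult by simp
        also have "\<dots> \<le> (1 + norm \<omega>) * (1 + norm (deriv f z / f z))" by (simp add: algebra_simps)
        finally have *: "norm (g z) / norm (f z) \<le> (1 + norm \<omega>) * (1 + norm (deriv f z / f z))" .
        have "exp (ln (1 + norm \<omega>) + L1 z) = (1 + norm \<omega>) * (1 + norm (deriv f z / f z))"
          unfolding L1_def exp_add by (simp add: exp_ln add_pos_nonneg)
        then show ?thesis using * by (intro log_plus_le) (auto simp: L1_def)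
      qed
      finally have "3 * log_plus (norm (f z))
          \<le> log_plus (norm (F z)) + (ln (norm (f z)) - ln (norm (g z)) + (ln (1 + norm \<omega>) + L1 z))" by simp
      moreover have "2 * ln (norm (f z)) + ln (norm (g z)) \<le> log_plus (norm (F z))"
        unfolding lnF[symmetric] by (rule ln_le_log_plus) simp
      ultimately show "3 * log_plus (norm (f z)) \<le> ?k + L1 z - 3/2 * ln (norm (g z))"
        using lF by linarith
    qed (intro continuous_intros clng clf cL)+
    also have "\<dots> = ?k + circle_mean r L1 - 3/2 * mean_ln g r"
      by (simp only: circle_mean_add[OF r0] circle_mean_diff[OF r0] circle_mean_cmult circle_mean_const
          continuous_on_add continuous_on_mult continuous_on_const clng cL)
    also have "\<dots> \<le> ?k + (C1 * (1 + r) + ln (1 / \<eta>)) - 3/2 * leading_ln g"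
    proof (intro add_mono diff_mono mult_left_mono order_refl)
      show "circle_mean r L1 \<le> C1 * (1 + r) + ln (1 / \<eta>)" unfolding L1_def by (rule C1(2)[rule_format, OF r eta]) (use sep in auto)
      show "leading_ln g \<le> mean_ln g r"
        by (rule jensen_ge[OF gnz r]) (use good in auto)
    qed (use D(1) r in auto)
    also have "\<dots> \<le> (3/2 * (D * (1 + r)) + c + C1 * (1 + r)) + 10 * ln (1 / \<eta>)"
    proof -
      have "0 \<le> ln (1 / \<eta>)" using eta by simp
      then show ?thesis unfolding c_def by linarith
    qed
    also have "3/2 * (D * (1 + r)) + c + C1 * (1 + r) \<le> C * (1 + r)"
    proof -
      have "c * 1 \<le> c * (1 + r)" unfolding c_def using r by (intro mult_left_mono) auto
      then show ?thesis unfolding C_def by (simp add: algebra_simps)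
    qed
    finally show ?thesis unfolding circle_mean_cmult by simp
  qed
  moreover have "0 \<le> C" unfolding C_def c_def using C1 D by simp
  ultimately show ?thesis by blast
qed

theorem truncated_second_main_bound:
  "\<exists>C\<ge>0. \<forall>r\<ge>1. \<exists>s. r < s \<and> s < r + 1 \<and> (\<forall>w. norm w = s \<longrightarrow> f w \<noteq> 0 \<and> H w \<noteq> 0) \<and>
     3 * proximity f s \<le> 2 * counting_distinct f s + counting_distinct H s + C * (1 + s)"
proof -
  have K0: "0 \<le> K" using K by simp
  have PK: "growth_le K P" by (rule growth_le_mono[OF P(2) K])
  \<comment> \<open>The two cases keep away from the zeros of different products. Each product
    vanishes wherever f or H does, which is what later steps need from it.\<close>
  have "\<exists>G C. nz_entire G \<and> growth_le K G \<and> 0 \<le> C \<and> (\<forall>w. f w = 0 \<or> H w = 0 \<longrightarrow> G w = 0) \<and>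
    (on_separated_circles G (\<lambda>r \<eta>.
     3 * proximity f r \<le> 2 * counting_distinct f r + counting_distinct H r
        + C * (1 + r) + 10 * ln (1 / \<eta>)))"
  proof (cases "nz_entire W")
    case True
    obtain C where C: "0 \<le> C" "on_separated_circles (\<lambda>w. f w * deriv f w * H w * P w * W w) (\<lambda>r \<eta>.
     3 * proximity f r \<le> 2 * counting_distinct f r + counting_distinct H r
        + C * (1 + r) + 10 * ln (1 / \<eta>))"
      using bound_nonzero_wronskian[OF True] by blast
    show ?thesis
    proof (intro exI[of _ "\<lambda>w. f w * deriv f w * H w * P w * W w"] exI[of _ C] conjI)
      show "nz_entire (\<lambda>w. f w * deriv f w * H w * P w * W w)"
        by (intro nz_entire_mult f f' H P True)
      show "growth_le K (\<lambda>w. f w * deriv f w * H w * P w * W w)"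
        by (intro growth_le_mult growth_le_deriv f H PK W_growth K0)
    qed (use C in \<open>simp_all\<close>)
  next
    case False
    then have "\<And>z. W z = 0" using W_holo unfolding nz_entire_def by blast
    from bound_zero_wronskian[OF this]
    obtain C where C: "0 \<le> C" "\<And>r \<eta>. 1 \<le> r \<Longrightarrow> 0 < \<eta> \<Longrightarrow> \<eta> \<le> 1 \<Longrightarrow>
     (\<forall>w. f w * (f w + \<omega> * deriv f w) * H w * P w = 0 \<longrightarrow> \<eta> \<le> \<bar>norm w - r\<bar>) \<Longrightarrow>
     3 * proximity f r \<le> C * (1 + r) + 10 * ln (1 / \<eta>)"
      by blast
    have pos: "0 \<le> 2 * counting_distinct f r + counting_distinct H r" if "1 \<le> r" for r
      using that by (intro add_nonneg_nonneg mult_nonneg_nonneg sum_nonneg log_weight_nonneg) auto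
    show ?thesis
    proof (intro exI[of _ "\<lambda>w. f w * (f w + \<omega> * deriv f w) * H w * P w"] exI[of _ C] conjI allI impI)
      show "nz_entire (\<lambda>w. f w * (f w + \<omega> * deriv f w) * H w * P w)"
        by (intro nz_entire_mult f g H P)
      show "growth_le K (\<lambda>w. f w * (f w + \<omega> * deriv f w) * H w * P w)"
        by (intro growth_le_mult growth_le_add growth_le_cmult growth_le_deriv f H PK K0)
      fix r \<eta> :: real assume *: "1 \<le> r" "0 < \<eta>" "\<eta> \<le> 1"
        "\<forall>w. f w * (f w + \<omega> * deriv f w) * H w * P w = 0 \<longrightarrow> \<eta> \<le> \<bar>norm w - r\<bar>"
      show "3 * proximity f r \<le> 2 * counting_distinct f r + counting_distinct H r
        + C * (1 + r) + 10 * ln (1 / \<eta>)"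
        using C(2)[OF *] pos[OF *(1)] by linarith
    qed (use C(1) in auto)
  qed
  then obtain G C where G: "nz_entire G" "growth_le K G" "\<forall>w. f w = 0 \<or> H w = 0 \<longrightarrow> G w = 0" and C: "0 \<le> C"
    and bound: "on_separated_circles G (\<lambda>r \<eta>.
     3 * proximity f r \<le> 2 * counting_distinct f r + counting_distinct H r
        + C * (1 + r) + 10 * ln (1 / \<eta>))"
    by (elim exE conjE) (rule that)
  obtain E where E: "0 \<le> E" "\<forall>r\<ge>1. \<exists>s \<eta>. r < s \<and> s < r + 1 \<and> 0 < \<eta> \<and> \<eta> \<le> 1 \<and>
     ln (1 / \<eta>) \<le> E * (1 + r) \<and> (\<forall>w. G w = 0 \<longrightarrow> \<eta> \<le> \<bar>norm w - s\<bar>)"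
    using separated_radius[OF G(1,2) K0] by blast
  show ?thesis
  proof (rule exI[of _ "C + 10 * E"], intro conjI allI impI)
    fix r :: real assume r: "1 \<le> r"
    obtain s \<eta> where s: "r < s" "s < r + 1" "0 < \<eta>" "\<eta> \<le> 1" "ln (1 / \<eta>) \<le> E * (1 + r)"
      "\<forall>w. G w = 0 \<longrightarrow> \<eta> \<le> \<bar>norm w - s\<bar>"
      using E(2)[rule_format, OF r] by blast
    have "1 \<le> s" using r s by simp
    have "3 * proximity f s \<le> 2 * counting_distinct f s + counting_distinct H s
        + C * (1 + s) + 10 * ln (1 / \<eta>)"
      using bound[rule_format, OF \<open>1 \<le> s\<close> s(3,4)] s(6) by blast
    moreover have "ln (1 / \<eta>) \<le> E * (1 + s)"
      using s(1,5) E(1) mult_left_mono[of "1 + r" "1 + s" E] by linarith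
    ultimately have b: "3 * proximity f s \<le> 2 * counting_distinct f s + counting_distinct H s
        + (C + 10 * E) * (1 + s)" by (simp add: algebra_simps)
    have "f w \<noteq> 0 \<and> H w \<noteq> 0" if "norm w = s" for w
      using G(3)[rule_format, of w] s(3) s(6)[rule_format, of w] that by auto
    with s(1,2) b show "\<exists>s. r < s \<and> s < r + 1 \<and> (\<forall>w. norm w = s \<longrightarrow> f w \<noteq> 0 \<and> H w \<noteq> 0) \<and>
       3 * proximity f s \<le> 2 * counting_distinct f s + counting_distinct H s
         + (C + 10 * E) * (1 + s)"
      by (intro exI[of _ s]) blast
  qed (use C E in auto)
qed

end

section \<open>The order of a solution\<close>

text \<open>A zero a \<noteq> 0 raises n(t) by one from t = |a| on and so contributes the integral
  of 1/t over [|a|, r], which is its \<open>log_weight\<close>; zeros at the origin enter only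
  through n(0) ln r. At t = 0 the numerator of the integrand is 0.\<close>

lemma integrated_count_eq:
  assumes Z: "finite Z" "\<And>a. a \<in> Z \<Longrightarrow> norm a < r" and r: "0 < r"
    and n: "\<And>t. 0 \<le> t \<Longrightarrow> t \<le> r \<Longrightarrow> n t = card {a\<in>Z. norm a \<le> t}"
  shows "integrated_count n r = (\<Sum>a\<in>Z. log_weight r a)"
proof -
  have ind: "real (n t) = (\<Sum>a\<in>Z. if norm a \<le> t then 1 else 0)" if "0 \<le> t" "t \<le> r" for t
    using n[OF that] Z(1) by (simp add: sum.If_cases Int_def)
  have each: "((\<lambda>t. if a \<noteq> 0 \<and> norm a \<le> t then 1 / t else 0) has_integral (if a \<noteq> 0 then log_weight r a else 0)) {0..r}"
    if a: "a \<in> Z" for a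
  proof (cases "a = 0")
    case False
    have na: "0 < norm a" "norm a < r" using False Z(2)[OF a] by auto
    have "((\<lambda>t. 1 / t) has_integral (ln r - ln (norm a))) {norm a..r}"
    proof (rule fundamental_theorem_of_calculus)
      fix t assume "t \<in> {norm a..r}"
      then have "norm a \<le> t" by simp
      with na(1) have "0 < t" by (rule less_le_trans)
      then have "(ln has_real_derivative 1 / t) (at t within {norm a..r})"
        by (auto intro!: derivative_eq_intros)
      then show "(ln has_vector_derivative 1 / t) (at t within {norm a..r})"
        by (simp add: has_real_derivative_iff_has_vector_derivative)
    qed (use na in auto)
    then have "((\<lambda>t. if t \<in> {norm a..r} then 1 / t else 0) has_integral (ln r - ln (norm a))) {0..r}"
      using na by (subst has_integral_restrict) auto
    then have "((\<lambda>t. if a \<noteq> 0 \<and> norm a \<le> t then 1 / t else 0) has_integral (ln r - ln (norm a))) {0..r}"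
      by (rule has_integral_eq[rotated]) (use False in auto)
    then show ?thesis using False na r by (simp add: log_weight_def ln_div)
  qed simp
  have "((\<lambda>t. \<Sum>a\<in>Z. if a \<noteq> 0 \<and> norm a \<le> t then 1 / t else 0) has_integral
      (\<Sum>a\<in>Z. if a \<noteq> 0 then log_weight r a else 0)) {0..r}"
    by (intro has_integral_sum Z each)
  then have "((\<lambda>t. (real (n t) - real (n 0)) / t) has_integral
      (\<Sum>a\<in>Z. if a \<noteq> 0 then log_weight r a else 0)) {0..r}"
  proof (rule has_integral_eq[rotated])
    fix t assume t: "t \<in> {0..r}"
    have "real (n t) - real (n 0) = (\<Sum>a\<in>Z. if a \<noteq> 0 \<and> norm a \<le> t then 1 else 0)"
      using ind[of t] ind[of 0] t r unfolding sum_subtractf[symmetric]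
      by (auto simp: sum_subtractf[symmetric] intro!: sum.cong)
    then show "(\<Sum>a\<in>Z. if a \<noteq> 0 \<and> norm a \<le> t then 1 / t else 0) = (real (n t) - real (n 0)) / t"
      by (simp add: sum_divide_distrib if_distrib[of "\<lambda>x. x / t"] cong: if_cong)
  qed
  then have i: "integral {0..r} (\<lambda>t. (real (n t) - real (n 0)) / t) = (\<Sum>a\<in>Z. if a \<noteq> 0 then log_weight r a else 0)"
    by (rule integral_unique)
  have "real (n 0) * ln r = (\<Sum>a\<in>Z. if a = 0 then log_weight r a else 0)"
    using ind[of 0] r unfolding sum_distrib_right
    by (auto simp: sum_distrib_right log_weight_def intro!: sum.cong)
  then show ?thesis unfolding integrated_count_def i
    by (simp add: sum.distrib[symmetric] if_distrib cong: if_cong) (auto intro!: sum.cong)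
qed

lemma simple_zero_counting_eq:
  assumes f: "nz_entire f" and r: "0 < r" and good: "\<And>w. norm w = r \<Longrightarrow> f w \<noteq> 0"
  shows "simple_zero_counting r f = (\<Sum>a | a \<in> zeros f r \<and> zorder f a = 1. log_weight r a)"
  unfolding simple_zero_counting_def
proof (rule integrated_count_eq[OF _ _ r])
  show "finite {a. a \<in> zeros f r \<and> zorder f a = 1}"
    by (rule finite_subset[OF _ finite_zeros[OF f, of r]]) auto
  fix t assume "0 \<le> t" "t \<le> r"
  \<comment> \<open>At t = r the closed disc contains no more zeros than the open one, since the
    circle avoids them.\<close>
  then have "{z. norm z \<le> t \<and> f z = 0 \<and> zorder f z = 1} = {a \<in> {a. a \<in> zeros f r \<and> zorder f a = 1}. norm a \<le> t}"
    using good by (auto simp: less_le)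
  then show "simple_zero_count f t = card {a \<in> {a. a \<in> zeros f r \<and> zorder f a = 1}. norm a \<le> t}"
    unfolding simple_zero_count_def by simp
qed auto

text \<open>A simple zero is counted once on the right as simple and once by multiplicity; any other
  zero has multiplicity at least two. Jensen's formula bounds the count with multiplicity by the
  proximity.\<close>

lemma distinct_zeros_le_simple_zeros:
  assumes f: "nz_entire f" and r: "1 \<le> r" and good: "\<And>w. norm w = r \<Longrightarrow> f w \<noteq> 0"
  shows "2 * counting_distinct f r \<le> simple_zero_counting r f + proximity f r - leading_ln f"
proof -
  note fin = finite_zeros[OF f, of r]
  have "2 * counting_distinct f r
      \<le> (\<Sum>a\<in>zeros f r. (if zorder f a = 1 then log_weight r a else 0) + zero_mult f a * log_weight r a)"
    unfolding sum_distrib_left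
  proof (rule sum_mono)
    fix a assume a: "a \<in> zeros f r"
    then have w: "0 \<le> log_weight r a" using r by (intro log_weight_nonneg) auto
    have m: "0 < zero_mult f a" using nz_entire_zorder(2)[OF f, of a] a by blast
    show "2 * log_weight r a \<le> (if zorder f a = 1 then log_weight r a else 0) + zero_mult f a * log_weight r a"
    proof (cases "zorder f a = 1")
      case False
      then have "2 \<le> real (zero_mult f a)" using m by linarith
      then show ?thesis using False w by (simp add: mult_right_mono)
    qed simp
  qed
  also have "\<dots> = (\<Sum>a | a \<in> zeros f r \<and> zorder f a = 1. log_weight r a) + counting_mult f r"
    unfolding sum.distrib using sum.inter_filter[OF fin, of "log_weight r" "\<lambda>a. zorder f a = 1"] by simp
  also have "(\<Sum>a | a \<in> zeros f r \<and> zorder f a = 1. log_weight r a) = simple_zero_counting r f"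
    using simple_zero_counting_eq[OF f _ good] r by simp
  also have "counting_mult f r = mean_ln f r - leading_ln f"
    using jensen_formula[OF f _ good] r by simp
  also have "mean_ln f r \<le> proximity f r"
    by (rule circle_mean_ln_le_proximity[OF f _ good]) (use r in auto)
  finally show ?thesis by simp
qed

lemma distinct_zeros_le_proximity:
  assumes f: "nz_entire f" and r: "1 \<le> r" and good: "\<And>w. norm w = r \<Longrightarrow> f w \<noteq> 0"
  shows "counting_distinct f r \<le> proximity f r - leading_ln f"
proof -
  have "counting_distinct f r \<le> counting_mult f r"
  proof (rule sum_mono)
    fix a assume a: "a \<in> zeros f r"
    then have w: "0 \<le> log_weight r a" using r by (intro log_weight_nonneg) auto
    have "0 < zero_mult f a" using nz_entire_zorder(2)[OF f, of a] a by blast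
    then have "1 * log_weight r a \<le> real (zero_mult f a) * log_weight r a"
      using w by (intro mult_right_mono) auto
    then show "log_weight r a \<le> real (zero_mult f a) * log_weight r a" by simp
  qed
  also have "\<dots> = mean_ln f r - leading_ln f"
    using jensen_formula[OF f _ good] r by simp
  also have "mean_ln f r \<le> proximity f r"
    by (rule circle_mean_ln_le_proximity[OF f _ good]) (use r in auto)
  finally show ?thesis by simp
qed

text \<open>Otherwise the values along \<open>r, r + L, r + 2 L, \<dots>\<close> would grow exponentially.\<close>

lemma exists_slow_growth_radius:
  fixes T :: "real \<Rightarrow> real"
  assumes up: "eventually (\<lambda>r. T r \<le> r powr K) at_top" and low: "frequently (\<lambda>r. r powr s \<le> T r) at_top"
    and s: "0 \<le> s" and \<delta>: "0 < \<delta>" and L: "0 < L"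
  obtains r where "r0 \<le> r" "r powr s \<le> T r" "T (r + L) \<le> (1 + \<delta>) * T r"
proof (rule ccontr)
  assume neg: "\<not> thesis"
  note found = that
  have jump: "(1 + \<delta>) * T r < T (r + L)" if "r0 \<le> r" "r powr s \<le> T r" for r
    using that found[of r] neg by force
  obtain r1 where r1: "\<And>r. r1 \<le> r \<Longrightarrow> T r \<le> r powr K"
    using up unfolding eventually_at_top_linorder by blast
  \<comment> \<open>From some point on, r^s grows by less than the factor 1 + \<delta> in a step of
    length L. So the lower bound r^s \<le> T(r) passes to r + L, and the jump can be
    repeated.\<close>
  have "((\<lambda>r::real. (r + L) powr s / r powr s) \<longlongrightarrow> 1) at_top" by real_asymp
  then have "eventually (\<lambda>r::real. (r + L) powr s / r powr s < 1 + \<delta>) at_top"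
    using \<delta> by (intro order_tendstoD(2)) auto
  then obtain r2 where r2: "\<And>r. r2 \<le> r \<Longrightarrow> (r + L) powr s / r powr s < 1 + \<delta>"
    unfolding eventually_at_top_linorder by blast
  define b where "b = max (max r0 1) (max r1 r2)"
  obtain x where x: "b \<le> x" "x powr s \<le> T x"
    using frequently_ex[OF frequently_eventually_frequently[OF low eventually_ge_at_top[of b]]] by blast
  have xs: "r0 \<le> x" "1 \<le> x" "r1 \<le> x" "r2 \<le> x" using x(1) unfolding b_def by auto
  have iter: "(1 + \<delta>) ^ n \<le> T (x + real n * L) \<and> (x + real n * L) powr s \<le> T (x + real n * L)" for n
  proof (induction n)
    case 0
    have "1 \<le> x powr s" using xs(2) s by (rule ge_one_powr_ge_zero)
    then show ?case using x(2) by simp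
  next
    case (Suc n)
    define y where "y = x + real n * L"
    have y: "x \<le> y" unfolding y_def using L by simp
    have Suc_y: "x + real (Suc n) * L = y + L" unfolding y_def by (simp add: algebra_simps)
    have "(1 + \<delta>) * T y < T (y + L)" using jump[of y] Suc y xs unfolding y_def by auto
    moreover have "(1 + \<delta>) ^ Suc n \<le> (1 + \<delta>) * T y"
      using Suc \<delta> unfolding y_def by (simp add: mult_left_mono)
    moreover have "(y + L) powr s \<le> (1 + \<delta>) * T y"
    proof -
      have "(y + L) powr s / y powr s < 1 + \<delta>" using y xs by (intro r2) auto
      moreover have "0 < y powr s" using y xs by simp
      ultimately have "(y + L) powr s \<le> (1 + \<delta>) * y powr s" by (simp add: field_simps)
      also have "\<dots> \<le> (1 + \<delta>) * T y" using Suc \<delta> unfolding y_def by (intro mult_left_mono) auto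
      finally show ?thesis .
    qed
    ultimately show ?case unfolding Suc_y by linarith
  qed
  have "(1 + \<delta>) ^ n \<le> (x + real n * L) powr K" for n
  proof -
    have "x \<le> x + real n * L" using L by simp
    then have "T (x + real n * L) \<le> (x + real n * L) powr K" using xs by (intro r1) auto
    then show ?thesis using iter[of n] by linarith
  qed
  then have le1: "1 \<le> (x + real n * L) powr K / (1 + \<delta>) ^ n" for n
    using \<delta> by (simp add: field_simps)
  \<comment> \<open>The assumed upper bound is polynomial in n, while the iterated jumps force the
    growth (1 + \<delta>)^n.\<close>
  have "((\<lambda>n. (x + real n * L) powr K / (1 + \<delta>) ^ n) \<longlongrightarrow> 0) sequentially"
    using \<delta> L by real_asymp
  then have "eventually (\<lambda>n. (x + real n * L) powr K / (1 + \<delta>) ^ n < 1) sequentially"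
    by (rule order_tendstoD(2)) simp
  then obtain n where "(x + real n * L) powr K / (1 + \<delta>) ^ n < 1"
    unfolding eventually_sequentially by blast
  then show False using le1[of n] by simp
qed

section \<open>Exclusion of degenerate cases\<close>

lemma frequently_powr_le_proximity_contra:
  assumes "growth_le 1 f" "1 < s" "frequently (\<lambda>r. r powr s \<le> proximity f r) at_top"
  shows False
proof -
  obtain C where C: "0 \<le> C" "\<And>r. 0 \<le> r \<Longrightarrow> proximity f r \<le> C * (1 + r) powr 1"
    using proximity_le_growth[OF assms(1)] by blast
  have "((\<lambda>r::real. (1 + r) / r powr s) \<longlongrightarrow> 0) at_top" using assms(2) by real_asymp
  then have "((\<lambda>r::real. C * ((1 + r) / r powr s)) \<longlongrightarrow> C * 0) at_top" by (intro tendsto_intros)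
  then have "eventually (\<lambda>r::real. C * ((1 + r) / r powr s) < 1) at_top"
    by (rule order_tendstoD(2)) simp
  then have "eventually (\<lambda>r. \<not> r powr s \<le> proximity f r) at_top"
    using eventually_gt_at_top[of 0]
  proof eventually_elim
    case (elim r)
    then have "C * (1 + r) < r powr s" by (simp add: field_simps)
    then show ?case using C(2)[of r] elim by simp
  qed
  then show False using assms(3) unfolding frequently_def by blast
qed

lemma first_order_ode:
  assumes f: "f holomorphic_on UNIV" and \<omega>: "\<omega> \<noteq> 0" and ode: "\<And>z. f z + \<omega> * deriv f z = 0"
  shows "\<exists>k. \<forall>z. f z * exp (z / \<omega>) = k"
proof -
  have "((\<lambda>z. f z * exp (z / \<omega>)) has_field_derivative 0) (at z)" for z
  proof -
    have df: "(f has_field_derivative deriv f z) (at z)" by (rule holomorphic_derivI[OF f open_UNIV UNIV_I])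
    have "((\<lambda>z. f z * exp (z / \<omega>)) has_field_derivative (deriv f z * exp (z / \<omega>) + exp (z / \<omega>) * (1 / \<omega>) * f z)) (at z)"
      using \<omega> by (auto intro!: derivative_eq_intros df)
    moreover have "deriv f z * exp (z / \<omega>) + exp (z / \<omega>) * (1 / \<omega>) * f z = exp (z / \<omega>) * (f z + \<omega> * deriv f z) / \<omega>"
      using \<omega> by (simp add: field_simps)
    ultimately show ?thesis using ode[of z] by simp
  qed
  then have "\<exists>k. \<forall>z\<in>UNIV. f z * exp (z / \<omega>) = k"
    by (intro has_field_derivative_zero_constant[OF convex_UNIV]) simp
  then show ?thesis by simp
qed

text \<open>If the sum vanished, its value and its derivative at 0 would give two linear equations
  that force \<open>p\<^sub>1 * (l\<^sub>1 - l\<^sub>2) = 0\<close>. The remaining case, equal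
  exponents with opposite coefficients, is ruled out by assumption; Jensen's formula is later
  applied to this sum.\<close>

lemma exponential_sum_nonzero:
  assumes "p\<^sub>1 \<noteq> 0" "l\<^sub>1 \<noteq> l\<^sub>2 \<or> p\<^sub>1 + p\<^sub>2 \<noteq> (0::complex)"
  shows "nz_entire (\<lambda>z. p\<^sub>1 * exp (l\<^sub>1 * z) + p\<^sub>2 * exp (l\<^sub>2 * z))"
proof (rule ccontr)
  let ?P = "\<lambda>z. p\<^sub>1 * exp (l\<^sub>1 * z) + p\<^sub>2 * exp (l\<^sub>2 * z)"
  assume "\<not> nz_entire ?P"
  then have z: "?P z = 0" for z unfolding nz_entire_def by (auto intro!: holomorphic_intros)
  have "(?P has_field_derivative (p\<^sub>1 * l\<^sub>1 + p\<^sub>2 * l\<^sub>2)) (at 0)"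
    by (auto intro!: derivative_eq_intros)
  then have "((\<lambda>z. 0) has_field_derivative (p\<^sub>1 * l\<^sub>1 + p\<^sub>2 * l\<^sub>2)) (at (0::complex))" unfolding z .
  from DERIV_unique[OF this DERIV_const] have "p\<^sub>1 * l\<^sub>1 + p\<^sub>2 * l\<^sub>2 = 0" .
  moreover have s: "p\<^sub>1 + p\<^sub>2 = 0" using z[of 0] by simp
  moreover have "p\<^sub>1 * (l\<^sub>1 - l\<^sub>2) = (p\<^sub>1 * l\<^sub>1 + p\<^sub>2 * l\<^sub>2) - (p\<^sub>1 + p\<^sub>2) * l\<^sub>2" by (simp add: algebra_simps)
  ultimately have "p\<^sub>1 * (l\<^sub>1 - l\<^sub>2) = 0" by (simp only:) simp
  then show False using assms s by auto
qed

section \<open>The order in terms of proximity, and exclusion of orders other than one\<close>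

lemma growth_order_less_imp:
  assumes "f holomorphic_on UNIV" "growth_order f < ereal s"
  shows "eventually (\<lambda>r. proximity f r \<le> r powr s) at_top"
proof -
  have "eventually (\<lambda>r. ereal (log_plus (nevanlinna_char r f) / ln r) < ereal s) at_top"
    using assms(2) unfolding growth_order_def by (rule Limsup_lessD)
  then show ?thesis using eventually_gt_at_top[of 1]
  proof eventually_elim
    case (elim r)
    then have "log_plus (proximity f r) < s * ln r"
      unfolding nevanlinna_char_entire[OF assms(1)] by (simp add: field_simps)
    then have "proximity f r \<le> exp (s * ln r)"
      by (intro le_exp_trans[OF le_exp_log_plus]) simp
    then show ?case using elim by (simp add: powr_def)
  qed
qed

lemma growth_order_greater_imp:
  assumes "f holomorphic_on UNIV" "ereal s < growth_order f" "0 \<le> s"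
  shows "frequently (\<lambda>r. r powr s \<le> proximity f r) at_top"
proof (rule ccontr)
  assume "\<not> ?thesis"
  then have "eventually (\<lambda>r. proximity f r < r powr s) at_top"
    unfolding frequently_def by (simp add: not_le)
  then have "eventually (\<lambda>r. ereal (log_plus (nevanlinna_char r f) / ln r) \<le> ereal s) at_top"
    using eventually_gt_at_top[of 1]
  proof eventually_elim
    case (elim r)
    have "log_plus (proximity f r) \<le> s * ln r"
      using elim assms(3) by (intro log_plus_le) (auto simp: powr_def)
    then show ?case unfolding nevanlinna_char_entire[OF assms(1)] using elim by (simp add: field_simps)
  qed
  then have "growth_order f \<le> ereal s" unfolding growth_order_def by (rule Limsup_bounded)
  then show False using assms(2) by simp
qed

lemma no_small_order_solution:
  assumes f: "nz_entire f" "growth_le s f" and s: "0 < s" "s < 1"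
    and nz: "\<omega> \<noteq> 0" "a \<noteq> 0" "l\<^sub>1 \<noteq> 0" "l\<^sub>2 \<noteq> 0"
    and eq: "\<And>z. f z ^ 3 + \<omega> * f z ^ 2 * deriv f z + poly q z * exp (b + a * z) * f (z + c)
              = p\<^sub>1 * exp (l\<^sub>1 * z) + p\<^sub>2 * exp (l\<^sub>2 * z)"
  shows False
proof -
  have s0: "0 \<le> s" using s by simp
  define F where "F = (\<lambda>z. f z ^ 3 + \<omega> * f z ^ 2 * deriv f z)"
  define G where "G = (\<lambda>z. poly q z * exp b * f (c + z))"
  have Fg: "growth_le s F" unfolding F_def
    by (intro growth_le_add growth_le_mult growth_le_power growth_le_const growth_le_deriv f s0)
  have Gg: "growth_le s G" unfolding G_def using s
    by (intro growth_le_mult growth_le_const growth_le_poly growth_le_shift f) auto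
  \<comment> \<open>The exponents a, \<open>l\<^sub>1\<close> and \<open>l\<^sub>2\<close> may
    coincide; adding up indicator terms collects their coefficients in every case. None of them is
    0, so the coefficient at exponent 0 is exactly F.\<close>
  define A where "A = (\<lambda>\<beta> z. (if \<beta> = 0 then F z else 0) + (if \<beta> = a then G z else 0)
     - (if \<beta> = l\<^sub>1 then p\<^sub>1 else 0) - (if \<beta> = l\<^sub>2 then p\<^sub>2 else 0))"
  have ifg: "growth_le s (\<lambda>z. if B then X z else 0)" if "growth_le s X" for B X
    using that growth_le_const[OF s0, of 0] by (cases B) auto
  have Ag: "growth_le s (A \<beta>)" for \<beta>
    unfolding A_def by (intro growth_le_add growth_le_diff ifg Fg Gg growth_le_const s0)
  let ?B = "{0, a, l\<^sub>1, l\<^sub>2}"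
  have sum_if: "(\<Sum>\<beta>\<in>?B. (if \<beta> = x then X else 0) * exp (\<beta> * z)) = X * exp (x * z)"
    if "x \<in> ?B" for x X z
  proof -
    have "(\<Sum>\<beta>\<in>?B. (if \<beta> = x then X else 0) * exp (\<beta> * z)) = (\<Sum>\<beta>\<in>?B. if \<beta> = x then X * exp (\<beta> * z) else 0)"
      by (intro sum.cong) auto
    also have "\<dots> = X * exp (x * z)" by (subst sum.delta) (use that in auto)
    finally show ?thesis .
  qed
  have total: "(\<Sum>\<beta>\<in>?B. A \<beta> z * exp (\<beta> * z)) = 0" for z
  proof -
    have "(\<Sum>\<beta>\<in>?B. A \<beta> z * exp (\<beta> * z)) = F z * exp (0 * z) + G z * exp (a * z) - p\<^sub>1 * exp (l\<^sub>1 * z) - p\<^sub>2 * exp (l\<^sub>2 * z)"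
      unfolding A_def left_diff_distrib distrib_right sum.distrib sum_subtractf
      by (subst (1 2 3 4) sum_if) simp_all
    also have "\<dots> = 0" using eq[of z] unfolding F_def G_def by (simp add: exp_add algebra_simps)
    finally show ?thesis .
  qed
  have "A 0 z = 0" for z
    by (rule borel_exponential_independence[OF _ s0 s(2) Ag total]) auto
  then have F0: "F z = 0" for z unfolding A_def using nz(2-4) by simp
  have ode: "f z + \<omega> * deriv f z = 0" for z
  proof (rule ccontr)
    assume "f z + \<omega> * deriv f z \<noteq> 0"
    then have "nz_entire (\<lambda>z. f z + \<omega> * deriv f z)"
      unfolding nz_entire_def using nz_entire_holo[OF f(1)]
      by (auto intro!: holomorphic_intros holomorphic_entire_deriv exI[of _ z])
    then have "nz_entire (\<lambda>z. f z ^ 2 * (f z + \<omega> * deriv f z))" by (intro nz_entire_mult nz_entire_power f)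
    then obtain w where "f w ^ 2 * (f w + \<omega> * deriv f w) \<noteq> 0" unfolding nz_entire_def by blast
    then show False using F0[of w] unfolding F_def by (simp add: algebra_simps power2_eq_square power3_eq_cube)
  qed
  obtain k where k: "\<And>z. f z * exp (z / \<omega>) = k"
    using first_order_ode[OF nz_entire_holo[OF f(1)] nz(1) ode] by blast
  \<comment> \<open>The identity f(z) exp(z / \<omega>) - k = 0 is again an exponential sum, with
    the distinct exponents 0 and 1 / \<omega> and coefficients of order below one.\<close>
  define A' where "A' = (\<lambda>\<beta> :: complex. if \<beta> = 0 then (\<lambda>z. - k) else f)"
  have A'g: "growth_le s (A' \<beta>)" for \<beta>
    unfolding A'_def using f(2) growth_le_const[OF s0, of "- k"] by auto
  have total': "(\<Sum>\<beta>\<in>{0, 1 / \<omega>}. A' \<beta> z * exp (\<beta> * z)) = 0" for z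
    unfolding A'_def using nz(1) k[of z] by simp
  have "A' (1 / \<omega>) z = 0" for z
    by (rule borel_exponential_independence[OF _ s0 s(2) A'g total']) auto
  then have "f z = 0" for z unfolding A'_def using nz(1) by simp
  then show False using f(1) unfolding nz_entire_def by blast
qed

lemma no_large_order_solution:
  assumes f: "nz_entire f" "growth_le K f" and K: "1 \<le> K" and \<omega>: "\<omega> \<noteq> 0"
    and up: "eventually (\<lambda>r. proximity f r \<le> r powr K) at_top"
    and s: "1 < s" and low: "frequently (\<lambda>r. r powr s \<le> proximity f r) at_top"
    and q: "q \<noteq> 0" and Q: "real (degree Q) \<le> K"
    and P: "nz_entire P" "growth_le 1 P"
    and eq: "\<And>z. f z ^ 3 + \<omega> * f z ^ 2 * deriv f z + poly q z * exp (poly Q z) * f (z + c) = P z"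
    and \<kappa>: "0 \<le> \<kappa>" "\<kappa> < 1" and \<epsilon>: "\<epsilon> \<in> o[at_top](\<lambda>_. 1 :: real)"
    and simple: "eventually (\<lambda>r. simple_zero_counting r f < (\<kappa> + \<epsilon> r) * proximity f r) at_top"
  shows False
proof -
  have K0: "0 \<le> K" using K by simp
  have fh: "f holomorphic_on UNIV" by (rule nz_entire_holo[OF f(1)])
  have f'h: "deriv f holomorphic_on UNIV" by (rule holomorphic_entire_deriv[OF fh])
  \<comment> \<open>A constant f would grow too slowly for the lower bound r^s with s > 1.\<close>
  have f': "nz_entire (deriv f)"
  proof (rule ccontr)
    assume "\<not> nz_entire (deriv f)"
    then have "deriv f z = 0" for z using f'h unfolding nz_entire_def by blast
    then have "(f has_field_derivative 0) (at z)" for z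
      using holomorphic_derivI[OF fh open_UNIV UNIV_I, of z] by simp
    then have "\<exists>k. \<forall>z\<in>UNIV. f z = k"
      by (intro has_field_derivative_zero_constant[OF convex_UNIV]) simp
    then obtain k where "f = (\<lambda>z. k)" by auto
    then have "growth_le 1 f" using growth_le_const[of 1 k] by simp
    then show False using frequently_powr_le_proximity_contra[OF _ s low] by blast
  qed
  \<comment> \<open>Otherwise f is a multiple of exp(-z / \<omega>), again too slow for the lower
    bound.\<close>
  have g: "nz_entire (\<lambda>z. f z + \<omega> * deriv f z)"
  proof (rule ccontr)
    assume "\<not> nz_entire (\<lambda>z. f z + \<omega> * deriv f z)"
    then have ode: "f z + \<omega> * deriv f z = 0" for z
      using fh f'h unfolding nz_entire_def by (auto intro!: holomorphic_intros)
    obtain k where k: "\<And>z. f z * exp (z / \<omega>) = k"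
      using first_order_ode[OF fh \<omega> ode] by blast
    have "f = (\<lambda>z. k * exp (- (1 / \<omega>) * z))"
    proof
      fix z
      show "f z = k * exp (- (1 / \<omega>) * z)" unfolding k[of z, symmetric] by (simp add: mult.assoc mult_exp_exp)
    qed
    then have "growth_le 1 f" using growth_le_cmult[OF _ growth_le_exp_linear[of 1 "- (1 / \<omega>)"], of k] by simp
    then show False using frequently_powr_le_proximity_contra[OF _ s low] by blast
  qed
  define fc where "fc = (\<lambda>z. f (c + z))"
  have fcg: "growth_le K fc" unfolding fc_def by (rule growth_le_shift[OF f(2) K0])
  have fc: "nz_entire fc" unfolding fc_def by (rule nz_entire_shift[OF f(1)])
  have qg: "growth_le 1 (poly q)" by (rule growth_le_poly) simp
  have qnz: "nz_entire (poly q)" by (rule nz_entire_poly[OF q])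
  define h where "h = (\<lambda>z. poly q z * fc z)"
  have h: "nz_entire h" unfolding h_def by (intro nz_entire_mult qnz fc)
  define H where "H = (\<lambda>z. poly q z * exp (poly Q z) * fc z)"
  have H: "nz_entire H" "growth_le K H"
    unfolding H_def
    by (intro nz_entire_mult qnz nz_entire_exp_poly fc,
        intro growth_le_mult growth_le_mono[OF qg K] growth_le_mono[OF growth_le_exp_poly Q] fcg)
  \<comment> \<open>The exponential has no zeros, so the distinct zeros of H are counted through h.
    This keeps exp(Q), whose proximity may be large, out of the bound.\<close>
  have zH: "H z = 0 \<longleftrightarrow> h z = 0" for z unfolding H_def h_def by simp
  define F where "F = (\<lambda>z. f z ^ 2 * (f z + \<omega> * deriv f z))"
  interpret tumura_clunie f H P F \<omega> K
  proof
    show "F z + H z = P z" for z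
      unfolding F_def H_def fc_def eq[of z, symmetric] by (simp add: algebra_simps power2_eq_square power3_eq_cube)
  qed (use f f' g H P K F_def in auto)
  obtain C where C: "0 \<le> C" "\<forall>r\<ge>1. \<exists>s. r < s \<and> s < r + 1 \<and> (\<forall>w. norm w = s \<longrightarrow> f w \<noteq> 0 \<and> H w \<noteq> 0) \<and>
     3 * proximity f s \<le> 2 * counting_distinct f s + counting_distinct H s + C * (1 + s)"
    using truncated_second_main_bound by blast
  obtain Cq where Cq: "0 \<le> Cq" "\<And>r. 0 \<le> r \<Longrightarrow> proximity (poly q) r \<le> Cq * (1 + r) powr 1"
    using proximity_le_growth[OF qg] by blast
  \<comment> \<open>The coefficients of T on the right will add up to (\<kappa> + \<delta>) + 1 + (1
    + 3 \<delta>) = 3 - 4 \<delta>, so that 4 \<delta> T remains on the left to be compared with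
    O(r).\<close>
  define \<delta> where "\<delta> = (1 - \<kappa>) / 8"
  have \<delta>: "0 < \<delta>" "\<delta> \<le> 1 / 8" unfolding \<delta>_def using \<kappa> by auto
  \<comment> \<open>One unit allows for the choice of t in (r, r + 1), another for the zero-free
    radius R just above |c| + t.\<close>
  define L where "L = norm c + 2"
  have L: "0 < L" unfolding L_def by (simp add: add_nonneg_pos)
  define E where "E = C + Cq + \<bar>leading_ln f\<bar> + \<bar>leading_ln h\<bar>"
  have E: "0 \<le> E" unfolding E_def using C(1) Cq(1) by simp
  have "eventually (\<lambda>r. norm (\<epsilon> r) \<le> \<delta> * norm (1::real)) at_top"
    using landau_o.smallD[OF \<epsilon> \<delta>(1)] .
  with simple have "eventually (\<lambda>r. simple_zero_counting r f < (\<kappa> + \<epsilon> r) * proximity f r \<and> \<epsilon> r \<le> \<delta>) at_top"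
    by eventually_elim auto
  then obtain r1 where r1: "\<And>r. r1 \<le> r \<Longrightarrow> simple_zero_counting r f < (\<kappa> + \<epsilon> r) * proximity f r \<and> \<epsilon> r \<le> \<delta>"
    unfolding eventually_at_top_linorder by blast
  have "((\<lambda>r::real. (2 + r) / r powr s) \<longlongrightarrow> 0) at_top" using s by real_asymp
  then have "((\<lambda>r::real. E * ((2 + r) / r powr s)) \<longlongrightarrow> E * 0) at_top" by (intro tendsto_intros)
  then have "eventually (\<lambda>r::real. E * ((2 + r) / r powr s) < 4 * \<delta>) at_top"
    using \<delta> by (intro order_tendstoD(2)) auto
  then obtain r2 where r2: "\<And>r. r2 \<le> r \<Longrightarrow> E * ((2 + r) / r powr s) < 4 * \<delta>"
    unfolding eventually_at_top_linorder by blast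
  \<comment> \<open>For radii R beyond the last entry, (R + |c|) / (R - |c|) \<le> 1 +
    \<delta>.\<close>
  define b where "b = max (max r1 1) (max r2 (norm c * (2 + \<delta>) / \<delta>))"
  obtain r where r: "b \<le> r" "r powr s \<le> proximity f r" "proximity f (r + L) \<le> (1 + \<delta>) * proximity f r"
    by (rule exists_slow_growth_radius[OF up low _ \<delta>(1) L, of b]) (use s in auto)
  have rb: "r1 \<le> r" "1 \<le> r" "r2 \<le> r" "norm c * (2 + \<delta>) / \<delta> \<le> r" using r(1) unfolding b_def by auto
  obtain t where t: "r < t" "t < r + 1" "\<And>w. norm w = t \<Longrightarrow> f w \<noteq> 0 \<and> H w \<noteq> 0"
    and main: "3 * proximity f t \<le> 2 * counting_distinct f t + counting_distinct H t + C * (1 + t)"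
    using C(2) rb(2) by blast
  have t1: "1 \<le> t" using t rb by simp
  define T where "T = proximity f t"
  have Tr: "proximity f r \<le> T" unfolding T_def using rb t by (intro proximity_mono f) auto
  have T0: "0 \<le> T" unfolding T_def using t1 by (intro proximity_nonneg f) auto
  have zf: "2 * counting_distinct f t \<le> (\<kappa> + \<delta>) * T + T - leading_ln f"
  proof -
    have "2 * counting_distinct f t \<le> simple_zero_counting t f + T - leading_ln f"
      unfolding T_def by (rule distinct_zeros_le_simple_zeros[OF f(1) t1]) (use t in auto)
    moreover have "simple_zero_counting t f < (\<kappa> + \<epsilon> t) * T \<and> \<epsilon> t \<le> \<delta>"
      unfolding T_def using t rb by (intro r1) auto
    moreover have "(\<kappa> + \<epsilon> t) * T \<le> (\<kappa> + \<delta>) * T" using calculation(2) T0 by (intro mult_right_mono) auto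
    ultimately show ?thesis by linarith
  qed
  have zh: "counting_distinct H t \<le> Cq * (1 + t) + (1 + \<delta>) * ((1 + \<delta>) * T) - leading_ln h"
  proof -
    obtain R where R: "norm c + t < R" "R < norm c + t + 1" "\<And>w. norm w = R \<Longrightarrow> f w \<noteq> 0"
      using exists_zero_free_radius[OF f(1), of "norm c + t" "norm c + t + 1"] t1 by (auto simp: add_nonneg_nonneg)
    have "r \<le> norm c + t" using t(1) by (intro add_increasing) auto
    then have Rr: "r \<le> R" "R \<le> r + L" "norm c < R" using R(1,2) t(2) t1 unfolding L_def by linarith+
    have "counting_distinct H t = counting_distinct h t" unfolding zH ..
    also have "\<dots> \<le> proximity h t - leading_ln h"
      by (rule distinct_zeros_le_proximity[OF h t1]) (use t zH in auto)
    also have "proximity h t \<le> circle_mean t (\<lambda>z. log_plus (norm (poly q z)) + log_plus (norm (fc z)))"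
      using t1 unfolding h_def norm_mult
      by (intro circle_mean_mono log_plus_mult_le continuous_on_add continuous_on_log_plus continuous_on_mult
          continuous_on_norm nz_entire_cont fc qnz) auto
    also have "\<dots> = proximity (poly q) t + proximity fc t"
      using t1 by (intro circle_mean_add continuous_on_log_plus continuous_on_norm nz_entire_cont fc qnz) auto
    also have "proximity (poly q) t \<le> Cq * (1 + t)" using Cq(2)[of t] t1 by simp
    also have "proximity fc t \<le> (R + norm c) / (R - norm c) * proximity f R"
      unfolding fc_def by (rule proximity_shift_le[OF f(1) _ R(1)]) (use t1 R(3) in auto)
    also have "\<dots> \<le> (1 + \<delta>) * ((1 + \<delta>) * T)"
    proof (intro mult_mono)
      have "norm c * (2 + \<delta>) \<le> r * \<delta>" using rb(4) \<delta>(1) by (simp add: pos_divide_le_eq)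
      also have "\<dots> \<le> R * \<delta>" using Rr(1) \<delta>(1) by (intro mult_right_mono) auto
      finally have "R + norm c \<le> (1 + \<delta>) * (R - norm c)" by (simp add: algebra_simps)
      then show "(R + norm c) / (R - norm c) \<le> 1 + \<delta>" using Rr(3) by (simp add: pos_divide_le_eq)
      have "proximity f R \<le> proximity f (r + L)" using Rr rb by (intro proximity_mono f) auto
      also have "\<dots> \<le> (1 + \<delta>) * proximity f r" by (rule r(3))
      also have "\<dots> \<le> (1 + \<delta>) * T" using Tr \<delta>(1) by (intro mult_left_mono) auto
      finally show "proximity f R \<le> (1 + \<delta>) * T" .
      show "0 \<le> proximity f R" using Rr rb by (intro proximity_nonneg f) auto
    qed (use \<delta> in auto)
    finally show ?thesis by simp
  qed
  have "(1 + \<delta>) * ((1 + \<delta>) * T) = (1 + 2 * \<delta> + \<delta> * \<delta>) * T" by (simp add: algebra_simps)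
  also have "\<dots> \<le> (1 + 3 * \<delta>) * T"
    using \<delta> T0 mult_left_mono[of \<delta> 1 \<delta>] by (intro mult_right_mono) auto
  finally have sq: "(1 + \<delta>) * ((1 + \<delta>) * T) \<le> (1 + 3 * \<delta>) * T" .
  have "3 * T \<le> (\<kappa> + \<delta>) * T + T + (1 + 3 * \<delta>) * T + (C * (1 + t) + Cq * (1 + t) - leading_ln f - leading_ln h)"
    using main zf zh sq unfolding T_def[symmetric] by linarith
  also have "C * (1 + t) + Cq * (1 + t) - leading_ln f - leading_ln h \<le> E * (1 + t)"
  proof -
    have "(\<bar>leading_ln f\<bar> + \<bar>leading_ln h\<bar>) * 1 \<le> (\<bar>leading_ln f\<bar> + \<bar>leading_ln h\<bar>) * (1 + t)"
      using t1 by (intro mult_left_mono) auto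
    then show ?thesis unfolding E_def by (simp add: algebra_simps)
  qed
  also have "E * (1 + t) \<le> E * (2 + r)" using E t by (intro mult_left_mono) auto
  finally have "3 * T \<le> (\<kappa> + \<delta>) * T + T + (1 + 3 * \<delta>) * T + E * (2 + r)" by simp
  moreover have "\<kappa> = 1 - 8 * \<delta>" unfolding \<delta>_def by (simp add: field_simps)
  ultimately have "4 * \<delta> * T \<le> E * (2 + r)" by (simp add: algebra_simps)
  moreover have "E * (2 + r) < 4 * \<delta> * r powr s"
  proof -
    have "0 < r powr s" using rb by simp
    then show ?thesis using r2[OF rb(3)] by (simp add: field_simps)
  qed
  moreover have "4 * \<delta> * r powr s \<le> 4 * \<delta> * T" using r(2) Tr \<delta>(1) by (intro mult_left_mono) auto
  ultimately show False by linarith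
qed

theorem theorem1p8:
  fixes \<omega> c l\<^sub>1 l\<^sub>2 p\<^sub>1 p\<^sub>2 :: complex
    and q Q :: "complex poly"
    and f :: "complex \<Rightarrow> complex"
    and \<kappa> :: real
    and \<epsilon> :: "real \<Rightarrow> real"
  assumes "\<omega> \<noteq> 0" and "c \<noteq> 0" and "l\<^sub>1 \<noteq> 0" and "l\<^sub>2 \<noteq> 0" and "p\<^sub>1 \<noteq> 0" and "p\<^sub>2 \<noteq> 0"
    and rhs_nonzero: "l\<^sub>1 \<noteq> l\<^sub>2 \<or> p\<^sub>1 + p\<^sub>2 \<noteq> 0"
    and "degree Q > 0" and "q \<noteq> 0"
    and "transcendental_entire f"
    and "growth_order f < \<infinity>"
    and "\<And>z. f z ^ 3 + \<omega> * f z ^ 2 * deriv f z + poly q z * exp (poly Q z) * f (z + c)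
              = p\<^sub>1 * exp (l\<^sub>1 * z) + p\<^sub>2 * exp (l\<^sub>2 * z)"
    and "0 \<le> \<kappa>" and "\<kappa> < 1"
    and "\<epsilon> \<in> o[at_top](\<lambda>_. 1)"
    and "eventually (\<lambda>r. simple_zero_counting r f < (\<kappa> + \<epsilon> r) * nevanlinna_char r f) at_top"
  shows "growth_order f = ereal (real (degree Q)) \<and> degree Q = 1"
proof -
  have fh: "f holomorphic_on UNIV" using assms(10) unfolding transcendental_entire_def entire_def by blast
  have f: "nz_entire f"
  proof (rule ccontr)
    assume "\<not> nz_entire f"
    then have "f = poly 0" using fh unfolding nz_entire_def by auto
    then show False using assms(10) unfolding transcendental_entire_def by blast
  qed
  have P: "nz_entire (\<lambda>z. p\<^sub>1 * exp (l\<^sub>1 * z) + p\<^sub>2 * exp (l\<^sub>2 * z))"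
    by (rule exponential_sum_nonzero[OF assms(5) rhs_nonzero])
  have Pg: "growth_le 1 (\<lambda>z. p\<^sub>1 * exp (l\<^sub>1 * z) + p\<^sub>2 * exp (l\<^sub>2 * z))"
    by (intro growth_le_add growth_le_cmult growth_le_exp_linear) auto
  have simple: "eventually (\<lambda>r. simple_zero_counting r f < (\<kappa> + \<epsilon> r) * proximity f r) at_top"
    using assms(16) unfolding nevanlinna_char_entire[OF fh] .
  have le1: "growth_order f \<le> 1"
  proof (rule ccontr)
    assume "\<not> growth_order f \<le> 1"
    then obtain s where s: "1 < ereal s" "ereal s < growth_order f" using ereal_dense2[of 1 "growth_order f"] by (auto simp: not_le)
    obtain n :: nat where n: "growth_order f < ereal (real n)" using assms(11) less_PInf_Ex_of_nat by auto
    \<comment> \<open>A single exponent has to serve the growth of f, of P and of exp(Q).\<close>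
    define K where "K = max (max 1 (real n)) (real (degree Q))"
    have "real n \<le> K" unfolding K_def by (simp add: le_max_iff_disj)
    then have "ereal (real n) \<le> ereal K" by simp
    then have "growth_order f < ereal K" using n by (rule less_le_trans[rotated])
    then have up: "eventually (\<lambda>r. proximity f r \<le> r powr K) at_top" by (rule growth_order_less_imp[OF fh])
    have K1: "1 \<le> K" and KQ: "real (degree Q) \<le> K" unfolding K_def by auto
    have fK: "growth_le K f" using K1 by (intro growth_le_if_proximity f up) auto
    have s1: "1 < s" using s(1) by (simp add: one_ereal_def)
    have low: "frequently (\<lambda>r. r powr s \<le> proximity f r) at_top"
      using s1 by (intro growth_order_greater_imp[OF fh s(2)]) auto
    show False
      by (rule no_large_order_solution[OF f fK K1 assms(1) up s1 low assms(9) KQ P Pg assms(12-15) simple])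
  qed
  \<comment> \<open>Order at most one does not give finite type at exponent one, so a slightly
    larger exponent is used; any value below 2 still forces the integer deg Q to be at most
    1.\<close>
  have "growth_order f < ereal (3/2)" using le1 by (rule le_less_trans) (simp add: one_ereal_def)
  from growth_order_less_imp[OF fh this] have f32: "growth_le (3/2) f"
    by (intro growth_le_if_proximity f) auto
  have deg: "degree Q = 1"
  proof -
    define h where "h = (\<lambda>z. poly q z * f (c + z))"
    define E where "E = (\<lambda>z. (p\<^sub>1 * exp (l\<^sub>1 * z) + p\<^sub>2 * exp (l\<^sub>2 * z)) - (f z ^ 3 + \<omega> * f z ^ 2 * deriv f z))"
    have hg: "growth_le (3/2) h"
      unfolding h_def by (intro growth_le_mult growth_le_poly growth_le_shift f32) auto
    have h: "nz_entire h" unfolding h_def by (intro nz_entire_mult nz_entire_poly nz_entire_shift f assms(9))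
    have Eg: "growth_le (3/2) E" unfolding E_def
      by (intro growth_le_diff growth_le_mono[OF Pg] growth_le_add growth_le_mult growth_le_power growth_le_const growth_le_deriv f32) auto
    have "exp (poly Q z) * h z = E z" for z
      using assms(12)[of z] unfolding h_def E_def by (simp add: algebra_simps)
    from degree_le_growth[OF h hg Eg _ this assms(8)] have "real (degree Q) \<le> 3/2" by simp
    then show ?thesis using assms(8) by linarith
  qed
  have ge1: "1 \<le> growth_order f"
  proof (rule ccontr)
    assume "\<not> 1 \<le> growth_order f"
    then obtain s where s: "growth_order f < ereal s" "ereal s < 1" using ereal_dense2[of _ 1] by (auto simp: not_le)
    \<comment> \<open>The exponent has to be positive for the polynomial coefficient q to have
      growth at most s'.\<close>
    define s' where "s' = max s (1/2)"
    have s': "0 < s'" "s' < 1" unfolding s'_def using s(2) by (auto simp: one_ereal_def)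
    have "growth_order f < ereal s'" using s(1) by (rule less_le_trans) (simp add: s'_def)
    from growth_order_less_imp[OF fh this] have fs: "growth_le s' f"
      using s' by (intro growth_le_if_proximity f) auto
    obtain b a where Q: "Q = [:b, a:]" "a \<noteq> 0" using deg by (metis degree1_coeffs)
    show False
      by (rule no_small_order_solution[OF f fs s' assms(1) Q(2) assms(3,4), of q b c p\<^sub>1 p\<^sub>2])
         (use assms(12) in \<open>simp add: Q(1) mult.commute\<close>)
  qed
  have "growth_order f = 1" using le1 ge1 by (rule antisym)
  then show ?thesis using deg by (simp add: one_ereal_def)
qed

end
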